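(* Exceptional radial eigencubics with $n_1=0$ exist exactly in the types $(0,3\ell+2)$ with $\ell\in\{1,2,4\}$: that is, there exists an exceptional radial eigencubic of type $(0,n_2)$ if and only if $n_2\in\{5,8,14\}$.
   Context: For a polynomial $f$ on $\mathbb{R}^n$ put $L(f)=|\nabla f|^2\Delta f-\sum_{i,j=1}^n f_{x_i}f_{x_j}f_{x_ix_j}$. A radial eigencubic in $\mathbb{R}^n$ is a homogeneous polynomial $f\not\equiv 0$ of degree 3 such that $L(f)=\lambda |x|^2 f$ for some constant $\lambda\in\mathbb{R}$, where it is assumed that $\lambda\neq 0$. Two cubic forms $f_1,f_2$ on $\mathbb{R}^n$ are congruent if $f_1(x)=cf_2(Ux)$ for some $U\in O(n)$ and some real $c\ne0$. Every radial eigencubic admits a normal form: an orthogonal decomposition $\mathbb{R}^n=\mathrm{span}(e_n)\oplus V_1\oplus V_2\oplus V_3$ ($e_n$ a unit vector, the $V_i$ possibly zero) such that, writing $x=x_ne_n+\xi+\eta+\zeta$ with $\xi\in V_1,\eta\in V_2,\zeta\in V_3$, after multiplication of $f$ by a nonzero constant, $$f=x_n^3-\tfrac32x_n(2|\xi|^2+|\eta|^2-|\zeta|^2)+\psi_{111}+\psi_{102}+\psi_{012}+\psi_{030},$$ where $\psi_{ijk}$ is homogeneous of degree $i$ in $\xi$, $j$ in $\eta$ and $k$ in $\zeta$. The type of $f$ is the pair $(n_1,n_2)=(\dim V_1,\dim V_2)$, which is independent of the normal form; one has $n=3n_1+2n_2-1$. For $m\ge1$, $q\ge0$, a symmetric Clifford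 system $\mathcal{A}=\{A_0,\dots,A_q\}\in\mathrm{Cliff}(\mathbb{R}^{2m},q)$ is a system of symmetric endomorphisms of $\mathbb{R}^{2m}$ with $A_iA_j+A_jA_i=2\delta_{ij}\mathbf{1}$ (and, when $q=0$, $\operatorname{tr}A_0=0$). To it one associates the radial eigencubic $C_{\mathcal A}(z,y)=\sum_{i=0}^q\langle y,A_iy\rangle z_{i+1}$ on $\mathbb{R}^{q+1}\times\mathbb{R}^{2m}$. A radial eigencubic is exceptional if it is not congruent to any $C_{\mathcal A}$. *)

theory Defs
  imports "HOL-Analysis.Derivative" "Jordan_Normal_Form.DL_Rank"
begin

no_notation inner (infix "\<bullet>" 70)
no_notation Finite_Cartesian_Product.vec_nth (infixl "$" 90)

text \<open>
  Since the dimension \<open>n\<close> is quantified over, $\mathbb{R}^n$ is the set \<open>carrier_vec n\<close> of vectors of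
  length \<open>n\<close>. A function on $\mathbb{R}^n$ is a function on all vectors of which only the values on
  \<open>carrier_vec n\<close> matter. Coordinates are numbered from \<open>0\<close>.
\<close>

type_synonym rvec = "real Matrix.vec"

definition cubic_form :: "nat \<Rightarrow> (rvec \<Rightarrow> real) \<Rightarrow> bool" where
  "cubic_form n f \<longleftrightarrow> (\<exists>c :: nat \<Rightarrow> nat \<Rightarrow> nat \<Rightarrow> real. \<forall>x \<in> carrier_vec n.
     f x = (\<Sum>i<n. \<Sum>j<n. \<Sum>k<n. c i j k * x $ i * x $ j * x $ k))"

definition partial :: "nat \<Rightarrow> nat \<Rightarrow> (rvec \<Rightarrow> real) \<Rightarrow> rvec \<Rightarrow> real" where
  "partial n i f x = deriv (\<lambda>t. f (x + t \<cdot>\<^sub>v unit_vec n i)) 0"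

definition hsiang_op :: "nat \<Rightarrow> (rvec \<Rightarrow> real) \<Rightarrow> rvec \<Rightarrow> real" where
  "hsiang_op n f x =
     (\<Sum>i<n. (partial n i f x)\<^sup>2) * (\<Sum>i<n. partial n i (partial n i f) x)
     - (\<Sum>i<n. \<Sum>j<n. partial n i f x * partial n j f x * partial n j (partial n i f) x)"

definition radial_eigencubic :: "nat \<Rightarrow> (rvec \<Rightarrow> real) \<Rightarrow> bool" where
  "radial_eigencubic n f \<longleftrightarrow>
     cubic_form n f \<and> (\<exists>x \<in> carrier_vec n. f x \<noteq> 0) \<and>
     (\<exists>l :: real. l \<noteq> 0 \<and> (\<forall>x \<in> carrier_vec n. hsiang_op n f x = l * (x \<bullet> x) * f x))"

text \<open>
  The library's \<open>orthogonal_mat\<close> only requires mutually orthogonal nonzero columns, so membership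
  in $O(n)$ is stated as $U^T U = 1$.
\<close>

definition congruent :: "nat \<Rightarrow> (rvec \<Rightarrow> real) \<Rightarrow> (rvec \<Rightarrow> real) \<Rightarrow> bool" where
  "congruent n f g \<longleftrightarrow>
     (\<exists>U \<in> carrier_mat n n. \<exists>c :: real. transpose_mat U * U = 1\<^sub>m n \<and> c \<noteq> 0 \<and>
        (\<forall>x \<in> carrier_vec n. f x = c * g (U *\<^sub>v x)))"

definition clifford_system :: "nat \<Rightarrow> nat \<Rightarrow> (nat \<Rightarrow> real mat) \<Rightarrow> bool" where
  "clifford_system m q A \<longleftrightarrow>
     m \<ge> 1 \<and>
     (\<forall>i\<le>q. A i \<in> carrier_mat (2 * m) (2 * m) \<and> transpose_mat (A i) = A i) \<and>
     (\<forall>i\<le>q. \<forall>j\<le>q. A i * A j + A j * A i = (if i = j then 2 else 0) \<cdot>\<^sub>m 1\<^sub>m (2 * m)) \<and>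
     (q = 0 \<longrightarrow> (\<Sum>i<2 * m. A 0 $$ (i, i)) = 0)"

text \<open>
  $\mathbb{R}^{q+1}\times\mathbb{R}^{2m}$ is identified with $\mathbb{R}^{q+1+2m}$ by
  concatenation, \<open>x = z @\<^sub>v y\<close>.
\<close>

definition clifford_cubic :: "nat \<Rightarrow> nat \<Rightarrow> (nat \<Rightarrow> real mat) \<Rightarrow> rvec \<Rightarrow> real" where
  "clifford_cubic m q A x =
     (let z = vec_first x (q + 1); y = vec_last x (2 * m)
      in \<Sum>i\<le>q. (y \<bullet> (A i *\<^sub>v y)) * z $ i)"

definition exceptional :: "nat \<Rightarrow> (rvec \<Rightarrow> real) \<Rightarrow> bool" where
  "exceptional n f \<longleftrightarrow>
     radial_eigencubic n f \<and>
     \<not> (\<exists>m q A. clifford_system m q A \<and> n = q + 1 + 2 * m \<and> congruent n f (clifford_cubic m q A))"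

abbreviation is_subspace :: "nat \<Rightarrow> rvec set \<Rightarrow> bool" where
  "is_subspace n V \<equiv> VectorSpace.subspace class_ring V (module_vec TYPE(real) n)"

abbreviation subspace_dim :: "nat \<Rightarrow> rvec set \<Rightarrow> nat" where
  "subspace_dim n V \<equiv> vectorspace.dim class_ring ((module_vec TYPE(real) n)\<lparr>carrier := V\<rparr>)"

definition orthogonal_sets :: "rvec set \<Rightarrow> rvec set \<Rightarrow> bool" where
  "orthogonal_sets V W \<longleftrightarrow> (\<forall>v \<in> V. \<forall>w \<in> W. v \<bullet> w = 0)"

definition orthogonal_decomposition ::
  "nat \<Rightarrow> rvec \<Rightarrow> rvec set \<Rightarrow> rvec set \<Rightarrow> rvec set \<Rightarrow> bool" where
  "orthogonal_decomposition n e V1 V2 V3 \<longleftrightarrow>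
     e \<in> carrier_vec n \<and> e \<bullet> e = 1 \<and>
     is_subspace n V1 \<and> is_subspace n V2 \<and> is_subspace n V3 \<and>
     orthogonal_sets {e} V1 \<and> orthogonal_sets {e} V2 \<and> orthogonal_sets {e} V3 \<and>
     orthogonal_sets V1 V2 \<and> orthogonal_sets V1 V3 \<and> orthogonal_sets V2 V3 \<and>
     (\<forall>x \<in> carrier_vec n. \<exists>t. \<exists>\<xi> \<in> V1. \<exists>\<eta> \<in> V2. \<exists>\<zeta> \<in> V3. x = t \<cdot>\<^sub>v e + \<xi> + \<eta> + \<zeta>)"

text \<open>
  A cubic form in $(\xi,\eta,\zeta)$, homogeneous of degree $i$ in $\xi$, $j$ in $\eta$ and $k$ in
  $\zeta$, is represented by its extension to $\mathbb{R}^n$ that does not depend on the coordinate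
  along $e$; the arbitrary \<open>t\<close> below expresses this independence.
\<close>

definition trihomogeneous ::
  "nat \<Rightarrow> rvec \<Rightarrow> rvec set \<Rightarrow> rvec set \<Rightarrow> rvec set \<Rightarrow> nat \<Rightarrow> nat \<Rightarrow> nat \<Rightarrow> (rvec \<Rightarrow> real) \<Rightarrow> bool" where
  "trihomogeneous n e V1 V2 V3 i j k \<psi> \<longleftrightarrow>
     cubic_form n \<psi> \<and>
     (\<forall>t a b c. \<forall>\<xi> \<in> V1. \<forall>\<eta> \<in> V2. \<forall>\<zeta> \<in> V3.
        \<psi> (t \<cdot>\<^sub>v e + a \<cdot>\<^sub>v \<xi> + b \<cdot>\<^sub>v \<eta> + c \<cdot>\<^sub>v \<zeta>) = a ^ i * b ^ j * c ^ k * \<psi> (\<xi> + \<eta> + \<zeta>))"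

definition normal_form ::
  "nat \<Rightarrow> (rvec \<Rightarrow> real) \<Rightarrow> rvec \<Rightarrow> rvec set \<Rightarrow> rvec set \<Rightarrow> rvec set \<Rightarrow> bool" where
  "normal_form n f e V1 V2 V3 \<longleftrightarrow>
     orthogonal_decomposition n e V1 V2 V3 \<and>
     (\<exists>(c :: real) \<psi>111 \<psi>102 \<psi>012 \<psi>030. c \<noteq> 0 \<and>
        trihomogeneous n e V1 V2 V3 1 1 1 \<psi>111 \<and>
        trihomogeneous n e V1 V2 V3 1 0 2 \<psi>102 \<and>
        trihomogeneous n e V1 V2 V3 0 1 2 \<psi>012 \<and>
        trihomogeneous n e V1 V2 V3 0 3 0 \<psi>030 \<and>
        (\<forall>t. \<forall>\<xi> \<in> V1. \<forall>\<eta> \<in> V2. \<forall>\<zeta> \<in> V3.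
           (let x = t \<cdot>\<^sub>v e + \<xi> + \<eta> + \<zeta> in
            c * f x = t ^ 3 - 3 / 2 * t * (2 * (\<xi> \<bullet> \<xi>) + \<eta> \<bullet> \<eta> - \<zeta> \<bullet> \<zeta>)
              + \<psi>111 x + \<psi>102 x + \<psi>012 x + \<psi>030 x)))"

text \<open>
  The dimensions do not depend on the chosen normal form, so \<open>f\<close> having type $(n_1,n_2)$ is
  expressed by the existence of a normal form with these dimensions.
\<close>

definition has_type :: "nat \<Rightarrow> (rvec \<Rightarrow> real) \<Rightarrow> nat \<times> nat \<Rightarrow> bool" where
  "has_type n f \<tau> \<longleftrightarrow>
     (\<exists>e V1 V2 V3. normal_form n f e V1 V2 V3 \<and> \<tau> = (subspace_dim n V1, subspace_dim n V2))"

end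

theory Submission
  imports Defs "HOL-Analysis.Analysis"
begin

text \<open>
  A cubic form is the same thing as a commutative product with $f(x)=\langle x\cdot x,x\rangle$ whose
  multiplications $L_x$ are symmetric, and the eigencubic equation becomes
  $|x^2|^2\,\mathrm{tr}\,L_x-\langle x^2,x\cdot x^2\rangle=\lambda|x|^2 f(x)$. In a normal form with $V_1=0$ the unit vector
  $e$ is an idempotent with eigenspaces $V_2$ and $V_3$. Comparing coefficients in the equation along $te+\eta+\zeta$ shows
  that $V_2\oplus V_3$, with the product projected off $e$, is a $\mathbb{Z}/2$-graded algebra with
  $|\eta^2|=|\eta|^2$, $|\zeta^2|=|\zeta|^2$ and $\dim V_2=\dim V_3+2$. Pick an idempotent $c\in V_2$ and split
  $V_2=\mathbb{R}c\oplus Y\oplus Z$, $V_3=Y'\oplus Z'$ into eigenspaces of $L_c$. If $Z=0$, or if $\dim Y=1$, the cubic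
  has a linear factor and is a Clifford cubic with $q=0$. Otherwise, with $m=\dim Y'=\dim Y-1$, one gets $\dim Z=2m$ and
  $\dim V_2=3m+2$. The multiplications by $Y$ and $Y'$ are two Clifford systems on $Z\oplus Z'$ that commute with each other;
  products of four generators give $m-1$ commuting involutions of $Z$, each anticommuting with some map that commutes with the
  others, whence $2^{m-1}$ divides $2m$ and $m\in\{1,2,4\}$.

  Conversely, the cubic norm of the Hermitian $3\times3$ matrices over the split complex numbers, quaternions and octonions,
  with a Euclidean inner product, satisfies $x^2\cdot x^2=\frac43\langle x^2,x\rangle x$, so it is a radial eigencubic, of
  dimension $n=9,15,27$ and $n_2=(n+1)/2$. A Clifford cubic satisfying this identity must have $q=0$, hence a linear factor, and
  this is excluded because the squares of all coordinate vectors vanish while the cubic contains two monomials without common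
  variable.
\<close>

hide_const (open) VectorSpace.subspace Matrix.orthogonal
hide_fact (open) VectorSpace.subspace_def Matrix.orthogonal_def
no_notation inner (infix "\<bullet>" 70)

section \<open>Orthonormal bases and traces\<close>

text \<open>The trace conditions at an idempotent give only dim Z' = dim Z and dim Y = dim Y' + 1.
  The missing relation comes from the square of a unit vector z of Z: its component h in Y acts on Z
  with eigenvalues among 3/4 and -3/4, and the lower eigenspace is counted twice, as half of Z and
  as a copy of the complement of h in Y. The first count needs a second direction in Y, which is why
  dim Y = 1 is set apart; there an idempotent at 120 degrees to c has no eigenspace for 1/2.
  Multiplications by Y' exchange Z and Z', so only even products of them act on Z, and a product of
  two anticommuting involutions squares to -1; two factors from each system are what gives
  involutions of Z. Idempotents arise as squares of unit vectors of V3, so V3 = 0 needs a separate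
  argument on a circle. In the converse, the identity for x^2 x^2 forces (x^2)^2 = 0 whenever the
  cubic vanishes at x, and this is what fails for Clifford cubics with q at least 1.\<close>

definition onb :: "'a::real_inner set \<Rightarrow> 'a set \<Rightarrow> bool" where
  "onb B S \<longleftrightarrow> finite B \<and> (\<forall>x\<in>B. \<forall>y\<in>B. inner x y = (if x = y then 1 else 0)) \<and> span B = S"

lemma onb_finite: "onb B S \<Longrightarrow> finite B"
  and onb_span: "onb B S \<Longrightarrow> span B = S"
  and onb_inner_basis: "onb B S \<Longrightarrow> x \<in> B \<Longrightarrow> y \<in> B \<Longrightarrow> inner x y = (if x = y then 1 else 0)"
  and onb_subset: "onb B S \<Longrightarrow> B \<subseteq> S"
  and onb_subspace: "onb B S \<Longrightarrow> subspace S"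
  by (auto simp: onb_def intro: span_base)

lemma onb_expand:
  assumes "onb B S" "x \<in> S"
  shows "(\<Sum>b\<in>B. inner x b *\<^sub>R b) = x"
proof -
  have fin: "finite B" using assms(1) by (rule onb_finite)
  have "x \<in> span B" using assms onb_span by blast
  then show ?thesis
  proof (induction rule: span_induct_alt)
    case base
    then show ?case by simp
  next
    case (step c a y)
    have "(\<Sum>b\<in>B. inner (c *\<^sub>R a + y) b *\<^sub>R b) = c *\<^sub>R (\<Sum>b\<in>B. inner a b *\<^sub>R b) + (\<Sum>b\<in>B. inner y b *\<^sub>R b)"
      by (simp add: inner_add_left scaleR_add_left sum.distrib scaleR_right.sum)
    moreover have "(\<Sum>b\<in>B. inner a b *\<^sub>R b) = (\<Sum>b\<in>B. if b = a then b else 0)"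
      by (rule sum.cong) (use onb_inner_basis[OF assms(1)] step(1) in auto)
    ultimately show ?case using step fin by simp
  qed
qed

lemma onb_inner:
  assumes "onb B S" "x \<in> S"
  shows "inner x y = (\<Sum>b\<in>B. inner x b * inner y b)"
proof -
  have "inner x y = inner (\<Sum>b\<in>B. inner x b *\<^sub>R b) y" using onb_expand[OF assms] by simp
  then show ?thesis by (simp add: inner_sum_left inner_commute[of y])
qed

lemma onb_dim:
  assumes "onb B S"
  shows "dim S = card B"
proof -
  have "pairwise orthogonal B" "0 \<notin> B"
    using onb_inner_basis[OF assms] by (auto simp: pairwise_def orthogonal_def) force+
  then have "independent B" by (rule pairwise_orthogonal_independent)
  then show ?thesis using onb_span[OF assms] dim_span_eq_card_independent by blast
qed

text \<open>The ambient type may be infinite-dimensional, so finite dimension of S enters through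
  the finite spanning set A. An orthogonal generating set is normalised after 0 is removed from
  it.\<close>

lemma onb_exists:
  assumes "subspace S" "S \<subseteq> span A" "finite A"
  obtains B where "onb B S"
proof -
  obtain T where T: "T \<subseteq> S" "independent T" "S \<subseteq> span T" using basis_exists by metis
  have finT: "finite T" using independent_span_bound[OF assms(3) T(2)] T(1) assms(2) by blast
  obtain C where C: "finite C" "span C = span T" "pairwise orthogonal C"
    using basis_orthogonal[OF finT] by auto
  have sT: "span T = S" using T assms(1) by (simp add: span_minimal subset_antisym)
  define B where "B = (\<lambda>x. x /\<^sub>R norm x) ` (C - {0})"
  have fB: "finite B" using C by (simp add: B_def)
  have "inner x y = (if x = y then 1 else 0)" if xy: "x \<in> B" "y \<in> B" for x y
  proof -
    obtain u v where uv: "u \<in> C" "v \<in> C" "u \<noteq> 0" "v \<noteq> 0" "x = u /\<^sub>R norm u" "y = v /\<^sub>R norm v"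
      using xy by (auto simp: B_def)
    show ?thesis
    proof (cases "u = v")
      case True
      then show ?thesis using uv by (simp add: dot_square_norm power2_eq_square)
    next
      case False
      then have "inner u v = 0" using C(3) uv by (auto simp: pairwise_def orthogonal_def)
      then have "inner x y = 0" using uv by simp
      moreover have "inner x x = 1" using uv by (simp add: dot_square_norm power2_eq_square)
      ultimately show ?thesis by auto
    qed
  qed
  moreover have "span B = span C"
  proof
    have "x /\<^sub>R norm x \<in> span C" if "x \<in> C" for x using that by (simp add: span_base span_mul)
    then show "span B \<subseteq> span C" unfolding B_def by (intro span_minimal) auto
    have "x \<in> span B" if "x \<in> C" for x
    proof (cases "x = 0")
      case False
      then have "x /\<^sub>R norm x \<in> span B" using that by (intro span_base) (auto simp: B_def)
      then have "norm x *\<^sub>R (x /\<^sub>R norm x) \<in> span B" by (rule span_mul)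
      then show ?thesis using False by simp
    qed (simp add: span_zero)
    then show "span C \<subseteq> span B" by (intro span_minimal) auto
  qed
  ultimately have "onb B S" using fB C sT by (auto simp: onb_def)
  then show ?thesis by (rule that)
qed

lemma onb_sub_exists:
  assumes "onb A V" "subspace S" "S \<subseteq> V"
  obtains B where "onb B S"
proof -
  have "S \<subseteq> span A" using assms onb_span by blast
  then show ?thesis using onb_exists[OF assms(2) _ onb_finite[OF assms(1)]] that by blast
qed

lemma onb_insert:
  assumes "onb B S" "inner v v = 1" "\<And>x. x \<in> S \<Longrightarrow> inner v x = 0" "subspace T" "v \<in> T" "S \<subseteq> T"
    "\<And>x. x \<in> T \<Longrightarrow> x - inner x v *\<^sub>R v \<in> S"
  shows "onb (insert v B) T" "v \<notin> B"
proof -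
  have BS: "B \<subseteq> S" using assms onb_subset by blast
  show "v \<notin> B" using assms(2,3) BS by force
  have "span (insert v B) = T"
  proof
    show "span (insert v B) \<subseteq> T" using BS assms by (intro span_minimal) auto
    show "T \<subseteq> span (insert v B)"
    proof
      fix x assume "x \<in> T"
      then have "x - inner x v *\<^sub>R v \<in> span B" using assms onb_span by blast
      then show "x \<in> span (insert v B)" by (auto simp: span_insert)
    qed
  qed
  moreover have "inner x y = (if x = y then 1 else 0)" if "x \<in> insert v B" "y \<in> insert v B" for x y
  proof -
    have "inner v z = 0" "inner z v = 0" if "z \<in> B" for z
      using assms(3)[of z] BS that by (auto simp: inner_commute)
    then show ?thesis
      using that onb_inner_basis[OF assms(1), of x y] assms(2) \<open>v \<notin> B\<close> by auto
  qed
  ultimately show "onb (insert v B) T" using onb_finite[OF assms(1)] by (auto simp: onb_def)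
qed

lemma onb_Un:
  assumes "onb B S" "onb C T" "\<And>x y. x \<in> S \<Longrightarrow> y \<in> T \<Longrightarrow> inner x y = 0" "subspace U"
    "S \<subseteq> U" "T \<subseteq> U" "\<And>x. x \<in> U \<Longrightarrow> \<exists>y\<in>S. \<exists>z\<in>T. x = y + z"
  shows "onb (B \<union> C) U" "B \<inter> C = {}"
proof -
  have sub: "B \<subseteq> S" "C \<subseteq> T" using assms onb_subset by blast+
  have n: "inner x x = 1" if "x \<in> B" for x using onb_inner_basis[OF assms(1) that that] by simp
  show disj: "B \<inter> C = {}" using assms(3) sub n by fastforce
  have o: "inner x y = 0" "inner y x = 0" if "x \<in> B" "y \<in> C" for x y
    using assms(3)[of x y] sub that by (auto simp: inner_commute)
  have "span (B \<union> C) = U"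
  proof
    show "span (B \<union> C) \<subseteq> U" using sub assms by (intro span_minimal) auto
    show "U \<subseteq> span (B \<union> C)"
    proof
      fix x assume "x \<in> U"
      then obtain y z where "y \<in> span B" "z \<in> span C" "x = y + z"
        using assms(7) onb_span[OF assms(1)] onb_span[OF assms(2)] by blast
      then show "x \<in> span (B \<union> C)"
        by (meson span_add span_mono sup_ge1 sup_ge2 subsetD)
    qed
  qed
  moreover have "inner x y = (if x = y then 1 else 0)" if "x \<in> B \<union> C" "y \<in> B \<union> C" for x y
    using that onb_inner_basis[OF assms(1)] onb_inner_basis[OF assms(2)] o disj by auto
  ultimately show "onb (B \<union> C) U" using onb_finite[OF assms(1)] onb_finite[OF assms(2)] by (auto simp: onb_def)
qed

lemma onb_image:
  assumes "onb B S" "linear T" "\<And>x y. x \<in> S \<Longrightarrow> y \<in> S \<Longrightarrow> inner (T x) (T y) = inner x y"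
  shows "onb (T ` B) (T ` S)" "card (T ` B) = card B"
proof -
  have BS: "B \<subseteq> S" using assms onb_subset by blast
  have inj: "inj_on T B"
  proof (rule inj_onI)
    fix x y assume xy: "x \<in> B" "y \<in> B" "T x = T y"
    have "inner x y = inner (T x) (T y)" "inner x x = inner (T x) (T x)"
      using assms(3) BS xy(1,2) by (simp_all add: subset_iff)
    with xy have "inner x y = inner x x" by simp
    then show "x = y" using onb_inner_basis[OF assms(1)] xy by (auto split: if_splits)
  qed
  show "card (T ` B) = card B" using inj by (rule card_image)
  have "span (T ` B) = T ` S" using linear_span_image[OF assms(2)] onb_span[OF assms(1)] by simp
  moreover have "inner (T x) (T y) = (if T x = T y then 1 else 0)" if "x \<in> B" "y \<in> B" for x y
  proof -
    have "inner (T x) (T y) = inner x y" using assms(3) BS that by (simp add: subset_iff)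
    also have "\<dots> = (if x = y then 1 else 0)" using onb_inner_basis[OF assms(1) that] .
    finally show ?thesis using inj that by (auto dest: inj_onD)
  qed
  ultimately show "onb (T ` B) (T ` S)" using onb_finite[OF assms(1)] by (auto simp: onb_def)
qed

lemma onb_vanish:
  assumes "onb B S" "x \<in> S" "\<And>y. y \<in> S \<Longrightarrow> inner x y = 0"
  shows "x = 0"
  using assms(3)[of x] assms(2) by simp

text \<open>A trace relative to an orthonormal set, because the ambient type has no trace of its
  own. A need not preserve the span of B: the number is the trace of the compression of A to that
  span.\<close>

definition trace_on :: "'a::real_inner set \<Rightarrow> ('a \<Rightarrow> 'a) \<Rightarrow> real" where
  "trace_on B A = (\<Sum>b\<in>B. inner (A b) b)"

lemma trace_on_unique:
  assumes "onb B S" "onb C S" "linear A"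
  shows "trace_on B A = trace_on C A"
proof -
  have "trace_on B A = (\<Sum>b\<in>B. inner (A b) (\<Sum>c\<in>C. inner b c *\<^sub>R c))"
    unfolding trace_on_def by (rule sum.cong) (use onb_expand[OF assms(2)] onb_subset[OF assms(1)] in auto)
  also have "\<dots> = (\<Sum>c\<in>C. inner (A (\<Sum>b\<in>B. inner c b *\<^sub>R b)) c)"
    by (subst linear_sum[OF assms(3)])
      (simp add: inner_sum_right inner_sum_left linear_scale[OF assms(3)] sum.swap[of _ B] inner_commute)
  also have "\<dots> = trace_on C A"
    unfolding trace_on_def by (rule sum.cong) (use onb_expand[OF assms(1)] onb_subset[OF assms(2)] in auto)
  finally show ?thesis .
qed

lemma trace_on_Un: "finite B \<Longrightarrow> finite C \<Longrightarrow> B \<inter> C = {} \<Longrightarrow> trace_on (B \<union> C) A = trace_on B A + trace_on C A"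
  unfolding trace_on_def by (rule sum.union_disjoint)

lemma trace_on_insert: "finite B \<Longrightarrow> v \<notin> B \<Longrightarrow> trace_on (insert v B) A = inner (A v) v + trace_on B A"
  unfolding trace_on_def by (rule sum.insert)

lemma trace_on_scale:
  assumes "onb B S" "\<And>x. x \<in> S \<Longrightarrow> A x = c *\<^sub>R x"
  shows "trace_on B A = c * card B"
proof -
  have "trace_on B A = (\<Sum>b\<in>B. c)"
    unfolding trace_on_def
    by (rule sum.cong) (use assms onb_subset[OF assms(1)] onb_inner_basis[OF assms(1)] in auto)
  then show ?thesis by simp
qed

section \<open>Divisibility of dimensions from anticommuting involutions\<close>

lemma subspace_eigen: "linear Q \<Longrightarrow> subspace S \<Longrightarrow> subspace {x \<in> S. Q x = c *\<^sub>R x}"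
  by (auto simp: subspace_def linear_add linear_scale linear_0 scaleR_add_right)

text \<open>F exchanges the eigenspaces of Q for 1 and -1 isometrically, since it anticommutes with
  Q, and S is their orthogonal sum.\<close>

lemma onb_halve:
  assumes B: "onb B S"
    and Q: "linear Q" "\<And>x. x \<in> S \<Longrightarrow> Q x \<in> S" "\<And>x y. x \<in> S \<Longrightarrow> y \<in> S \<Longrightarrow> inner (Q x) y = inner x (Q y)"
      "\<And>x. x \<in> S \<Longrightarrow> Q (Q x) = x"
    and F: "linear F" "\<And>x. x \<in> S \<Longrightarrow> F x \<in> S" "\<And>x y. x \<in> S \<Longrightarrow> y \<in> S \<Longrightarrow> inner (F x) y = inner x (F y)"
      "\<And>x. x \<in> S \<Longrightarrow> F (F x) = x" "\<And>x. x \<in> S \<Longrightarrow> F (Q x) = - Q (F x)"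
  obtains C where "onb C {x \<in> S. Q x = x}" "card B = 2 * card C"
proof -
  let ?P = "{x \<in> S. Q x = x}" and ?N = "{x \<in> S. Q x = - x}"
  note sS = onb_subspace[OF B]
  have "subspace ?P" using subspace_eigen[OF Q(1) sS, of 1] by simp
  then obtain C where C: "onb C ?P" using onb_sub_exists[OF B] by blast
  have iso: "inner (F x) (F y) = inner x y" if "x \<in> S" "y \<in> S" for x y
    using F(2,3,4) that by metis
  have im: "F ` ?P = ?N"
  proof
    show "F ` ?P \<subseteq> ?N" using F(2) F(5) by (auto, metis add.inverse_inverse)
    show "?N \<subseteq> F ` ?P"
    proof
      fix x assume x: "x \<in> ?N"
      then have "Q (F x) = F x" using F(5)[of x] linear_neg[OF F(1)] by simp
      then have "F x \<in> ?P" using F(2) x by auto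
      moreover have "x = F (F x)" using F(4) x by simp
      ultimately show "x \<in> F ` ?P" by blast
    qed
  qed
  have D: "onb (F ` C) ?N" "card (F ` C) = card C"
    using onb_image[OF C F(1)] iso im by auto
  have orth: "inner x y = 0" if "x \<in> ?P" "y \<in> ?N" for x y
    using Q(3)[of x y] that by auto
  have split: "\<exists>y\<in>?P. \<exists>z\<in>?N. x = y + z" if "x \<in> S" for x
  proof (intro bexI)
    show "x = (1/2) *\<^sub>R (x + Q x) + (1/2) *\<^sub>R (x - Q x)" by (simp add: algebra_simps flip: scaleR_add_left)
    show "(1/2) *\<^sub>R (x + Q x) \<in> ?P" "(1/2) *\<^sub>R (x - Q x) \<in> ?N"
      using that Q sS by (auto simp: linear_add linear_diff linear_scale subspace_add subspace_scale subspace_diff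
          algebra_simps)
  qed
  have "onb (C \<union> F ` C) S" "C \<inter> F ` C = {}"
    using onb_Un[OF C D(1) orth sS _ _ split] by auto
  then have "card B = card C + card (F ` C)"
    using onb_dim[OF B] onb_dim[of "C \<union> F ` C" S] onb_finite[OF C] by (simp add: card_Un_disjoint)
  then show ?thesis using that C D(2) by simp
qed

text \<open>Each step halves the dimension by passing to the 1-eigenspace of the last involution.
  The remaining \<open>Q i\<close> and \<open>F i\<close> commute with that involution, hence
  restrict to the eigenspace, and the induction continues there.\<close>

lemma power2_dvd_card_onb:
  assumes "onb B S"
    and "\<And>i. i < k \<Longrightarrow> linear (Q i)" "\<And>i x. i < k \<Longrightarrow> x \<in> S \<Longrightarrow> Q i x \<in> S"
      "\<And>i x y. i < k \<Longrightarrow> x \<in> S \<Longrightarrow> y \<in> S \<Longrightarrow> inner (Q i x) y = inner x (Q i y)"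
      "\<And>i x. i < k \<Longrightarrow> x \<in> S \<Longrightarrow> Q i (Q i x) = x"
      "\<And>i j x. i < k \<Longrightarrow> j < k \<Longrightarrow> i \<noteq> j \<Longrightarrow> x \<in> S \<Longrightarrow> Q i (Q j x) = Q j (Q i x)"
    and "\<And>i. i < k \<Longrightarrow> linear (F i)" "\<And>i x. i < k \<Longrightarrow> x \<in> S \<Longrightarrow> F i x \<in> S"
      "\<And>i x y. i < k \<Longrightarrow> x \<in> S \<Longrightarrow> y \<in> S \<Longrightarrow> inner (F i x) y = inner x (F i y)"
      "\<And>i x. i < k \<Longrightarrow> x \<in> S \<Longrightarrow> F i (F i x) = x"
      "\<And>i x. i < k \<Longrightarrow> x \<in> S \<Longrightarrow> F i (Q i x) = - Q i (F i x)"
      "\<And>i j x. i < k \<Longrightarrow> j < k \<Longrightarrow> i \<noteq> j \<Longrightarrow> x \<in> S \<Longrightarrow> F i (Q j x) = Q j (F i x)"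
  shows "2 ^ k dvd card B"
  using assms
proof (induction k arbitrary: B S)
  case 0
  then show ?case by simp
next
  case (Suc k)
  obtain C where C: "onb C {x \<in> S. Q k x = x}" "card B = 2 * card C"
    by (rule onb_halve[OF Suc.prems(1), of "Q k" "F k"]) (use Suc.prems(2-) in auto)
  have k: "k < Suc k" and ik: "i < k \<Longrightarrow> i < Suc k \<and> i \<noteq> k" for i by auto
  have "2 ^ k dvd card C"
  proof (rule Suc.IH[OF C(1)], goal_cases)
    case (2 i x) then show ?case using Suc.prems(3)[of i x] Suc.prems(6)[of k i x] by auto
  next
    case (7 i x) then show ?case using Suc.prems(8)[of i x] Suc.prems(12)[of i k x] by auto
  next
    case (8 i x y) then show ?case using Suc.prems(9)[of i x y] by auto
  qed (use Suc.prems ik in auto)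
  then show ?case using C(2) by simp
qed

lemma inner_eqI: "(\<And>w. inner u w = inner v w) \<Longrightarrow> u = v"
  using vector_eq_rdot by blast

text \<open>A vector equation that is a linear consequence of one, two or three known ones becomes,
  after pairing with an arbitrary w, an equation between real numbers, where linear arithmetic can
  combine the hypotheses.\<close>

lemma inner_lin1: "(\<And>w. inner a w = inner a' w \<Longrightarrow> inner u w = inner v w) \<Longrightarrow> a = a' \<Longrightarrow> u = v"
  by (rule inner_eqI) simp

lemma inner_lin2: "(\<And>w. inner a w = inner a' w \<Longrightarrow> inner b w = inner b' w \<Longrightarrow> inner u w = inner v w) \<Longrightarrow>
    a = a' \<Longrightarrow> b = b' \<Longrightarrow> u = v"
  by (rule inner_eqI) simp

lemma inner_lin3: "(\<And>w. inner a w = inner a' w \<Longrightarrow> inner b w = inner b' w \<Longrightarrow> inner d w = inner d' w \<Longrightarrow>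
    inner u w = inner v w) \<Longrightarrow> a = a' \<Longrightarrow> b = b' \<Longrightarrow> d = d' \<Longrightarrow> u = v"
  by (rule inner_eqI) simp

section \<open>Algebras of cubic forms\<close>

text \<open>The product is not associative: \<open>mult_assoc\<close> says that the inner product
  associates with it. Together with commutativity this means that the trilinear form taking x, y, z
  to the inner product of xy and z is symmetric, and that every multiplication is
  self-adjoint.\<close>

locale comm_algebra =
  fixes mult :: "'a::real_inner \<Rightarrow> 'a \<Rightarrow> 'a" (infixl "\<star>" 70)
  assumes bilinear_mult: "bilinear (\<star>)"
    and mult_commute: "x \<star> y = y \<star> x"
    and mult_assoc: "inner (x \<star> y) z = inner x (y \<star> z)"
begin

lemmas mult_simps [simp] =
  bilinear_ladd[OF bilinear_mult] bilinear_radd[OF bilinear_mult]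
  bilinear_lmul[OF bilinear_mult] bilinear_rmul[OF bilinear_mult]
  bilinear_lneg[OF bilinear_mult] bilinear_rneg[OF bilinear_mult]
  bilinear_lsub[OF bilinear_mult] bilinear_rsub[OF bilinear_mult]
  bilinear_lzero[OF bilinear_mult] bilinear_rzero[OF bilinear_mult]

lemma linear_mult: "linear ((\<star>) x)"
  using bilinear_mult by (simp add: bilinear_def)

lemma mult_selfadjoint: "inner (x \<star> y) z = inner y (x \<star> z)"
  by (metis mult_assoc mult_commute inner_commute)

lemma norm_polar:
  assumes S: "subspace S" "\<And>x. x \<in> S \<Longrightarrow> inner (x \<star> x) (x \<star> x) = (inner x x)\<^sup>2"
    and x: "x \<in> S" and y: "y \<in> S"
  shows "inner (x \<star> x) (x \<star> y) = inner x x * inner x y"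
proof -
  have *: "inner (x \<star> x) (x \<star> y) + inner (y \<star> y) (x \<star> y) = (inner x x + inner y y) * inner x y"
    if y: "y \<in> S" for y
  proof -
    have "x + y \<in> S" "x - y \<in> S" using S x y by (auto simp: subspace_add subspace_diff)
    from S(2)[OF this(1)] S(2)[OF this(2)] show ?thesis
      by (simp add: inner_add_left inner_add_right inner_diff_left inner_diff_right power2_eq_square
          mult_commute[of y x] inner_commute[of y x] inner_commute[of "y \<star> y" "x \<star> x"]
          inner_commute[of "x \<star> y" "y \<star> y"] inner_commute[of "x \<star> y" "x \<star> x"] algebra_simps)
  qed
  \<comment> \<open>The identity just proved mixes terms of degree 1 and 3 in y; comparing y with 2y
    separates them.\<close>
  have "2 *\<^sub>R y \<in> S" using S(1) y by (rule subspace_scale)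
  from *[OF y] *[OF this] show ?thesis by (simp add: algebra_simps)
qed

lemma norm_polar2:
  assumes S: "subspace S" "\<And>x. x \<in> S \<Longrightarrow> inner (x \<star> x) (x \<star> x) = (inner x x)\<^sup>2"
    and x: "x \<in> S" and y: "y \<in> S" and z: "z \<in> S"
  shows "2 * inner (x \<star> y) (x \<star> z) + inner (x \<star> x) (y \<star> z) = 2 * inner x y * inner x z + inner x x * inner y z"
proof -
  have "x + y \<in> S" "x - y \<in> S" using S x y by (auto simp: subspace_add subspace_diff)
  from norm_polar[OF S this(1) z] norm_polar[OF S this(2) z] norm_polar[OF S y z]
  show ?thesis
    by (simp add: inner_add_left inner_add_right inner_diff_left inner_diff_right
        mult_commute[of y x] inner_commute[of y x] algebra_simps)
qed

end

text \<open>
  The projection off $e$, scaled by $\sqrt2$, of the algebra of a radial eigencubic in normal form with $V_1=0$ is of this kind.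
\<close>

locale graded_algebra = comm_algebra mult
  for mult :: "'a::real_inner \<Rightarrow> 'a \<Rightarrow> 'a" (infixl "\<star>" 70) +
  fixes V2 V3 B2 B3 :: "'a set"
  assumes B2: "onb B2 V2" and B3: "onb B3 V3"
    and orth: "x \<in> V2 \<Longrightarrow> z \<in> V3 \<Longrightarrow> inner x z = 0"
    and closed22: "x \<in> V2 \<Longrightarrow> y \<in> V2 \<Longrightarrow> x \<star> y \<in> V2"
    and closed23: "x \<in> V2 \<Longrightarrow> z \<in> V3 \<Longrightarrow> x \<star> z \<in> V3"
    and closed33: "z \<in> V3 \<Longrightarrow> w \<in> V3 \<Longrightarrow> z \<star> w \<in> V2"
    and norm2: "x \<in> V2 \<Longrightarrow> inner (x \<star> x) (x \<star> x) = (inner x x)\<^sup>2"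
    and norm3: "z \<in> V3 \<Longrightarrow> inner (z \<star> z) (z \<star> z) = (inner z z)\<^sup>2"
    and norm23: "x \<in> V2 \<Longrightarrow> z \<in> V3 \<Longrightarrow>
      2 * inner (x \<star> z) (x \<star> z) - inner (x \<star> x) (z \<star> z) = inner x x * inner z z"
    and square_square: "z \<in> V3 \<Longrightarrow> (z \<star> z) \<star> (z \<star> z) = inner z z *\<^sub>R (z \<star> z)"
    and trace_zero: "x \<in> V2 \<Longrightarrow> trace_on B2 ((\<star>) x) + trace_on B3 ((\<star>) x) = 0"
    and card_B2: "card B2 = card B3 + 2"
begin

lemma sub2: "subspace V2" and sub3: "subspace V3"
  using B2 B3 onb_subspace by auto

lemma eqI2: "u \<in> V2 \<Longrightarrow> v \<in> V2 \<Longrightarrow> (\<And>y. y \<in> V2 \<Longrightarrow> inner u y = inner v y) \<Longrightarrow> u = v"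
  using onb_vanish[OF B2, of "u - v"] sub2 by (simp add: subspace_diff inner_diff_left)

lemma eqI3: "u \<in> V3 \<Longrightarrow> v \<in> V3 \<Longrightarrow> (\<And>y. y \<in> V3 \<Longrightarrow> inner u y = inner v y) \<Longrightarrow> u = v"
  using onb_vanish[OF B3, of "u - v"] sub3 by (simp add: subspace_diff inner_diff_left)

text \<open>The vector form of \<open>norm_polar2\<close>: self-adjointness moves every factor away
  from z, and both sides lie in V2, so testing against V2 suffices.\<close>

lemma cubic2:
  assumes "x \<in> V2" "y \<in> V2"
  shows "2 *\<^sub>R (x \<star> (x \<star> y)) + (x \<star> x) \<star> y = (2 * inner x y) *\<^sub>R x + inner x x *\<^sub>R y"
proof (rule eqI2)
  show "2 *\<^sub>R (x \<star> (x \<star> y)) + (x \<star> x) \<star> y \<in> V2" "(2 * inner x y) *\<^sub>R x + inner x x *\<^sub>R y \<in> V2"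
    using assms sub2 by (auto intro!: subspace_add subspace_scale closed22)
  fix z assume "z \<in> V2"
  from norm_polar2[OF sub2 norm2 assms this]
  show "inner (2 *\<^sub>R (x \<star> (x \<star> y)) + (x \<star> x) \<star> y) z = inner ((2 * inner x y) *\<^sub>R x + inner x x *\<^sub>R y) z"
    by (simp add: inner_add_left mult_selfadjoint[of x "x \<star> y" z] mult_assoc[of "x \<star> x" y z])
qed

lemma cubic3:
  assumes "x \<in> V3" "y \<in> V3"
  shows "2 *\<^sub>R (x \<star> (x \<star> y)) + (x \<star> x) \<star> y = (2 * inner x y) *\<^sub>R x + inner x x *\<^sub>R y"
proof (rule eqI3)
  show "2 *\<^sub>R (x \<star> (x \<star> y)) + (x \<star> x) \<star> y \<in> V3" "(2 * inner x y) *\<^sub>R x + inner x x *\<^sub>R y \<in> V3"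
    using assms sub3 closed23[OF closed33[OF assms] assms(1)]
    by (auto intro!: subspace_add subspace_scale closed23 closed33 simp: mult_commute[of x "x \<star> y"])
  fix z assume "z \<in> V3"
  from norm_polar2[OF sub3 norm3 assms this]
  show "inner (2 *\<^sub>R (x \<star> (x \<star> y)) + (x \<star> x) \<star> y) z = inner ((2 * inner x y) *\<^sub>R x + inner x x *\<^sub>R y) z"
    by (simp add: inner_add_left mult_selfadjoint[of x "x \<star> y" z] mult_assoc[of "x \<star> x" y z])
qed

lemma norm23_polar:
  assumes "x \<in> V2" "z \<in> V3" "w \<in> V3"
  shows "2 * inner (x \<star> z) (x \<star> w) = inner (x \<star> x) (z \<star> w) + inner x x * inner z w"
  using norm23[OF assms(1), of "z + w"] norm23[OF assms(1,2)] norm23[OF assms(1,3)] sub3 assms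
  by (simp add: subspace_add inner_add_left inner_add_right mult_commute[of w z] inner_commute[of w z]
      inner_commute[of "x \<star> w" "x \<star> z"] algebra_simps)

lemma mixed23:
  assumes "x \<in> V2" "z \<in> V3"
  shows "2 *\<^sub>R (x \<star> (x \<star> z)) = (x \<star> x) \<star> z + inner x x *\<^sub>R z"
proof (rule eqI3)
  show "2 *\<^sub>R (x \<star> (x \<star> z)) \<in> V3" "(x \<star> x) \<star> z + inner x x *\<^sub>R z \<in> V3"
    using assms sub3 by (auto intro!: subspace_add subspace_scale closed22 closed23)
  fix w assume "w \<in> V3"
  from norm23_polar[OF assms this]
  show "inner (2 *\<^sub>R (x \<star> (x \<star> z))) w = inner ((x \<star> x) \<star> z + inner x x *\<^sub>R z) w"
    by (simp add: inner_add_left mult_selfadjoint[of x "x \<star> z" w] mult_assoc[of "x \<star> x" z w])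
qed

text \<open>Taken at an idempotent x = c it determines how c acts on a product of a vector of V2 and
  one of V3, which gives the multiplication rules between eigenspaces.\<close>

lemma mixed23_polar:
  assumes "x \<in> V2" "y \<in> V2" "z \<in> V3"
  shows "x \<star> (y \<star> z) + y \<star> (x \<star> z) = (x \<star> y) \<star> z + inner x y *\<^sub>R z"
proof -
  have xy: "x + y \<in> V2" using assms sub2 by (simp add: subspace_add)
  have "2 *\<^sub>R (x \<star> (y \<star> z) + y \<star> (x \<star> z)) = 2 *\<^sub>R ((x \<star> y) \<star> z + inner x y *\<^sub>R z)"
    using mixed23[OF xy assms(3)] mixed23[OF assms(1,3)] mixed23[OF assms(2,3)]
    by (simp add: inner_add_left inner_add_right mult_commute[of y x] inner_commute[of y x] algebra_simps)
      (simp add: scaleR_2 algebra_simps)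
  then show ?thesis by simp
qed

text \<open>The source of idempotents when V3 is nonzero: \<open>square_square\<close> makes the
  square of a unit vector of V3 idempotent, and \<open>norm3\<close> makes it a unit vector.\<close>

lemma square_idempotent:
  assumes "z \<in> V3" "inner z z = 1"
  shows "z \<star> z \<in> V2" "inner (z \<star> z) (z \<star> z) = 1" "(z \<star> z) \<star> (z \<star> z) = z \<star> z"
  using closed33[OF assms(1,1)] norm3[OF assms(1)] square_square[OF assms(1)] assms(2) by auto

end

section \<open>Peirce decomposition with respect to an idempotent of V2\<close>

locale graded_algebra_idem = graded_algebra +
  fixes c
  assumes c: "c \<in> V2" "inner c c = 1" "c \<star> c = c"
begin

text \<open>By \<open>eigen2\<close> and \<open>eigen3\<close> the operator L_c satisfies (2L - 1)(L
  + 1) = 0 on the complement of c in V2 and (2L + 1)(L - 1) = 0 on V3; these are the four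
  eigenspaces. Scalars such as 1 and -1 are written out so that \<open>subspace_eigen\<close>
  applies literally.\<close>

definition "Y = {x \<in> V2. c \<star> x = (-1) *\<^sub>R x}"
definition "Z = {x \<in> V2. c \<star> x = (1/2) *\<^sub>R x}"
definition "Y' = {x \<in> V3. c \<star> x = 1 *\<^sub>R x}"
definition "Z' = {x \<in> V3. c \<star> x = (-1/2) *\<^sub>R x}"

lemma subspaces: "subspace Y" "subspace Z" "subspace Y'" "subspace Z'"
  unfolding Y_def Z_def Y'_def Z'_def by (intro subspace_eigen linear_mult sub2 sub3)+

lemma Y_D: "y \<in> Y \<Longrightarrow> y \<in> V2" "y \<in> Y \<Longrightarrow> c \<star> y = - y"
  and Z_D: "z \<in> Z \<Longrightarrow> z \<in> V2" "z \<in> Z \<Longrightarrow> c \<star> z = (1/2) *\<^sub>R z"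
  and Y'_D: "u \<in> Y' \<Longrightarrow> u \<in> V3" "u \<in> Y' \<Longrightarrow> c \<star> u = u"
  and Z'_D: "w \<in> Z' \<Longrightarrow> w \<in> V3" "w \<in> Z' \<Longrightarrow> c \<star> w = (-1/2) *\<^sub>R w"
  by (auto simp: Y_def Z_def Y'_def Z'_def)

lemma inner_c_mult: "inner c (c \<star> x) = inner c x"
  using mult_assoc[of c c x] c(3) by simp

lemma c_orth: "y \<in> Y \<Longrightarrow> inner c y = 0" "z \<in> Z \<Longrightarrow> inner c z = 0"
  using inner_c_mult[of y] inner_c_mult[of z] Y_D Z_D by auto

lemma YZ_orth: "y \<in> Y \<Longrightarrow> z \<in> Z \<Longrightarrow> inner y z = 0"
  using mult_selfadjoint[of c y z] Y_D Z_D by simp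

lemma YZ'_orth: "u \<in> Y' \<Longrightarrow> w \<in> Z' \<Longrightarrow> inner u w = 0"
  using mult_selfadjoint[of c u w] Y'_D Z'_D by simp

lemma eigen2: "x \<in> V2 \<Longrightarrow> 2 *\<^sub>R (c \<star> (c \<star> x)) + c \<star> x = (2 * inner c x) *\<^sub>R c + x"
  using cubic2[OF c(1)] c by simp

lemma eigen3: "u \<in> V3 \<Longrightarrow> 2 *\<^sub>R (c \<star> (c \<star> u)) = c \<star> u + u"
  using mixed23[OF c(1)] c by simp

text \<open>Used to prove that elements vanish: an element is shown to be an eigenvector of L_c for
  a number that is not an eigenvalue. An eigenvector for a number other than 1 is orthogonal to c,
  after which \<open>eigen2\<close> is a quadratic equation for that number.\<close>

lemma no_eigen2:
  assumes "x \<in> V2" "c \<star> x = k *\<^sub>R x" "k \<notin> {1, -1, 1/2}"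
  shows "x = 0"
proof -
  have "inner c x = k * inner c x" using inner_c_mult[of x] assms(2) by simp
  then have "inner c x = 0" using assms(3) by (simp add: field_simps)
  then have "((2 * k - 1) * (k + 1)) *\<^sub>R x = 0"
    using eigen2[OF assms(1)] assms(2) by (simp add: algebra_simps)
  then show ?thesis using assms(3) by auto
qed

lemma no_eigen3:
  assumes "u \<in> V3" "c \<star> u = k *\<^sub>R u" "k \<notin> {1, -1/2}"
  shows "u = 0"
proof -
  have "((2 * k + 1) * (k - 1)) *\<^sub>R u = 0"
    using eigen3[OF assms(1)] assms(2) by (simp add: algebra_simps)
  then show ?thesis using assms(3) by auto
qed

lemma split2:
  assumes "x \<in> V2" "inner x c = 0"
  shows "\<exists>y\<in>Y. \<exists>z\<in>Z. x = y + z"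
proof (intro bexI)
  \<comment> \<open>The Lagrange projections (1 - 2L)/3 and 2(1 + L)/3 onto the eigenvalues -1 and
    1/2 of L = L_c.\<close>
  let ?y = "(1/3) *\<^sub>R (x - 2 *\<^sub>R (c \<star> x))" and ?z = "(2/3) *\<^sub>R (x + c \<star> x)"
  have e: "2 *\<^sub>R (c \<star> (c \<star> x)) = x - c \<star> x"
    using eigen2[OF assms(1)] assms(2) by (simp add: inner_commute algebra_simps)
  have e': "c \<star> (c \<star> x) = (1/2) *\<^sub>R (x - c \<star> x)"
    by (rule inner_lin1[OF _ e], simp add: inner_diff_left field_simps)
  show "x = ?y + ?z" by (rule inner_eqI) (simp add: inner_add_left inner_diff_left field_simps)
  have "c \<star> ?y = (-1) *\<^sub>R ?y" "c \<star> ?z = (1/2) *\<^sub>R ?z"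
    by (rule inner_eqI, simp add: e' inner_add_left inner_diff_left field_simps)+
  moreover have "?y \<in> V2" "?z \<in> V2"
    using assms(1) sub2 closed22[OF c(1)] by (auto intro!: subspace_scale subspace_add subspace_diff)
  ultimately show "?y \<in> Y" "?z \<in> Z" unfolding Y_def Z_def by auto
qed

lemma split3:
  assumes "x \<in> V3"
  shows "\<exists>y\<in>Y'. \<exists>z\<in>Z'. x = y + z"
proof (intro bexI)
  let ?y = "(1/3) *\<^sub>R (x + 2 *\<^sub>R (c \<star> x))" and ?z = "(2/3) *\<^sub>R (x - c \<star> x)"
  have e': "c \<star> (c \<star> x) = (1/2) *\<^sub>R (c \<star> x + x)"
    by (rule inner_lin1[OF _ eigen3[OF assms(1)]], simp add: inner_add_left field_simps)
  show "x = ?y + ?z" by (rule inner_eqI) (simp add: inner_add_left inner_diff_left field_simps)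
  have "c \<star> ?y = (1) *\<^sub>R ?y" "c \<star> ?z = (-1/2) *\<^sub>R ?z"
    by (rule inner_eqI, simp add: e' inner_add_left inner_diff_left field_simps)+
  moreover have "?y \<in> V3" "?z \<in> V3"
    using assms(1) sub3 closed23[OF c(1)] by (auto intro!: subspace_scale subspace_add subspace_diff)
  ultimately show "?y \<in> Y'" "?z \<in> Z'" unfolding Y'_def Z'_def by auto
qed

lemma in_Z_I:
  assumes "x \<in> V2" "inner x c = 0" "\<And>y. y \<in> Y \<Longrightarrow> inner x y = 0"
  shows "x \<in> Z"
proof -
  obtain y z where x: "y \<in> Y" "z \<in> Z" "x = y + z" using split2[OF assms(1,2)] by blast
  have "inner y y = 0" using assms(3)[OF x(1)] YZ_orth[OF x(1,2)] x(3)
    by (simp add: inner_add_left inner_commute[of z y])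
  then show ?thesis using x by simp
qed

lemma YY: "y \<in> Y \<Longrightarrow> x \<in> Y \<Longrightarrow> y \<star> x = - (inner y x) *\<^sub>R c"
proof -
  have sq: "y \<star> y = - (inner y y) *\<^sub>R c" if y: "y \<in> Y" for y
  proof -
    \<comment> \<open>The claim for squares is that this vector is 0; \<open>cubic2\<close> at y and
      c makes it an eigenvector of L_c for 2.\<close>
    let ?u = "y \<star> y + inner y y *\<^sub>R c"
    have e: "- (2 *\<^sub>R (y \<star> y)) + c \<star> (y \<star> y) = inner y y *\<^sub>R c"
      using cubic2[OF Y_D(1)[OF y] c(1)] Y_D(1,2)[OF y] c_orth(1)[OF y]
      by (simp add: mult_commute[of y c] mult_commute[of "y \<star> y" c] inner_commute)
    have "c \<star> ?u = 2 *\<^sub>R ?u"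
      by (rule inner_lin1[OF _ e]) (simp add: c(3) inner_add_left inner_diff_left algebra_simps)
    moreover have "?u \<in> V2" using Y_D(1)[OF y] c(1) sub2 by (auto intro!: subspace_add subspace_scale closed22)
    ultimately have "?u = 0" by (intro no_eigen2[of _ 2]) auto
    then show ?thesis by (simp add: eq_neg_iff_add_eq_0)
  qed
  assume yx: "y \<in> Y" "x \<in> Y"
  then have yx': "y + x \<in> Y" using subspaces by (simp add: subspace_add)
  show ?thesis
    by (rule inner_lin3[OF _ sq[OF yx'] sq[OF yx(1)] sq[OF yx(2)]])
      (simp add: inner_add_left inner_add_right mult_commute[of x y] inner_commute[of x y] algebra_simps)
qed

text \<open>The product would be an eigenvector of L_c in V3 for -2, which is not an eigenvalue
  there.\<close>

lemma YY': "y \<in> Y \<Longrightarrow> u \<in> Y' \<Longrightarrow> y \<star> u = 0"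
proof -
  assume y: "y \<in> Y" and u: "u \<in> Y'"
  have "c \<star> (y \<star> u) = (-2) *\<^sub>R (y \<star> u)"
    by (rule inner_lin1[OF _ mixed23_polar[OF c(1) Y_D(1)[OF y] Y'_D(1)[OF u]]])
      (simp add: Y_D(1,2)[OF y] Y'_D[OF u] c_orth(1)[OF y] inner_add_left algebra_simps)
  then show ?thesis using no_eigen3[of "y \<star> u" "-2"] closed23 Y_D(1)[OF y] Y'_D(1)[OF u] by auto
qed

lemma YZ': "y \<in> Y \<Longrightarrow> w \<in> Z' \<Longrightarrow> y \<star> w \<in> Z'"
proof -
  assume y: "y \<in> Y" and w: "w \<in> Z'"
  have "c \<star> (y \<star> w) = (-1/2) *\<^sub>R (y \<star> w)"
    by (rule inner_lin1[OF _ mixed23_polar[OF c(1) Y_D(1)[OF y] Z'_D(1)[OF w]]])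
      (simp add: Y_D(1,2)[OF y] Z'_D[OF w] c_orth(1)[OF y] inner_add_left algebra_simps)
  then show ?thesis using closed23 Y_D(1)[OF y] Z'_D(1)[OF w] by (auto simp: Z'_def)
qed

text \<open>\<open>cubic2\<close> is quadratic in its first argument; its instances at c + y and c -
  y differ by the part linear in y, and this part determines c(yz).\<close>

lemma YZ: "y \<in> Y \<Longrightarrow> z \<in> Z \<Longrightarrow> y \<star> z \<in> Z"
proof -
  assume y: "y \<in> Y" and z: "z \<in> Z"
  have cy: "c + y \<in> V2" "c - y \<in> V2" using c Y_D(1)[OF y] sub2 by (auto intro: subspace_add subspace_diff)
  have "c \<star> (y \<star> z) = (1/2) *\<^sub>R (y \<star> z)"
    by (rule inner_lin2[OF _ cubic2[OF cy(1) Z_D(1)[OF z]] cubic2[OF cy(2) Z_D(1)[OF z]]])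
      (simp add: mult_commute[of y c] inner_add_left inner_add_right inner_diff_left inner_diff_right
          inner_commute[of y c] c c_orth(1)[OF y] c_orth(2)[OF z] YZ_orth[OF y z] Y_D(1,2)[OF y] Z_D[OF z]
          algebra_simps)
  then show ?thesis using closed22 Y_D(1)[OF y] Z_D(1)[OF z] by (auto simp: Z_def)
qed

lemma Y'Z: "u \<in> Y' \<Longrightarrow> z \<in> Z \<Longrightarrow> u \<star> z \<in> Z'"
proof -
  assume u: "u \<in> Y'" and z: "z \<in> Z"
  have "c \<star> (z \<star> u) = (-1/2) *\<^sub>R (z \<star> u)"
    by (rule inner_lin1[OF _ mixed23_polar[OF c(1) Z_D(1)[OF z] Y'_D(1)[OF u]]])
      (simp add: Z_D[OF z] Y'_D[OF u] c_orth(2)[OF z] inner_add_left algebra_simps)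
  then show ?thesis using closed23 Z_D(1)[OF z] Y'_D(1)[OF u] by (auto simp: Z'_def mult_commute[of u z])
qed

lemma Y'Z': "u \<in> Y' \<Longrightarrow> w \<in> Z' \<Longrightarrow> u \<star> w \<in> Z"
proof (rule in_Z_I)
  assume u: "u \<in> Y'" and w: "w \<in> Z'"
  show "u \<star> w \<in> V2" using closed33 Y'_D(1)[OF u] Z'_D(1)[OF w] .
  show "inner (u \<star> w) c = 0"
    using mult_assoc[of c u w] Y'_D(2)[OF u] YZ'_orth[OF u w] by (simp add: inner_commute)
  show "inner (u \<star> w) y = 0" if "y \<in> Y" for y
    using mult_assoc[of y u w] YY'[OF that u] by (simp add: inner_commute)
qed

text \<open>Equality in the Cauchy-Schwarz inequality: c is a unit vector, \<open>norm3\<close>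
  gives the square of u the length |u|^2, and its inner product with c is |u|^2 as well.\<close>

lemma Y'_square: "u \<in> Y' \<Longrightarrow> u \<star> u = inner u u *\<^sub>R c"
proof -
  assume u: "u \<in> Y'"
  have "inner c (u \<star> u) = inner u u" using mult_assoc[of c u u] Y'_D[OF u] by simp
  then have "inner (u \<star> u - inner u u *\<^sub>R c) (u \<star> u - inner u u *\<^sub>R c) = 0"
    using norm3[OF Y'_D(1)[OF u]] c(2)
    by (simp add: inner_diff_left inner_diff_right inner_commute[of "u \<star> u" c] power2_eq_square)
  then show ?thesis by simp
qed

text \<open>A Clifford relation: after scaling by 2/sqrt 3, unit vectors of Y act on Z as
  involutions, and orthogonal ones anticommute by \<open>square_polar\<close>. The 3/4 is half of 1
  + 1/2, where 1/2 comes from the action of the square of y, a multiple of c.\<close>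

lemma Y_square_Z: "y \<in> Y \<Longrightarrow> x \<in> Z \<Longrightarrow> y \<star> (y \<star> x) = (3/4 * inner y y) *\<^sub>R x"
proof -
  assume y: "y \<in> Y" and x: "x \<in> Z"
  show ?thesis
    by (rule inner_lin1[OF _ cubic2[OF Y_D(1)[OF y] Z_D(1)[OF x]]])
      (simp add: YY[OF y y] Z_D[OF x] YZ_orth[OF y x] inner_add_left inner_diff_left field_simps)
qed

text \<open>Here only the scalar identity \<open>norm23\<close> is available. As the square of u is
  a multiple of c, it gives |zu|^2 = (3/4)|z|^2|u|^2 for z in Z; polarising within Z and pairing the
  difference of both sides with itself gives the vector identity.\<close>

lemma Y'_square_Z: "u \<in> Y' \<Longrightarrow> x \<in> Z \<Longrightarrow> u \<star> (u \<star> x) = (3/4 * inner u u) *\<^sub>R x"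
proof (rule eqI2)
  assume u: "u \<in> Y'" and x: "x \<in> Z"
  have mem: "u \<star> (u \<star> x) \<in> Z" using Y'Z[OF u x] Y'Z'[OF u] by blast
  then show "u \<star> (u \<star> x) \<in> V2" using Z_D by blast
  show "(3/4 * inner u u) *\<^sub>R x \<in> V2" using Z_D(1)[OF x] sub2 by (simp add: subspace_scale)
  have nrm: "4 * inner (z \<star> u) (z \<star> u) = 3 * (inner z z * inner u u)" if z: "z \<in> Z" for z
  proof -
    have e: "inner (z \<star> z) c = 1/2 * inner z z"
      using mult_assoc[of c z z] Z_D[OF z] by (simp add: inner_commute[of "z \<star> z" c])
    show ?thesis using norm23[OF Z_D(1)[OF z] Y'_D(1)[OF u]] Y'_square[OF u]
      by (simp add: e algebra_simps)
  qed
  fix v assume v: "v \<in> V2"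
  have zz: "4 * inner (x \<star> u) (z \<star> u) = 3 * (inner x z * inner u u)" if z: "z \<in> Z" for z
  proof -
    have "x + z \<in> Z" using x z subspaces by (simp add: subspace_add)
    from nrm[OF this] nrm[OF x] nrm[OF z] show ?thesis
      by (simp add: inner_add_left inner_add_right inner_commute[of z x] inner_commute[of "z \<star> u" "x \<star> u"] algebra_simps)
  qed
  let ?d = "u \<star> (u \<star> x) - (3/4 * inner u u) *\<^sub>R x"
  have d: "?d \<in> Z" using mem x subspaces by (simp add: subspace_diff subspace_scale)
  have "inner ?d ?d = 0"
    using zz[OF d] by (subst (1) inner_diff_left)
      (simp add: mult_selfadjoint[of u "u \<star> x"] mult_commute[of _ u] algebra_simps)
  then show "inner (u \<star> (u \<star> x)) v = inner ((3/4 * inner u u) *\<^sub>R x) v" by simp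
qed

lemma Y'_square_Z': "u \<in> Y' \<Longrightarrow> x \<in> Z' \<Longrightarrow> u \<star> (u \<star> x) = (3/4 * inner u u) *\<^sub>R x"
proof -
  assume u: "u \<in> Y'" and x: "x \<in> Z'"
  show ?thesis
    by (rule inner_lin1[OF _ cubic3[OF Y'_D(1)[OF u] Z'_D(1)[OF x]]])
      (simp add: Y'_square[OF u] Z'_D[OF x] YZ'_orth[OF u x] inner_add_left inner_diff_left field_simps)
qed

lemma square_polar:
  assumes "subspace S" "\<And>u. u \<in> S \<Longrightarrow> u \<star> (u \<star> x) = (3/4 * inner u u) *\<^sub>R x" "u \<in> S" "v \<in> S" "inner u v = 0"
  shows "u \<star> (v \<star> x) = - (v \<star> (u \<star> x))"
proof -
  have uv: "u + v \<in> S" using assms by (simp add: subspace_add)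
  show ?thesis
    by (rule inner_lin3[OF _ assms(2)[OF uv] assms(2)[OF assms(3)] assms(2)[OF assms(4)]]) (simp add: assms(5) inner_add_left inner_add_right inner_commute[of v u] algebra_simps)
qed

lemma Y_Y'_commute: "y \<in> Y \<Longrightarrow> u \<in> Y' \<Longrightarrow> x \<in> Z \<Longrightarrow> y \<star> (u \<star> x) = u \<star> (y \<star> x)"
  using mixed23_polar[of y x u] YY'[of y u] YZ_orth[of y x] Y_D Z_D Y'_D
  by (simp add: mult_commute[of x u] mult_commute[of "y \<star> x" u])

text \<open>The commutator maps Z' into Z, and its adjoint is, up to sign, the commutator on Z,
  which vanishes by \<open>Y_Y'_commute\<close>.\<close>

lemma Y_Y'_commute': "y \<in> Y \<Longrightarrow> u \<in> Y' \<Longrightarrow> x \<in> Z' \<Longrightarrow> y \<star> (u \<star> x) = u \<star> (y \<star> x)"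
proof -
  assume y: "y \<in> Y" and u: "u \<in> Y'" and x: "x \<in> Z'"
  let ?d = "y \<star> (u \<star> x) - u \<star> (y \<star> x)"
  have d: "?d \<in> Z" using YZ[OF y Y'Z'[OF u x]] Y'Z'[OF u YZ'[OF y x]] subspaces by (simp add: subspace_diff)
  have "inner ?d ?d = inner (y \<star> (u \<star> x)) ?d - inner (u \<star> (y \<star> x)) ?d" by (rule inner_diff_left)
  also have "\<dots> = inner x (u \<star> (y \<star> ?d)) - inner x (y \<star> (u \<star> ?d))"
    by (simp only: mult_selfadjoint)
  also have "\<dots> = 0" using Y_Y'_commute[OF y u d] by simp
  finally show ?thesis by simp
qed

end

section \<open>Dimensions of graded algebras\<close>

text \<open>From m = 5 on the power exceeds 2m, and m = 3 fails because 4 does not divide 6.\<close>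

lemma power2_dvd_cases:
  fixes m :: nat
  assumes "2 ^ (m - 1) dvd 2 * m" "m \<ge> 1"
  shows "m \<in> {1, 2, 4}"
proof -
  have big: "2 * (k + 5) < 16 * 2 ^ k" for k :: nat
    by (induction k) auto
  have "m < 5"
  proof (rule ccontr)
    assume "\<not> m < 5"
    then obtain k where m: "m = k + 5" using that[of "m - 5"] by simp
    then have "2 ^ (k + 4) \<le> 2 * (k + 5)" using assms(1) m by (auto dest!: dvd_imp_le simp: add.commute)
    then show False using big[of k] by (simp add: power_add)
  qed
  then have "m = 1 \<or> m = 2 \<or> m = 3 \<or> m = 4" using assms(2) by auto
  then show ?thesis using assms(1) by auto
qed

context graded_algebra
begin

text \<open>
  At such an idempotent the restricted cubic takes the form $r^3-3r|y|^2+3r|u|^2$, see \<open>reducible_cubic\<close>.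
\<close>

definition reducible_at :: "'a \<Rightarrow> bool" where
  "reducible_at c \<longleftrightarrow> c \<in> V2 \<and> inner c c = 1 \<and> c \<star> c = c \<and> (\<forall>x\<in>V2. inner x c = 0 \<longrightarrow> c \<star> x = - x)"

end

context graded_algebra_idem
begin

text \<open>Two linear equations: the dimension count dim V2 = dim V3 + 2 and the vanishing trace of
  L_c, computed from the eigenvalues 1, -1, 1/2 on V2 and 1, -1/2 on V3. They determine dim Z - dim
  Z' = 0 and dim Y - dim Y' = 1.\<close>

lemma card_relations:
  assumes CY: "onb CY Y" and CZ: "onb CZ Z" and CY': "onb CY' Y'" and CZ': "onb CZ' Z'"
  shows "card CZ' = card CZ" "card CY = card CY' + 1" "card B2 = card CY + card CZ + 1"
proof -
  let ?W = "{x \<in> V2. inner c x = 0}"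
  have W: "subspace ?W" using sub2 by (auto simp: subspace_def inner_add_right)
  have s2: "\<exists>y\<in>Y. \<exists>z\<in>Z. x = y + z" if "x \<in> ?W" for x
    using split2[of x] that by (auto simp: inner_commute[of x c])
  have sub: "Y \<subseteq> ?W" "Z \<subseteq> ?W" "Y' \<subseteq> V3" "Z' \<subseteq> V3" using Y_D(1) Z_D(1) Y'_D(1) Z'_D(1) c_orth by auto
  have c1: "onb (CY \<union> CZ) ?W" "CY \<inter> CZ = {}"
    using onb_Un[OF CY CZ YZ_orth W sub(1,2) s2] by simp_all
  have c2: "onb (insert c (CY \<union> CZ)) V2" "c \<notin> CY \<union> CZ"
  proof -
    have "x - inner x c *\<^sub>R c \<in> ?W" if "x \<in> V2" for x
      using that c sub2 by (auto simp: inner_diff_right inner_commute[of c x] intro!: subspace_diff subspace_scale)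
    then show "onb (insert c (CY \<union> CZ)) V2" "c \<notin> CY \<union> CZ"
      using onb_insert[OF c1(1) c(2) _ sub2 c(1)] by auto
  qed
  have c3: "onb (CY' \<union> CZ') V3" "CY' \<inter> CZ' = {}"
    using onb_Un[OF CY' CZ' YZ'_orth sub3 sub(3,4) split3] by simp_all
  note fin = onb_finite[OF CY] onb_finite[OF CZ] onb_finite[OF CY'] onb_finite[OF CZ']
  have "trace_on B2 ((\<star>) c) = trace_on (insert c (CY \<union> CZ)) ((\<star>) c)"
    by (rule trace_on_unique[OF B2 c2(1) linear_mult])
  also have "\<dots> = 1 - real (card CY) + 1/2 * real (card CZ)"
    using fin c1(2) c2(2) trace_on_scale[OF CY, of "(\<star>) c" "-1"] trace_on_scale[OF CZ, of "(\<star>) c" "1/2"] Y_D(2) Z_D(2)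
    by (simp add: trace_on_insert trace_on_Un c)
  finally have t2: "trace_on B2 ((\<star>) c) = 1 - real (card CY) + 1/2 * real (card CZ)" .
  have "trace_on B3 ((\<star>) c) = trace_on (CY' \<union> CZ') ((\<star>) c)"
    by (rule trace_on_unique[OF B3 c3(1) linear_mult])
  also have "\<dots> = real (card CY') - 1/2 * real (card CZ')"
    using fin c3(2) trace_on_scale[OF CY', of "(\<star>) c" "1"] trace_on_scale[OF CZ', of "(\<star>) c" "-1/2"] Y'_D(2) Z'_D(2)
    by (simp add: trace_on_Un)
  finally have t3: "trace_on B3 ((\<star>) c) = real (card CY') - 1/2 * real (card CZ')" .
  have d2: "card B2 = 1 + (card CY + card CZ)"
    using onb_dim[OF B2] onb_dim[OF c2(1)] c2(2) c1(2) fin by (simp add: card_Un_disjoint)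
  have d3: "card B3 = card CY' + card CZ'"
    using onb_dim[OF B3] onb_dim[OF c3(1)] c3(2) fin by (simp add: card_Un_disjoint)
  have "real (card CY) + real (card CZ) = real (card CY') + real (card CZ') + 1"
    using d2 d3 card_B2 by linarith
  moreover have "1 - real (card CY) + 1/2 * real (card CZ) + (real (card CY') - 1/2 * real (card CZ')) = 0"
    using trace_zero[OF c(1)] t2 t3 by simp
  ultimately have "real (card CZ') = real (card CZ)" "real (card CY) = real (card CY' + 1)"
    by (simp_all add: field_simps)
  then show "card CZ' = card CZ" "card CY = card CY' + 1" by linarith+
  show "card B2 = card CY + card CZ + 1" using d2 by simp
qed

lemma bases:
  obtains CY CZ CY' CZ' where "onb CY Y" "onb CZ Z" "onb CY' Y'" "onb CZ' Z'"
proof -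
  have "Y \<subseteq> V2" "Z \<subseteq> V2" "Y' \<subseteq> V3" "Z' \<subseteq> V3" using Y_D Z_D Y'_D Z'_D by blast+
  with subspaces show ?thesis
    using onb_sub_exists[OF B2] onb_sub_exists[OF B3] that by metis
qed

lemma Z_zero_reducible:
  assumes "Z = {0}"
  shows "reducible_at c"
  unfolding reducible_at_def
proof (intro conjI ballI impI)
  fix x assume "x \<in> V2" "inner x c = 0"
  then obtain y z where "y \<in> Y" "z \<in> Z" "x = y + z" using split2 by blast
  then show "c \<star> x = - x" using assms Y_D(2) by simp
qed (use c in auto)

text \<open>The square of z splits as c/2 + h. It turns out that h lies in Y, that |h|^2 = 1 - 1/4 =
  3/4, and that hz = (3/4)z. By \<open>Y_square_Z\<close> the operator L_h then squares to 9/16 on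
  Z, so it splits Z into eigenspaces for 3/4 and -3/4, with z in the first.\<close>

context
  fixes z h
  assumes z: "z \<in> Z" "inner z z = 1" and h: "h = z \<star> z - (1/2) *\<^sub>R c"
begin

lemma zz: "z \<star> z = h + (1/2) *\<^sub>R c"
  using h by simp

lemma h_Y: "h \<in> Y"
proof -
  have "h \<in> V2" unfolding h using z Z_D c sub2 by (auto intro!: subspace_diff subspace_scale closed22)
  moreover have "c \<star> h = (-1) *\<^sub>R h"
    by (rule inner_lin1[OF _ cubic2[OF Z_D(1)[OF z(1)] c(1)]])
      (simp add: h z c Z_D[OF z(1)] c_orth(2)[OF z(1)] mult_commute[of z c] mult_commute[of "z \<star> z" c]
        inner_commute[of z c] inner_add_left inner_diff_left)
  ultimately show ?thesis by (simp add: Y_def)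
qed

lemma h_norm: "inner h h = 3/4"
proof -
  have e: "inner (z \<star> z) c = 1/2" using mult_assoc[of c z z] Z_D[OF z(1)] z(2) by (simp add: inner_commute[of "z \<star> z" c])
  show ?thesis using norm2[OF Z_D(1)[OF z(1)]]
    by (simp add: h e z c inner_diff_left inner_diff_right inner_commute[of c "z \<star> z"])
qed

lemma h_z: "h \<star> z = (3/4) *\<^sub>R z"
  by (rule inner_lin1[OF _ cubic2[OF Z_D(1)[OF z(1)] Z_D(1)[OF z(1)]]])
    (simp add: mult_commute[of z "z \<star> z"] h z(2) inner_add_left inner_diff_left Z_D(2)[OF z(1)])

lemma z_x: 
  assumes x: "x \<in> Z" "inner z x = 0"
  shows "z \<star> x \<in> Y" "2 *\<^sub>R (z \<star> (z \<star> x)) = (3/4) *\<^sub>R x - h \<star> x"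
proof -
  have "c \<star> (z \<star> x) = (-1) *\<^sub>R (z \<star> x)"
  proof -
    have zx: "z + x \<in> V2" "z - x \<in> V2" using x z Z_D sub2 by (auto intro: subspace_add subspace_diff)
    show ?thesis
      by (rule inner_lin2[OF _ cubic2[OF zx(1) c(1)] cubic2[OF zx(2) c(1)]])
        (simp add: mult_commute[of x c] mult_commute[of z c] mult_commute[of x z]
          mult_commute[of "z \<star> z" c] mult_commute[of "x \<star> x" c] mult_commute[of "z \<star> x" c]
          inner_add_left inner_add_right inner_diff_left inner_diff_right
          inner_commute[of x z] inner_commute[of x c] inner_commute[of z c] c c_orth(2) x z
          Z_D[OF x(1)] Z_D[OF z(1)] algebra_simps)
  qed
  moreover have "z \<star> x \<in> V2" using x z Z_D closed22 by blast
  ultimately show "z \<star> x \<in> Y" by (simp add: Y_def)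
  show "2 *\<^sub>R (z \<star> (z \<star> x)) = (3/4) *\<^sub>R x - h \<star> x"
    by (rule inner_lin1[OF _ cubic2[OF Z_D(1)[OF z(1)] Z_D(1)[OF x(1)]]])
      (simp add: zz x z Z_D[OF x(1)] inner_add_left inner_diff_left)
qed

lemma z_y:
  assumes y: "y \<in> Y" "inner y h = 0"
  shows "z \<star> (z \<star> y) = (3/4) *\<^sub>R y"
  by (rule inner_lin1[OF _ cubic2[OF Z_D(1)[OF z(1)] Y_D(1)[OF y(1)]]])
    (simp add: zz y z Y_D(2)[OF y(1)] YY[OF h_Y y(1)] inner_commute[of h y] YZ_orth[OF y(1) z(1)] inner_commute[of z y]
      inner_add_left inner_diff_left)

text \<open>The eigenspace \<open>?E\<close> of L_h for -3/4 is counted twice. Multiplication by z,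
  scaled to be isometric, maps the complement of h in Y onto it, so its dimension is dim Y - 1. A
  unit vector y1 of Y orthogonal to h anticommutes with L_h, so \<open>?E\<close> is also half of
  Z.\<close>

lemma card_eigen:
  assumes CY: "onb CY Y" and CZ: "onb CZ Z" and card: "card CY \<noteq> 1"
  shows "card CZ = 2 * (card CY - 1)"
proof -
  let ?Y0 = "{y \<in> Y. inner y h = 0}" and ?E = "{x \<in> Z. h \<star> x = (-3/4) *\<^sub>R x}"
  \<comment> \<open>The factor with r^2 * (3/4) = 1: it turns h into a unit vector, \<open>T\<close>
    into an isometry and \<open>?F\<close> into an involution.\<close>
  define r :: real where "r = 2 / sqrt 3"
  have r: "r * r = 4/3" "r \<noteq> 0" by (auto simp: r_def)
  have rr: "r * (r * t) = 4/3 * t" for t using r by (metis mult.assoc)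
  have sY0: "subspace ?Y0" using subspaces by (auto simp: subspace_def inner_add_left)
  then obtain C0 where C0: "onb C0 ?Y0" using onb_sub_exists[OF CY] by blast
  have Cr: "onb (insert (r *\<^sub>R h) C0) Y" "r *\<^sub>R h \<notin> C0"
  proof -
    have "x - inner x (r *\<^sub>R h) *\<^sub>R (r *\<^sub>R h) \<in> ?Y0" if "x \<in> Y" for x
    proof -
      have "inner (x - inner x (r *\<^sub>R h) *\<^sub>R (r *\<^sub>R h)) h = inner x h - (r * r) * inner x h * inner h h"
        by (simp add: inner_diff_left)
      then show ?thesis using that h_Y subspaces by (auto simp: r h_norm intro!: subspace_diff subspace_scale)
    qed
    moreover have "inner (r *\<^sub>R h) (r *\<^sub>R h) = 1"
      using arg_cong[OF r(1), of "\<lambda>t. t * inner h h"] by (simp add: h_norm mult.assoc)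
    moreover have "inner (r *\<^sub>R h) x = 0" if "x \<in> ?Y0" for x using that by (simp add: inner_commute[of h x])
    moreover have "r *\<^sub>R h \<in> Y" using h_Y subspaces by (simp add: subspace_scale)
    ultimately show "onb (insert (r *\<^sub>R h) C0) Y" "r *\<^sub>R h \<notin> C0"
      using onb_insert[OF C0, of "r *\<^sub>R h" Y] subspaces(1) by blast+
  qed
  then have cY: "card CY = card C0 + 1"
    using onb_dim[OF CY] onb_dim[OF Cr(1)] onb_finite[OF C0] by simp
  \<comment> \<open>The only place where dim Y = 1 has to be excluded: the complement of h must
    contain a unit vector.\<close>
  then obtain y1 where y1: "y1 \<in> C0" using card by fastforce
  then have y1': "y1 \<in> Y" "inner y1 h = 0" "inner y1 y1 = 1"
    using onb_subset[OF C0] onb_inner_basis[OF C0 y1 y1] by auto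
  define T where "T = (\<lambda>y. r *\<^sub>R (z \<star> y))"
  have linT: "linear T" unfolding T_def by (intro linear_compose_scale_right linear_mult)
  have anti: "h \<star> (y \<star> x) = - (y \<star> (h \<star> x))" if "y \<in> Y" "inner y h = 0" "x \<in> Z" for x y
    by (rule square_polar[OF subspaces(1) _ h_Y that(1)])
      (use that Y_square_Z[OF _ that(3)] in \<open>auto simp: inner_commute[of h y]\<close>)
  have isoT: "inner (T y) (T y') = inner y y'" if "y \<in> ?Y0" "y' \<in> ?Y0" for y y'
  proof -
    have "inner (T y) (T y') = r * r * inner y (z \<star> (z \<star> y'))"
      by (simp add: T_def mult_selfadjoint[of z y])
    then show ?thesis using z_y[of y'] that r by simp
  qed
  have imT: "T ` ?Y0 = ?E"
  proof
    show "T ` ?Y0 \<subseteq> ?E"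
    proof clarify
      fix y assume y: "y \<in> Y" "inner y h = 0"
      have "T y \<in> Z" unfolding T_def using YZ[OF y(1) z(1)] subspaces by (simp add: mult_commute[of z y] subspace_scale)
      moreover have "h \<star> T y = (-3/4) *\<^sub>R T y"
        using anti[OF y z(1)] h_z by (simp add: T_def mult_commute[of z y])
      ultimately show "T y \<in> Z \<and> h \<star> T y = (-3/4) *\<^sub>R T y" by blast
    qed
    show "?E \<subseteq> T ` ?Y0"
    proof
      fix x assume "x \<in> ?E"
      then have x: "x \<in> Z" "h \<star> x = (-3/4) *\<^sub>R x" by auto
      \<comment> \<open>z and x belong to the different eigenvalues 3/4 and -3/4 of the self-adjoint
        L_h.\<close>
      have zx: "inner z x = 0" using mult_selfadjoint[of h z x] h_z x(2) by simp
      let ?y = "z \<star> x"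
      have "inner ?y h = 0"
        using mult_assoc[of h z x] h_z zx by (simp add: inner_commute[of "z \<star> x" h])
      then have "r *\<^sub>R ?y \<in> ?Y0"
        using z_x(1)[OF x(1) zx] subspaces(1) by (simp add: subspace_scale)
      moreover have "T (r *\<^sub>R ?y) = x"
      proof (rule inner_lin1[OF _ z_x(2)[OF x(1) zx]])
        fix w assume "inner (2 *\<^sub>R (z \<star> (z \<star> x))) w = inner ((3/4) *\<^sub>R x - h \<star> x) w"
        then have "inner (z \<star> (z \<star> x)) w = 3/4 * inner x w" using x(2) by (simp add: inner_diff_left inner_add_left)
        then have "r * r * inner (z \<star> (z \<star> x)) w = inner x w" unfolding r(1) by simp
        then show "inner (T (r *\<^sub>R ?y)) w = inner x w" by (simp add: T_def)
      qed
      ultimately show "x \<in> T ` ?Y0" by (metis imageI)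
    qed
  qed
  have E: "onb (T ` C0) ?E" "card (T ` C0) = card C0"
    using onb_image[OF C0 linT isoT] unfolding imT by blast+
  let ?Q = "\<lambda>x. (-4/3) *\<^sub>R (h \<star> x)" and ?F = "\<lambda>x. r *\<^sub>R (y1 \<star> x)"
  obtain C where C: "onb C {x \<in> Z. ?Q x = x}" "card CZ = 2 * card C"
  proof (rule onb_halve[OF CZ, of ?Q ?F])
    show "linear ?Q" "linear ?F" by (intro linear_compose_scale_right linear_mult)+
    show "?Q x \<in> Z" "?F x \<in> Z" if "x \<in> Z" for x
      using YZ[OF h_Y that] YZ[OF y1'(1) that] subspaces(2)
      by (auto intro!: subspace_scale simp del: scaleR_minus_left)
    show "inner (?Q x) y = inner x (?Q y)" "inner (?F x) y = inner x (?F y)" for x y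
      by (simp_all add: mult_selfadjoint)
    show "?Q (?Q x) = x" "?F (?F x) = x" "?F (?Q x) = - ?Q (?F x)" if "x \<in> Z" for x
      using Y_square_Z[OF h_Y that] Y_square_Z[OF y1'(1) that] anti[OF y1'(1,2) that] h_norm y1'(3) by (simp_all add: rr)
  qed blast
  have "{x \<in> Z. ?Q x = x} = ?E"
  proof -
    have "(?Q x = x) \<longleftrightarrow> (h \<star> x = (-3/4) *\<^sub>R x)" for x
    proof
      assume "?Q x = x"
      then show "h \<star> x = (-3/4) *\<^sub>R x" by (rule inner_lin1[rotated]) simp
    next
      assume "h \<star> x = (-3/4) *\<^sub>R x"
      then show "?Q x = x" by simp
    qed
    then show ?thesis by auto
  qed
  then have "card C = card C0" using onb_dim[OF C(1)] onb_dim[OF E(1)] E(2) by simp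
  then show ?thesis using C(2) cY by simp
qed

text \<open>In orthonormal coordinates (r, y) along c and h the cubic is r^3 - 3ry^2, which is
  invariant under rotation by 120 degrees, and -c/2 - h is a rotated copy of c. When h spans Y, L_h
  is 3/4 on all of Z, so the new idempotent acts on Z by -1/4 - 3/4 = -1.\<close>

lemma one_dim_reducible:
  assumes CY: "onb CY Y" and card: "card CY = 1"
  shows "reducible_at (- (1/2) *\<^sub>R c - h)"
proof -
  let ?d = "- (1/2) *\<^sub>R c - h"
  obtain b where b: "CY = {b}" using card card_1_singletonE by blast
  have Yb: "\<exists>k. y = k *\<^sub>R h" if "y \<in> Y" for y
  proof -
    have "y = inner y b *\<^sub>R b" "h = inner h b *\<^sub>R b"
      using onb_expand[OF CY that] onb_expand[OF CY h_Y] b by auto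
    moreover have "inner h b \<noteq> 0" using calculation(2) h_norm by auto
    ultimately have "y = (inner y b / inner h b) *\<^sub>R h" by (metis nonzero_eq_divide_eq scaleR_scaleR times_divide_eq_left)
    then show ?thesis by blast
  qed
  have hx: "h \<star> x = (3/4) *\<^sub>R x" if x: "x \<in> Z" for x
  proof -
    \<comment> \<open>Up to a factor, the component of x in the eigenspace of L_h for -3/4. The
      product ze lies in Y and is orthogonal to h, hence vanishes, and \<open>z_x\<close> then gives
      e = 0.\<close>
    define e where "e = (3/4) *\<^sub>R x - h \<star> x"
    have eZ: "e \<in> Z" unfolding e_def using x YZ[OF h_Y x] subspaces by (auto intro!: subspace_diff subspace_scale)
    have he: "h \<star> e = (-3/4) *\<^sub>R e"
      unfolding e_def by (rule inner_eqI) (simp add: Y_square_Z[OF h_Y x] h_norm inner_diff_left field_simps)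
    have ze: "inner z e = 0" using mult_selfadjoint[of h z e] h_z he by simp
    have zeh: "inner (z \<star> e) h = 0"
      using mult_assoc[of h z e] h_z ze by (simp add: inner_commute[of "z \<star> e" h])
    obtain k where k: "z \<star> e = k *\<^sub>R h" using Yb z_x(1)[OF eZ ze] by blast
    then have "z \<star> e = 0" using zeh h_norm by simp
    then have "e = 0"
      by (intro inner_lin1[OF _ z_x(2)[OF eZ ze]]) (simp add: he inner_diff_left inner_add_left)
    then show ?thesis by (simp add: e_def)
  qed
  note hY = h_Y
  have ch: "c \<star> h = - h" "h \<star> c = - h" "inner c h = 0" "inner h c = 0" "h \<star> h = - (3/4) *\<^sub>R c"
    using Y_D(2)[OF hY] c_orth(1)[OF hY] YY[OF hY hY] h_norm by (auto simp: mult_commute[of h c] inner_commute[of h c])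
  have "?d \<in> V2" using c Y_D(1)[OF hY] sub2 by (intro subspace_diff subspace_scale)
  moreover have "inner ?d ?d = 1" using c h_norm ch by (simp add: inner_diff_left inner_diff_right)
  moreover have "?d \<star> ?d = ?d"
    by (rule inner_eqI) (simp add: c ch inner_add_left inner_diff_left field_simps)
  moreover have "?d \<star> x = - x" if x: "x \<in> V2" "inner x ?d = 0" for x
  proof -
    have "x - inner x c *\<^sub>R c \<in> V2" "inner (x - inner x c *\<^sub>R c) c = 0"
      using x c sub2 by (auto intro!: subspace_diff subspace_scale simp: inner_diff_left)
    then obtain y u where yu: "y \<in> Y" "u \<in> Z" "x - inner x c *\<^sub>R c = y + u" using split2 by blast
    obtain k where k: "y = k *\<^sub>R h" using Yb[OF yu(1)] by blast
    have xe: "x = inner x c *\<^sub>R c + k *\<^sub>R h + u" using yu(3) k by (simp add: algebra_simps)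
    have uo: "inner u c = 0" "inner u h = 0"
      using c_orth(2)[OF yu(2)] YZ_orth[OF hY yu(2)] by (auto simp: inner_commute[of u])
    have "inner x ?d = - (1/2) * inner x c - 3/4 * k"
    proof -
      have "inner (inner x c *\<^sub>R c + k *\<^sub>R h + u) ?d = - (1/2) * inner x c - 3/4 * k"
        by (simp add: inner_add_left inner_diff_right ch uo c h_norm)
      then show ?thesis by (simp only: xe[symmetric])
    qed
    then have xc: "inner x c = - (3/2) * k" using x(2) by simp
    have "x = (- (3/2) * k) *\<^sub>R c + k *\<^sub>R h + u" using xe xc by simp
    moreover have "?d \<star> ((- (3/2) * k) *\<^sub>R c + k *\<^sub>R h + u) = - ((- (3/2) * k) *\<^sub>R c + k *\<^sub>R h + u)"
      by (rule inner_eqI) (simp add: c ch hx[OF yu(2)] Z_D(2)[OF yu(2)] inner_add_left inner_diff_left field_simps)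
    ultimately show ?thesis by simp
  qed
  ultimately show ?thesis unfolding reducible_at_def by blast
qed

end

end

section \<open>Two commuting Clifford systems on Z and Z'\<close>

context graded_algebra_idem
begin

text \<open>With a and b the normalised multiplications by Y and Y', the involutions are products of
  a 0, a (i+1), b 0 and b (i+1) for i < m - 1. The map a (i+1) passes one anticommuting factor of
  the i-th product and two of every other one, so it anticommutes with the former and commutes with
  the latter.\<close>

lemma power2_dvd_card_Z:
  assumes CY: "onb CY Y" and CZ: "onb CZ Z" and CY': "onb CY' Y'"
    and card: "card CY = m + 1" "card CY' = m" "m \<ge> 1"
  shows "2 ^ (m - 1) dvd card CZ"
proof -
  obtain y where y: "bij_betw y {..<m + 1} CY"
    using ex_bij_betw_nat_finite[OF onb_finite[OF CY]] card by (auto simp: atLeast0LessThan)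
  obtain u where u: "bij_betw u {..<m} CY'"
    using ex_bij_betw_nat_finite[OF onb_finite[OF CY']] card by (auto simp: atLeast0LessThan)
  have yY: "y i \<in> Y" if "i < m" for i
    using that bij_betwE[OF y] onb_subset[OF CY] by auto
  have uY: "u i \<in> Y'" if "i < m" for i
    using that bij_betwE[OF u] onb_subset[OF CY'] by auto
  have yy: "inner (y i) (y j) = (if i = j then 1 else 0)" if "i < m" "j < m" for i j
    using that bij_betwE[OF y] onb_inner_basis[OF CY, of "y i" "y j"] bij_betw_imp_inj_on[OF y]
    by (auto simp: inj_on_def)
  have uu: "inner (u i) (u j) = (if i = j then 1 else 0)" if "i < m" "j < m" for i j
    using that bij_betwE[OF u] onb_inner_basis[OF CY', of "u i" "u j"] bij_betw_imp_inj_on[OF u]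
    by (auto simp: inj_on_def)
  define r :: real where "r = 2 / sqrt 3"
  have r: "r * r = 4/3" by (simp add: r_def)
  define a where "a = (\<lambda>i x. r *\<^sub>R (y i \<star> x))"
  define b where "b = (\<lambda>i x. r *\<^sub>R (u i \<star> x))"
  have lin: "linear (a i)" "linear (b i)" for i
    unfolding a_def b_def by (intro linear_compose_scale_right linear_mult)+
  have a_neg: "a i (- x) = - a i x" and b_neg: "b i (- x) = - b i x" for i x
    using lin by (simp_all add: linear_neg)
  have aZ: "a i x \<in> Z" if "i < m" "x \<in> Z" for i x
    using YZ[OF yY[OF that(1)] that(2)] subspaces by (simp add: a_def subspace_scale)
  have bZ: "b i x \<in> Z'" if "i < m" "x \<in> Z" for i x
    using Y'Z[OF uY[OF that(1)] that(2)] subspaces by (simp add: b_def subspace_scale)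
  have bZ': "b i x \<in> Z" if "i < m" "x \<in> Z'" for i x
    using Y'Z'[OF uY[OF that(1)] that(2)] subspaces by (simp add: b_def subspace_scale)
  have rr: "r * (r * t) = 4/3 * t" for t using r by (metis mult.assoc)
  have aa: "a i (a i x) = x" if "i < m" "x \<in> Z" for i x
    using Y_square_Z[OF yY[OF that(1)] that(2)] yy[OF that(1,1)] by (simp add: a_def rr)
  have bb: "b i (b i x) = x" if "i < m" "x \<in> Z" for i x
    using Y'_square_Z[OF uY[OF that(1)] that(2)] uu[OF that(1,1)] by (simp add: b_def rr)
  have a_anti: "a i (a j x) = - a j (a i x)" if "i < m" "j < m" "i \<noteq> j" "x \<in> Z" for i j x
    unfolding a_def
    by (simp add: square_polar[OF subspaces(1) Y_square_Z[OF _ that(4)] yY[OF that(1)] yY[OF that(2)]] yy that)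
  have b_anti: "b i (b j x) = - b j (b i x)" if "i < m" "j < m" "i \<noteq> j" "x \<in> Z" for i j x
    unfolding b_def
    by (simp add: square_polar[OF subspaces(3) Y'_square_Z[OF _ that(4)] uY[OF that(1)] uY[OF that(2)]] uu that)
  have ab: "a i (b j x) = b j (a i x)" if "i < m" "j < m" "x \<in> Z" for i j x
    using Y_Y'_commute[OF yY[OF that(1)] uY[OF that(2)] that(3)] by (simp add: a_def b_def)
  have ab': "a i (b j x) = b j (a i x)" if "i < m" "j < m" "x \<in> Z'" for i j x
    using Y_Y'_commute'[OF yY[OF that(1)] uY[OF that(2)] that(3)] by (simp add: a_def b_def)
  have a_self: "inner (a i x) v = inner x (a i v)" and b_self: "inner (b i x) v = inner x (b i v)" for i x v
    by (simp_all add: a_def b_def mult_selfadjoint)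
  have b_anti': "b i (b j x) = - b j (b i x)" if "i < m" "j < m" "i \<noteq> j" "x \<in> Z'" for i j x
    unfolding b_def
    by (simp add: square_polar[OF subspaces(3) Y'_square_Z'[OF _ that(4)] uY[OF that(1)] uY[OF that(2)]] uu that)
  \<comment> \<open>Pairs of generators: the b's enter in pairs because a single one maps Z to Z'.
    Both \<open>A i\<close> and \<open>G i\<close> square to -1.\<close>
  define A where "A = (\<lambda>i x. a 0 (a (Suc i) x))"
  define G where "G = (\<lambda>i x. b 0 (b (Suc i) x))"
  have AZ: "A i x \<in> Z" and GZ: "G i x \<in> Z" if "i < m - 1" "x \<in> Z" for i x
    using that aZ bZ[of "Suc i" x] bZ'[of 0] by (simp_all add: A_def G_def)
  have aG: "a j (G i x) = G i (a j x)" if "i < m - 1" "j < m" "x \<in> Z" for i j x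
    using that bZ[of "Suc i" x] by (simp add: G_def ab ab')
  have AG: "A j (G i x) = G i (A j x)" if "i < m - 1" "j < m - 1" "x \<in> Z" for i j x
    using that aG aZ by (simp add: A_def)
  have AA: "A i (A j x) = - a (Suc i) (a (Suc j) x)" if "i < m - 1" "j < m - 1" "x \<in> Z" for i j x
    using that a_anti[of "Suc i" 0 "a (Suc j) x"] aa[of 0 "a (Suc i) (a (Suc j) x)"] aZ by (simp add: A_def a_neg)
  have GG: "G i (G j x) = - b (Suc i) (b (Suc j) x)" if "i < m - 1" "j < m - 1" "x \<in> Z" for i j x
    using that b_anti'[of "Suc i" 0 "b (Suc j) x"] bb[of 0 "b (Suc i) (b (Suc j) x)"] bZ bZ'
    by (simp add: G_def b_neg)
  have A_neg: "A i (- x) = - A i x" for i x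
    by (simp add: A_def a_neg)
  \<comment> \<open>The factors commute and each squares to -1, so the product squares to 1. In
    \<open>QQ\<close> the generators with index 0 cancel; exchanging i and j then costs one sign
    from the a's and one from the b's.\<close>
  define Q where "Q = (\<lambda>i x. A i (G i x))"
  have QQ: "Q i (Q j x) = a (Suc i) (a (Suc j) (b (Suc i) (b (Suc j) x)))" if "i < m - 1" "j < m - 1" "x \<in> Z" for i j x
  proof -
    have "Q i (Q j x) = A i (A j (G i (G j x)))" using that AG GZ by (simp add: Q_def)
    also have "\<dots> = - (- a (Suc i) (a (Suc j) (b (Suc i) (b (Suc j) x))))"
      using that AA[of i j "b (Suc i) (b (Suc j) x)"] bZ bZ' by (simp add: GG A_neg)
    finally show ?thesis by simp
  qed
  show ?thesis
  proof (rule power2_dvd_card_onb[OF CZ, where Q = Q and F = "\<lambda>i. a (Suc i)"])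
    fix i assume i: "i < m - 1"
    then have si: "Suc i < m" "0 < m" by auto
    show "linear (Q i)" unfolding Q_def A_def G_def
      using linear_compose[OF linear_compose[OF linear_compose[OF lin(2) lin(2)] lin(1)] lin(1)] by (simp add: o_def)
    show "linear (a (Suc i))" by (rule lin)
    fix x assume x: "x \<in> Z"
    show "Q i x \<in> Z" using i x AZ GZ by (simp add: Q_def)
    show "a (Suc i) x \<in> Z" "a (Suc i) (a (Suc i) x) = x" using si x aZ aa by auto
    show "inner (a (Suc i) x) v = inner x (a (Suc i) v)" for v by (rule a_self)
    show "Q i (Q i x) = x" using QQ[OF i i x] bb[OF si(1) x] aa[OF si(1) x] by simp
    show "a (Suc i) (Q i x) = - Q i (a (Suc i) x)"
      by (simp add: Q_def A_def aG[OF i si(1) x] a_anti[OF si _ GZ[OF i aZ[OF si(1) x]]])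
    show "inner (Q i x) v = inner x (Q i v)" if v: "v \<in> Z" for v
    proof -
      have "inner (Q i x) v = inner x (b (Suc i) (b 0 (a (Suc i) (a 0 v))))"
        by (simp add: Q_def A_def G_def a_self b_self)
      also have "b (Suc i) (b 0 (a (Suc i) (a 0 v))) = G i (A i v)"
        by (simp add: G_def A_def b_neg a_anti[OF si _ v] b_anti[OF si _ AZ[OF i v], unfolded A_def])
      finally show ?thesis using AG[OF i i v] by (simp add: Q_def)
    qed
    fix j assume j: "j < m - 1" and ij: "i \<noteq> j"
    then have sj: "Suc j < m" by auto
    show "Q i (Q j x) = Q j (Q i x)"
      using ij by (simp add: QQ[OF i j x] QQ[OF j i x] a_neg b_anti[OF si(1) sj _ x]
          a_anti[OF si(1) sj _ bZ'[OF sj bZ[OF si(1) x]]])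
    show "a (Suc i) (Q j x) = Q j (a (Suc i) x)"
      using ij by (simp add: Q_def A_def a_neg a_anti[OF si _ aZ[OF sj GZ[OF j x]]]
          a_anti[OF si(1) sj _ GZ[OF j x]] aG[OF j si(1) x])
  qed
qed

lemma classification_at:
  "(\<exists>d. reducible_at d) \<or> card B2 \<in> {5, 8, 14}"
proof -
  obtain CY CZ CY' CZ' where b: "onb CY Y" "onb CZ Z" "onb CY' Y'" "onb CZ' Z'" by (rule bases)
  note rel = card_relations[OF b]
  show ?thesis
  proof (cases "Z = {0}")
    case True
    then show ?thesis using Z_zero_reducible by blast
  next
    case False
    then obtain x where "x \<in> Z" "x \<noteq> 0" using subspaces subspace_0 by blast
    define z where "z = x /\<^sub>R norm x"
    have z: "z \<in> Z" "inner z z = 1" using \<open>x \<in> Z\<close> \<open>x \<noteq> 0\<close> subspaces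
      by (auto simp: z_def subspace_scale dot_square_norm power2_eq_square)
    show ?thesis
    proof (cases "card CY = 1")
      case True
      then show ?thesis using one_dim_reducible[OF z refl b(1)] by blast
    next
      case False
      then have cZ: "card CZ = 2 * (card CY - 1)" by (rule card_eigen[OF z refl b(1,2)])
      \<comment> \<open>Then dim V2 = (m + 1) + 2m + 1 = 3m + 2.\<close>
      define m where "m = card CY'"
      have m: "card CY = m + 1" "m \<ge> 1" "card CZ = 2 * m" using rel False cZ by (auto simp: m_def)
      then have "2 ^ (m - 1) dvd 2 * m" using power2_dvd_card_Z[OF b(1-3) m(1) m_def[symmetric] m(2)] by simp
      then have "m \<in> {1, 2, 4}" using power2_dvd_cases m(2) by blast
      then show ?thesis using rel(3) m by auto
    qed
  qed
qed

end

section \<open>Existence of an idempotent and the reducible cubic\<close>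

context graded_algebra
begin

text \<open>On the unit circle of V2 an idempotent is, up to sign, a u whose square is parallel to
  u. The component of the square of u along the tangent v changes sign between u and -u, so it has a
  zero.\<close>

lemma planar_idempotent:
  assumes "onb {a, b} V2" "a \<noteq> b"
  obtains c where "c \<in> V2" "inner c c = 1" "c \<star> c = c"
proof -
  have ab: "inner a a = 1" "inner b b = 1" "inner a b = 0" "inner b a = 0"
    using onb_inner_basis[OF assms(1)] assms(2) by auto
  have mem: "a \<in> V2" "b \<in> V2" using onb_subset[OF assms(1)] by auto
  define u where "u = (\<lambda>t. cos t *\<^sub>R a + sin t *\<^sub>R b)"
  define v where "v = (\<lambda>t. - sin t *\<^sub>R a + cos t *\<^sub>R b)"
  define f where "f = (\<lambda>t. inner (u t \<star> u t) (v t))"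
  have cont: "continuous_on S f" for S
    unfolding f_def u_def v_def by (simp add: inner_add_left inner_add_right) (intro continuous_intros)
  have "f pi = - f 0" by (simp add: f_def u_def v_def)
  then have "\<exists>t. f t = 0"
    using IVT'[of f 0 0 pi] IVT2'[of f pi 0 0] cont[of "{0..pi}"] by (cases "f 0 \<le> 0") auto
  then obtain t where t: "f t = 0" by blast
  define k where "k = inner (u t \<star> u t) (u t)"
  have uV: "u t \<in> V2" unfolding u_def using mem sub2 by (intro subspace_add subspace_scale)
  have sc: "(cos t)\<^sup>2 + (sin t)\<^sup>2 = 1" by simp
  have uu: "inner (u t) (u t) = 1"
    using sc by (simp add: u_def inner_add_left inner_add_right ab power2_eq_square)
  define p q where "p = inner (u t \<star> u t) a" and "q = inner (u t \<star> u t) b"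
  have e: "p * cos t + q * sin t = k" "q * cos t = p * sin t"
    using t by (simp_all add: p_def q_def f_def k_def u_def v_def inner_add_right algebra_simps)
  have "k * cos t = p * cos t * cos t + (q * cos t) * sin t" by (simp flip: e(1) add: algebra_simps)
  then have "k * cos t = p * ((cos t)\<^sup>2 + (sin t)\<^sup>2)"
    unfolding e(2) by (simp only: algebra_simps power2_eq_square)
  moreover have "k * sin t = (p * sin t) * cos t + q * sin t * sin t" by (simp flip: e(1) add: algebra_simps)
  then have "k * sin t = q * ((cos t)\<^sup>2 + (sin t)\<^sup>2)"
    unfolding e(2)[symmetric] by (simp only: algebra_simps power2_eq_square)
  ultimately have pq: "p = k * cos t" "q = k * sin t" using sc by simp_all
  have "u t \<star> u t = p *\<^sub>R a + q *\<^sub>R b"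
    using onb_expand[OF assms(1) closed22[OF uV uV]] assms(2) by (simp add: p_def q_def)
  then have sq: "u t \<star> u t = k *\<^sub>R u t" by (simp add: pq u_def scaleR_add_right)
  \<comment> \<open>The norm identity leaves k = 1 or k = -1, and k times u is the idempotent in
    both cases.\<close>
  then have "k * k = 1" using norm2[OF uV] uu by simp
  then have kk: "k *\<^sub>R (k *\<^sub>R x) = x" "k * (k * r) = r" for x :: 'a and r by (simp_all flip: mult.assoc)
  show ?thesis
  proof (rule that[of "k *\<^sub>R u t"])
    show "k *\<^sub>R u t \<in> V2" using uV sub2 by (simp add: subspace_scale)
    show "inner (k *\<^sub>R u t) (k *\<^sub>R u t) = 1" using \<open>k * k = 1\<close> uu by simp
    show "(k *\<^sub>R u t) \<star> (k *\<^sub>R u t) = k *\<^sub>R u t" using kk by (simp add: sq)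
  qed
qed

lemma idempotent_exists:
  obtains c where "c \<in> V2" "inner c c = 1" "c \<star> c = c"
proof (cases "V3 = {0}")
  case True
  then have "B3 \<subseteq> {0}" using onb_subset[OF B3] by simp
  moreover have "0 \<notin> B3" using onb_inner_basis[OF B3, of 0 0] by auto
  ultimately have "B3 = {}" by blast
  then have "card B2 = 2" using card_B2 by simp
  then obtain a b where "B2 = {a, b}" "a \<noteq> b" by (auto simp: card_2_iff)
  then show ?thesis using planar_idempotent that B2 by blast
next
  case False
  then obtain x where "x \<in> V3" "x \<noteq> 0" using sub3 subspace_0 by blast
  then have "x /\<^sub>R norm x \<in> V3" "inner (x /\<^sub>R norm x) (x /\<^sub>R norm x) = 1" using sub3
    by (auto simp: subspace_scale dot_square_norm power2_eq_square)
  then show ?thesis using square_idempotent that by blast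
qed

lemma classification: "(\<exists>c. reducible_at c) \<or> card B2 \<in> {5, 8, 14}"
proof -
  obtain c where c: "c \<in> V2" "inner c c = 1" "c \<star> c = c" by (rule idempotent_exists)
  interpret graded_algebra_idem "(\<star>)" V2 V3 B2 B3 c by unfold_locales (use c in auto)
  show ?thesis by (rule classification_at)
qed

text \<open>Reducibility says Z = 0; then \<open>card_relations\<close> forces Z' = 0, so V3
  coincides with Y' and all products are known.\<close>

lemma reducible_cubic:
  assumes "reducible_at c" "y \<in> V2" "inner y c = 0" "u \<in> V3"
  shows "inner ((r *\<^sub>R c + y + u) \<star> (r *\<^sub>R c + y + u)) (r *\<^sub>R c + y + u)
    = r ^ 3 - 3 * r * inner y y + 3 * r * inner u u"
proof -
  interpret graded_algebra_idem "(\<star>)" V2 V3 B2 B3 c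
    by unfold_locales (use assms(1) in \<open>auto simp: reducible_at_def\<close>)
  have Yall: "x \<in> Y" if "x \<in> V2" "inner x c = 0" for x
    using assms(1) that by (auto simp: reducible_at_def Y_def)
  have "Z = {0}"
  proof -
    have "x = 0" if x: "x \<in> Z" for x
    proof -
      have "x \<in> Y" using Yall Z_D(1)[OF x] c_orth(2)[OF x] by (simp add: inner_commute[of x c])
      then have "inner x x = 0" by (rule YZ_orth[OF _ x])
      then show ?thesis by simp
    qed
    then show ?thesis using subspaces subspace_0 by blast
  qed
  obtain CY CZ CY' CZ' where b: "onb CY Y" "onb CZ Z" "onb CY' Y'" "onb CZ' Z'" by (rule bases)
  have "CZ = {}"
  proof -
    have "CZ \<subseteq> {0}" using onb_subset[OF b(2)] \<open>Z = {0}\<close> by simp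
    moreover have "0 \<notin> CZ" using onb_inner_basis[OF b(2), of 0 0] by auto
    ultimately show ?thesis by blast
  qed
  then have "CZ' = {}" using card_relations[OF b] onb_finite[OF b(4)] by simp
  then have "Z' = {0}" using onb_span[OF b(4)] by simp
  then have u: "u \<in> Y'" using split3[OF assms(4)] by auto
  have y: "y \<in> Y" by (rule Yall[OF assms(2,3)])
  have o: "inner y u = 0" "inner u y = 0" "inner c u = 0" "inner u c = 0" "inner c y = 0" "inner y c = 0"
    using orth[OF assms(2,4)] orth[OF c(1) assms(4)] assms(3) by (simp_all add: inner_commute)
  show ?thesis
    by (simp add: mult_commute[of y c] mult_commute[of u c] mult_commute[of u y] Y_D(2)[OF y] Y'_D(2)[OF u]
        YY[OF y y] YY'[OF y u] Y'_square[OF u] inner_add_left inner_add_right c o algebra_simps power3_eq_cube)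
qed

end

section \<open>Eigencubics in normal form\<close>

lemma poly5_zero:
  fixes c0 c1 c2 c3 c4 c5 :: real
  assumes "\<And>t. c0 + c1 * t + c2 * t^2 + c3 * t^3 + c4 * t^4 + c5 * t^5 = 0"
  shows "c0 = 0" "c1 = 0" "c2 = 0" "c3 = 0" "c4 = 0" "c5 = 0"
  using assms[of 0] assms[of 1] assms[of "-1"] assms[of 2] assms[of "-2"] assms[of 3] by simp_all

text \<open>The expansion behind \<open>hsiang_coefficients\<close>, stated over bare real
  variables: y, z stand for the squared lengths, d and n for their difference and sum, and a, b, c,
  e, p, g, k1, k2, k3 for the inner products of the squares and products of the two vectors.\<close>

lemma hsiang_poly_identity:
  fixes y z :: real
  assumes H: "((t^2+d/2)^2 + (t^2*y - 2*t* s*(p+g) + (a+2*b+c)/2) + (t^2*z+4*t* s*g+2*e))*(t*T+L)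
      - (t*((t^2+d/2)^2 + ((t^2*z+4*t* s*g+2*e) - (t^2*y-2*t* s*(p+g)+(a+2*b+c)/2))/2)
        + ((s*t^2*p - t*(a+b) + s*k1/2) + (s*t^2*g + 2*t*e + 2* s*k2)) - (t^2+d/2)*(s*(p+g)-t*y)
        + (t^2+d/2)*(t*z+2* s*g) + (-2* s*t^2*g - 2*t*e + t*(b+c) + 2* s*k3))
      = l*(t^2+n)*(t*(t^2+d/2) + (s*(p+g)-t*y) + (t*z+2* s*g))"
    and y: "y = (n - d) / 2" and z: "z = (n + d) / 2"
  shows "((d\<^sup>2 / 4 + (a+2*b+c) / 2 + 2 * e) * L - s * (d * (g - p) / 2 + (k1 / 2 + 2 * k2 + 2 * k3)) - l * n * (s * (p + 3 * g)))
    + ((d\<^sup>2 / 4 + (a+2*b+c) / 2 + 2 * e) * T + s * (2 * g - 2 * p) * L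
       - (d\<^sup>2 / 4 + e - (a+2*b+c) / 4 + d * n / 2 + c - a) - l * n * (3/2 * d)) * t
    + (s * (2 * g - 2 * p) * T + 2 * z * L - s * (p + 3 * g) * (1 + l)) * t^2
    + (2 * z * T - (1 + l) * (3 * d / 2 + n)) * t^3 + L * t^4 + (T - 1 - l) * t^5 = 0"
  using H unfolding y z by (simp add: field_simps power2_eq_square power3_eq_cube eval_nat_numeral)

context comm_algebra
begin

lemma cubic_vanish:
  assumes S: "subspace S" "\<And>x. x \<in> S \<Longrightarrow> inner (x \<star> x) x = 0" and "x \<in> S" "y \<in> S" "z \<in> S"
  shows "inner (x \<star> y) z = 0"
proof -
  have *: "inner (x \<star> x) y = 0" if x: "x \<in> S" and y: "y \<in> S" for x y
  proof -
    have "inner (x \<star> y) x = inner (x \<star> x) y" "inner (x \<star> y) y = inner (y \<star> y) x"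
      "inner (y \<star> x) x = inner (x \<star> x) y" "inner (y \<star> x) y = inner (y \<star> y) x"
      by (metis mult_assoc mult_commute inner_commute)+
    moreover have "x + y \<in> S" "x - y \<in> S" using S x y by (auto simp: subspace_add subspace_diff)
    ultimately show ?thesis using S(2)[of "x + y"] S(2)[of "x - y"] S(2)[OF x] S(2)[OF y]
      by (simp add: inner_add_left inner_add_right inner_diff_left inner_diff_right)
  qed
  have "x + y \<in> S" using S assms by (simp add: subspace_add)
  then show ?thesis using *[of "x + y" z] *[of x z] *[of y z] assms
    by (simp add: inner_add_left mult_commute[of y x])
qed

end

text \<open>A normal form with zero V1 in product language. The eigenvalues -1/2 and 1/2 of L_e
  encode the term linear in |\<eta>|^2 and |\<zeta>|^2; \<open>no223\<close> and
  \<open>no333\<close> say that only terms of the shape \<psi>012 and \<psi>030 remain. The constant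
  l has absorbed the numerical factors from gradient and Hessian.\<close>

locale normal_form_algebra = comm_algebra mul
  for mul :: "'a::real_inner \<Rightarrow> 'a \<Rightarrow> 'a" (infixl "\<diamondop>" 70) +
  fixes V B V2 V3 B2 B3 :: "'a set" and e :: 'a and l :: real
  assumes B: "onb B V" and B2: "onb B2 V2" and B3: "onb B3 V3"
    and closed: "x \<diamondop> y \<in> V"
    and e: "e \<in> V" "inner e e = 1"
    and sub: "V2 \<subseteq> V" "V3 \<subseteq> V"
    and orth_e2: "x \<in> V2 \<Longrightarrow> inner x e = 0" and orth_e3: "z \<in> V3 \<Longrightarrow> inner z e = 0"
    and orth: "x \<in> V2 \<Longrightarrow> z \<in> V3 \<Longrightarrow> inner x z = 0"
    and decomp: "x \<in> V \<Longrightarrow> \<exists>t. \<exists>y\<in>V2. \<exists>z\<in>V3. x = t *\<^sub>R e + y + z"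
    and ee: "e \<diamondop> e = e"
    and e2: "x \<in> V2 \<Longrightarrow> e \<diamondop> x = - (1/2) *\<^sub>R x"
    and e3: "z \<in> V3 \<Longrightarrow> e \<diamondop> z = (1/2) *\<^sub>R z"
    and no223: "x \<in> V2 \<Longrightarrow> z \<in> V3 \<Longrightarrow> inner (x \<diamondop> x) z = 0"
    and no333: "z \<in> V3 \<Longrightarrow> inner (z \<diamondop> z) z = 0"
    and l: "l \<noteq> 0"
    and hsiang: "x \<in> V \<Longrightarrow> inner (x \<diamondop> x) (x \<diamondop> x) * trace_on B ((\<diamondop>) x) - inner (x \<diamondop> x) (x \<diamondop> (x \<diamondop> x))
      = l * inner x x * inner (x \<diamondop> x) x"
begin

definition P where "P x = x - inner x e *\<^sub>R e"

text \<open>Projecting the arguments as well as the result keeps the trilinear form symmetric on the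
  whole ambient space, as \<open>comm_algebra\<close> demands. The factor sqrt 2 is the one for
  which squares have the length |x|^2.\<close>

definition star (infixl "\<star>" 70) where "x \<star> y = sqrt 2 *\<^sub>R P (P x \<diamondop> P y)"

definition s :: real where "s = 1 / sqrt 2"

lemma ss: "s * s = 1/2" "s * (s * r) = r / 2" "s * sqrt 2 = 1" "sqrt 2 * s = 1"
  by (auto simp: s_def)

lemma subV: "subspace V" and sub2: "subspace V2" and sub3: "subspace V3"
  using B B2 B3 onb_subspace by auto

lemma P_linear: "P (x + y) = P x + P y" "P (r *\<^sub>R x) = r *\<^sub>R P x"
  by (auto simp: P_def inner_add_left algebra_simps)

lemma P_sym: "inner (P x) y = inner x (P y)"
  by (simp add: P_def inner_diff_left inner_diff_right inner_commute[of e y])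

lemma P_id: "inner x e = 0 \<Longrightarrow> P x = x"
  by (simp add: P_def)

lemma P_V: "x \<in> V \<Longrightarrow> P x \<in> V"
  unfolding P_def using e subV by (intro subspace_diff subspace_scale)

lemma P_e: "inner (P x) e = 0"
  using e by (simp add: P_def inner_diff_left)

lemma comm_algebra_star: "comm_algebra (\<star>)"
proof
  show "bilinear (\<star>)"
    unfolding bilinear_def star_def
    by (auto intro!: linearI simp: P_linear scaleR_add_right)
  show "x \<star> y = y \<star> x" for x y by (simp add: star_def mult_commute)
  show "inner (x \<star> y) z = inner x (y \<star> z)" for x y z
  proof -
    have "inner (x \<star> y) z = sqrt 2 * inner (P x \<diamondop> P y) (P z)" by (simp add: star_def P_sym)
    also have "\<dots> = sqrt 2 * inner (P x) (P y \<diamondop> P z)" by (simp only: mult_assoc)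
    also have "\<dots> = inner x (y \<star> z)" by (simp add: star_def P_sym)
    finally show ?thesis .
  qed
qed

interpretation star: comm_algebra "(\<star>)" by (rule comm_algebra_star)

lemma star_eq:
  assumes "inner x e = 0" "inner y e = 0"
  shows "x \<diamondop> y = inner (x \<diamondop> y) e *\<^sub>R e + s *\<^sub>R (x \<star> y)"
  using assms by (simp add: star_def P_id ss) (simp add: P_def)

lemma mul_e: "inner (x \<diamondop> y) e = inner x (e \<diamondop> y)"
  by (simp add: mult_assoc mult_commute[of y e])

lemma mul22: "x \<in> V2 \<Longrightarrow> y \<in> V2 \<Longrightarrow> x \<diamondop> y = (- (1/2) * inner x y) *\<^sub>R e + s *\<^sub>R (x \<star> y)"
  using star_eq[of x y] by (simp add: orth_e2 mul_e e2)

lemma mul33: "x \<in> V3 \<Longrightarrow> y \<in> V3 \<Longrightarrow> x \<diamondop> y = ((1/2) * inner x y) *\<^sub>R e + s *\<^sub>R (x \<star> y)"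
  using star_eq[of x y] by (simp add: orth_e3 mul_e e3)

lemma mul23: "x \<in> V2 \<Longrightarrow> y \<in> V3 \<Longrightarrow> x \<diamondop> y = s *\<^sub>R (x \<star> y)"
  using star_eq[of x y] orth[of x y] by (simp add: orth_e2 orth_e3 mul_e e3)

lemma star_inner: "inner x e = 0 \<Longrightarrow> inner y e = 0 \<Longrightarrow> inner z e = 0 \<Longrightarrow> inner (x \<star> y) z = sqrt 2 * inner (x \<diamondop> y) z"
  by (simp add: star_def P_id P_sym)

lemma star_e: "inner (x \<star> y) e = 0"
  by (simp add: star_def P_e)

lemma star_V: "x \<star> y \<in> V"
  unfolding star_def using closed P_V subV by (auto intro: subspace_scale)

lemma in2: 
  assumes "x \<in> V" "inner x e = 0" "\<And>z. z \<in> V3 \<Longrightarrow> inner x z = 0"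
  shows "x \<in> V2"
proof -
  obtain t y z where x: "y \<in> V2" "z \<in> V3" "x = t *\<^sub>R e + y + z" using decomp[OF assms(1)] by blast
  have "t = 0" using assms(2) x e orth_e2 orth_e3 by (simp add: inner_add_left)
  moreover have "z = 0" using assms(3)[OF x(2)] x \<open>t = 0\<close> orth by (simp add: inner_add_left)
  ultimately show ?thesis using x by simp
qed

lemma in3: 
  assumes "x \<in> V" "inner x e = 0" "\<And>y. y \<in> V2 \<Longrightarrow> inner y x = 0"
  shows "x \<in> V3"
proof -
  obtain t y z where x: "y \<in> V2" "z \<in> V3" "x = t *\<^sub>R e + y + z" using decomp[OF assms(1)] by blast
  have "t = 0" using assms(2) x e orth_e2 orth_e3 by (simp add: inner_add_left)
  moreover have "y = 0" using assms(3)[OF x(1)] x \<open>t = 0\<close> orth by (simp add: inner_add_right)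
  ultimately show ?thesis using x by simp
qed

lemma no223': "x \<in> V2 \<Longrightarrow> y \<in> V2 \<Longrightarrow> z \<in> V3 \<Longrightarrow> inner (x \<diamondop> y) z = 0"
  using no223[of "x + y" z] no223[of x z] no223[of y z] sub2
  by (simp add: subspace_add inner_add_left mult_commute[of y x])

lemma star22: "x \<in> V2 \<Longrightarrow> y \<in> V2 \<Longrightarrow> x \<star> y \<in> V2"
  by (rule in2) (simp_all add: star_V star_e star_inner orth_e2 orth_e3 no223')

lemma star23: "x \<in> V2 \<Longrightarrow> z \<in> V3 \<Longrightarrow> x \<star> z \<in> V3"
proof (rule in3)
  fix y assume "x \<in> V2" "z \<in> V3" "y \<in> V2"
  then show "inner y (x \<star> z) = 0"
    using no223'[of x y z] mult_selfadjoint[of x y z]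
    by (simp add: star_inner orth_e2 orth_e3 inner_commute[of y "x \<star> z"] mult_selfadjoint[of x z y] inner_commute[of z "x \<diamondop> y"])
qed (simp_all add: star_V star_e)

lemma star33: "x \<in> V3 \<Longrightarrow> y \<in> V3 \<Longrightarrow> x \<star> y \<in> V2"
  by (rule in2) (simp_all add: star_V star_e star_inner orth_e3 cubic_vanish[OF sub3 no333])

lemma square:
  assumes a: "a \<in> V2" and b: "b \<in> V3"
  shows "(r *\<^sub>R e + a + b) \<diamondop> (r *\<^sub>R e + a + b)
    = (r\<^sup>2 + (inner b b - inner a a) / 2) *\<^sub>R e + (s *\<^sub>R (a \<star> a + b \<star> b) - r *\<^sub>R a) + (r *\<^sub>R b + (2 * s) *\<^sub>R (a \<star> b))"
  by (rule inner_eqI)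
    (simp add: mult_commute[of a e] mult_commute[of b e] mult_commute[of b a] ee e2[OF a] e3[OF b] mul22[OF a a]
      mul33[OF b b] mul23[OF a b] inner_add_left inner_diff_left field_simps power2_eq_square)

lemma onb_adapted:
  "onb (insert e (B2 \<union> B3)) V" "e \<notin> B2 \<union> B3" "B2 \<inter> B3 = {}"
proof -
  let ?W = "{x \<in> V. inner e x = 0}"
  have W: "subspace ?W" using subV by (auto simp: subspace_def inner_add_right)
  have s2: "\<exists>y\<in>V2. \<exists>z\<in>V3. x = y + z" if x: "x \<in> ?W" for x
  proof -
    obtain t y z where x': "y \<in> V2" "z \<in> V3" "x = t *\<^sub>R e + y + z" using decomp x by blast
    then have "t = 0" using x e orth_e2 orth_e3 by (simp add: inner_add_right inner_commute[of e y] inner_commute[of e z])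
    then show ?thesis using x' by auto
  qed
  have sW: "V2 \<subseteq> ?W" "V3 \<subseteq> ?W" using sub orth_e2 orth_e3 by (auto simp: inner_commute)
  note c1 = onb_Un[OF B2 B3 orth W sW s2]
    have sp: "x - inner x e *\<^sub>R e \<in> ?W" if "x \<in> V" for x
      using that e subV by (auto simp: inner_diff_right inner_commute[of e x] intro!: subspace_diff subspace_scale)
    have oW: "inner e x = 0" if "x \<in> ?W" for x using that by simp
    have WV: "?W \<subseteq> V" by blast
    show "onb (insert e (B2 \<union> B3)) V" "e \<notin> B2 \<union> B3"
      using onb_insert[OF c1(1) e(2) oW subV e(1) WV sp] by blast+
  show "B2 \<inter> B3 = {}" by (rule c1(2))
qed

lemma trace_adapted:
  assumes "linear A"
  shows "trace_on B A = inner (A e) e + trace_on B2 A + trace_on B3 A"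
  using trace_on_unique[OF B onb_adapted(1) assms] onb_finite[OF B2] onb_finite[OF B3] onb_adapted(2,3)
  by (simp add: trace_on_insert trace_on_Un)

text \<open>Once the trace of L_e is known to vanish, the first formula becomes dim V2 = dim V3 +
  2.\<close>

lemma trace_e: "trace_on B ((\<diamondop>) e) = 1 - card B2 / 2 + card B3 / 2"
  and trace_2: "x \<in> V2 \<Longrightarrow> sqrt 2 * trace_on B ((\<diamondop>) x) = trace_on B2 ((\<star>) x) + trace_on B3 ((\<star>) x)"
proof -
  note tr = trace_adapted[OF linear_mult]
  show "trace_on B ((\<diamondop>) e) = 1 - card B2 / 2 + card B3 / 2"
    using tr[of e] trace_on_scale[OF B2, of "(\<diamondop>) e" "-1/2"] trace_on_scale[OF B3, of "(\<diamondop>) e" "1/2"] e2 e3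
    by (simp add: ee e)
  assume x: "x \<in> V2"
  have "inner (x \<diamondop> e) e = 0" using e2[OF x] orth_e2[OF x] by (simp add: mult_commute[of x e])
  moreover have "sqrt 2 * trace_on B2 ((\<diamondop>) x) = trace_on B2 ((\<star>) x)"
    unfolding trace_on_def sum_distrib_left
    by (rule sum.cong) (use onb_subset[OF B2] in \<open>auto simp: star_inner x orth_e2\<close>)
  moreover have "sqrt 2 * trace_on B3 ((\<diamondop>) x) = trace_on B3 ((\<star>) x)"
    unfolding trace_on_def sum_distrib_left
    by (rule sum.cong) (use onb_subset[OF B3] in \<open>auto simp: star_inner x orth_e2 orth_e3\<close>)
  ultimately show "sqrt 2 * trace_on B ((\<diamondop>) x) = trace_on B2 ((\<star>) x) + trace_on B3 ((\<star>) x)"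
    using tr[of x] by (simp add: distrib_left)
qed

lemma trace_linear: "trace_on B ((\<diamondop>) (r *\<^sub>R e + x)) = r * trace_on B ((\<diamondop>) e) + trace_on B ((\<diamondop>) x)"
  by (simp add: trace_on_def inner_add_left sum.distrib sum_distrib_left)

text \<open>At te + y + z the equation is a polynomial of degree 5 in t. The conclusions are its
  coefficients of t^4, t^5, t^3, t and 1, in this order. The last two are stated under T = 0, which
  is itself deduced from coefficients of higher degree in \<open>trace_e_zero\<close>.\<close>

lemma hsiang_coefficients:
  assumes y: "y \<in> V2" and z: "z \<in> V3"
  defines "T \<equiv> trace_on B ((\<diamondop>) e)" and "L \<equiv> trace_on B ((\<diamondop>) (y + z))"
    and "A \<equiv> y \<star> y" and "C \<equiv> z \<star> z" and "E \<equiv> y \<star> z" and "d \<equiv> inner z z - inner y y" and "n \<equiv> inner y y + inner z z"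
    and "p \<equiv> inner y (y \<star> y)" and "g \<equiv> inner y (z \<star> z)"
  shows "L = 0" "T - 1 = l" "2 * inner z z * T = (1 + l) * (3 * d / 2 + n)"
    "T = 0 \<Longrightarrow> d\<^sup>2 / 4 + inner E E - (inner A A + 2 * inner A C + inner C C) / 4 + d * n / 2 + inner C C - inner A A
      = - l * n * (3/2 * d)"
    "T = 0 \<Longrightarrow> d * (g - p) / 2 + (inner y (A \<star> A) + 2 * inner y (A \<star> C) + inner y (C \<star> C)) / 2
      + 2 * inner y (E \<star> E) + 2 * (inner z (A \<star> E) + inner z (C \<star> E)) = - l * n * (p + 3 * g)"
proof -
  have AV: "A \<in> V2" and CV: "C \<in> V2" and EV: "E \<in> V3"
    unfolding A_def C_def E_def using y z star22 star23 star33 by auto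
  have pg: "inner y A = p" "inner y C = g" "inner z E = g" "inner A y = p" "inner C y = g" "inner E z = g"
    using star.mult_assoc[of y z z] by (auto simp: p_def g_def A_def C_def E_def inner_commute star.mult_commute[of y z])
  have f: "inner y (y \<star> A) = inner A A" "inner y (y \<star> C) = inner A C" "inner y (z \<star> E) = inner E E"
    "inner z (y \<star> E) = inner E E" "inner z (A \<star> z) = inner A C" "inner z (C \<star> z) = inner C C"
    using star.mult_assoc[of y y A] star.mult_assoc[of y y C] star.mult_assoc[of y z E] star.mult_assoc[of z y E]
      star.mult_assoc[of A z z] star.mult_assoc[of C z z] star.mult_commute[of z y]
    by (auto simp: A_def[symmetric] C_def[symmetric] E_def[symmetric] inner_commute)
  define N where "N = d\<^sup>2 / 4 + (inner A A + 2 * inner A C + inner C C) / 2 + 2 * inner E E"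
  define K where "K = (inner y (A \<star> A) + 2 * inner y (A \<star> C) + inner y (C \<star> C)) / 2
      + 2 * inner y (E \<star> E) + 2 * (inner z (A \<star> E) + inner z (C \<star> E))"
  define K1 where "K1 = d\<^sup>2 / 4 + inner E E - (inner A A + 2 * inner A C + inner C C) / 4 + d * n / 2 + inner C C - inner A A"
  have poly: "(N * L - s * (d * (g - p) / 2 + K) - l * n * (s * (p + 3 * g)))
    + (N * T + s * (2 * g - 2 * p) * L - K1 - l * n * (3/2 * d)) * t
    + (s * (2 * g - 2 * p) * T + 2 * inner z z * L - s * (p + 3 * g) * (1 + l)) * t^2
    + (2 * inner z z * T - (1 + l) * (3 * d / 2 + n)) * t^3 + L * t^4 + (T - 1 - l) * t^5 = 0" for t
  proof -
    define x where "x = t *\<^sub>R e + y + z"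
    have xV: "x \<in> V" unfolding x_def using e y z sub subV by (intro subspace_add subspace_scale) auto
    define al where "al = t\<^sup>2 + d / 2"
    define v where "v = s *\<^sub>R (A + C) - t *\<^sub>R y"
    define w where "w = t *\<^sub>R z + (2 * s) *\<^sub>R E"
    have vV: "v \<in> V2" and wV: "w \<in> V3" unfolding v_def w_def
      using AV CV EV y z sub2 sub3 by (auto intro!: subspace_add subspace_diff subspace_scale)
    define u where "u = al *\<^sub>R e + v + w"
    have u: "x \<diamondop> x = u"
      unfolding x_def square[OF y z] u_def al_def v_def w_def d_def A_def C_def E_def by simp
    have o: "inner a b = 0" "inner b a = 0" "inner a e = 0" "inner e a = 0" "inner b e = 0" "inner e b = 0"
      if "a \<in> V2" "b \<in> V3" for a b
      using that orth orth_e2 orth_e3 by (auto simp: inner_commute)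
    have vv: "inner v v = t\<^sup>2 * inner y y - 2 * t * s * (p + g) + (inner A A + 2 * inner A C + inner C C) / 2"
      unfolding v_def
      by (simp add: inner_add_left inner_add_right inner_diff_left inner_diff_right pg inner_commute[of C A] ss
          algebra_simps power2_eq_square)
    have ww: "inner w w = t\<^sup>2 * inner z z + 4 * t * s * g + 2 * inner E E"
      unfolding w_def
      by (simp add: inner_add_left inner_add_right pg ss algebra_simps power2_eq_square)
    have yv: "inner y v = s * (p + g) - t * inner y y"
      unfolding v_def by (simp add: inner_diff_right inner_add_right pg algebra_simps)
    have zw: "inner z w = t * inner z z + 2 * s * g"
      unfolding w_def by (simp add: inner_add_right pg algebra_simps)
    have yvv: "inner y (v \<star> v) = t\<^sup>2 * p - 2 * t * s * (inner A A + inner A C)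
        + (inner y (A \<star> A) + 2 * inner y (A \<star> C) + inner y (C \<star> C)) / 2"
      unfolding v_def
      by (simp add: inner_add_right inner_diff_right star.mult_commute[of A y] star.mult_commute[of C y]
          star.mult_commute[of C A] f pg ss A_def[symmetric] algebra_simps power2_eq_square)
    have yww: "inner y (w \<star> w) = t\<^sup>2 * g + 4 * t * s * inner E E + 2 * inner y (E \<star> E)"
      unfolding w_def
      by (simp add: inner_add_right star.mult_commute[of E z] f pg ss C_def[symmetric] algebra_simps power2_eq_square)
    have zvw: "inner z (v \<star> w) = - (t\<^sup>2) * g - 2 * t * s * inner E E + t * s * (inner A C + inner C C)
        + inner z (A \<star> E) + inner z (C \<star> E)"
      unfolding v_def w_def
      by (simp add: inner_add_right inner_diff_right f pg ss E_def[symmetric] algebra_simps power2_eq_square)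
    have uu: "inner u u = al\<^sup>2 + inner v v + inner w w"
      unfolding u_def using vV wV e
      by (simp add: inner_add_left inner_add_right o power2_eq_square)
    have xu: "inner x (u \<diamondop> u) = t * (al\<^sup>2 + (inner w w - inner v v) / 2)
        + s * (inner y (v \<star> v) + inner y (w \<star> w)) - al * inner y v + al * inner z w + 2 * s * inner z (v \<star> w)"
    proof -
      have m: "v \<star> v \<in> V2" "w \<star> w \<in> V2" "v \<star> w \<in> V3" using vV wV star22 star23 star33 by auto
      show ?thesis
        unfolding x_def u_def square[OF vV wV] using e
        by (simp add: inner_add_left inner_add_right inner_diff_right o[OF y wV] o[OF vV z] o[OF y z] o[OF m(1) z]
            o[OF m(2) z] o[OF y m(3)] o[OF vV wV] o[OF m(1,3)] algebra_simps)
    qed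
    have xux: "inner (x \<diamondop> x) x = t * al + inner y v + inner z w"
      unfolding u unfolding x_def u_def using e
      by (simp add: inner_add_left inner_add_right o[OF y wV] o[OF vV z] o[OF y z] o[OF vV wV] inner_commute)
    have xx: "inner x x = t\<^sup>2 + n"
      unfolding x_def n_def using e
      by (simp add: inner_add_left inner_add_right o[OF y z] power2_eq_square)
    have "inner (x \<diamondop> x) (x \<diamondop> (x \<diamondop> x)) = inner x (u \<diamondop> u)"
      unfolding u using mult_assoc[of x u u] by (simp add: inner_commute)
    moreover have "trace_on B ((\<diamondop>) x) = t * T + L"
      unfolding x_def T_def L_def using trace_linear[of t "y + z"] by (simp add: add.assoc)
    ultimately have "inner u u * (t * T + L) - inner x (u \<diamondop> u) = l * (t\<^sup>2 + n) * (t * al + inner y v + inner z w)"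
      using hsiang[OF xV] xux xx u by simp
    moreover have svw: "s * (inner y (v \<star> v) + inner y (w \<star> w)) = (s * t^2 * p - t * (inner A A + inner A C)
        + s * (inner y (A \<star> A) + 2 * inner y (A \<star> C) + inner y (C \<star> C)) / 2)
        + (s * t^2 * g + 2 * t * inner E E + 2 * s * inner y (E \<star> E))"
      unfolding yvv yww by (simp add: ss algebra_simps)
    moreover have szw: "2 * s * inner z (v \<star> w) = - 2 * s * t^2 * g - 2 * t * inner E E + t * (inner A C + inner C C)
        + 2 * s * (inner z (A \<star> E) + inner z (C \<star> E))"
      unfolding zvw by (simp add: ss algebra_simps)
    ultimately have "inner y y = (n - d) / 2 \<Longrightarrow> inner z z = (n + d) / 2 \<Longrightarrow> ?thesis"
      unfolding N_def K_def K1_def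
      by (intro hsiang_poly_identity) (simp_all only: uu xu svw szw vv ww yv zw al_def)
    moreover have "inner y y = (n - d) / 2" "inner z z = (n + d) / 2" by (simp_all add: n_def d_def)
    ultimately show ?thesis by blast
  qed
  note co = poly5_zero[OF poly]
  show "L = 0" "T - 1 = l" "2 * inner z z * T = (1 + l) * (3 * d / 2 + n)" using co by auto
  show "T = 0 \<Longrightarrow> d\<^sup>2 / 4 + inner E E - (inner A A + 2 * inner A C + inner C C) / 4 + d * n / 2 + inner C C - inner A A
      = - l * n * (3/2 * d)" proof -
    assume "T = 0"
    then have "K1 = - l * n * (3/2 * d)" using co(2) \<open>L = 0\<close> by simp
    then show ?thesis unfolding K1_def .
  qed
  assume T: "T = 0"
  have "s * (d * (g - p) / 2 + K + l * n * (p + 3 * g)) = 0"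
    using co(1) \<open>L = 0\<close> by (simp only: distrib_left mult_zero_right) (simp add: mult.left_commute)
  then have "d * (g - p) / 2 + K = - l * n * (p + 3 * g)" by (simp add: s_def)
  then show "d * (g - p) / 2 + (inner y (A \<star> A) + 2 * inner y (A \<star> C) + inner y (C \<star> C)) / 2
      + 2 * inner y (E \<star> E) + 2 * (inner z (A \<star> E) + inner z (C \<star> E)) = - l * n * (p + 3 * g)"
    unfolding K_def by (simp only: add.assoc)
qed

text \<open>The coefficient of t^5 gives l = T - 1, so 1 + l = T. For a nonzero y in V2 and z = 0
  the coefficient of t^3 is a nonzero multiple of (1 + l)|y|^2. If V2 = 0, then T = 1 + (dim V3)/2,
  and l being nonzero supplies a unit vector of V3 to test with.\<close>

lemma trace_e_zero: "trace_on B ((\<diamondop>) e) = 0" "l = - 1"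
proof -
  let ?T = "trace_on B ((\<diamondop>) e)"
  have 0: "0 \<in> V2" "0 \<in> V3" using sub2 sub3 subspace_0 by auto
  note co = hsiang_coefficients
  have Tl: "?T - 1 = l" using co(2)[OF 0] .
  show T: "?T = 0"
  proof (cases "V2 = {0}")
    case False
    then obtain y where y: "y \<in> V2" "y \<noteq> 0" using 0 by blast
    then have "(1 + l) * inner y y = 0" using co(3)[OF y(1) 0(2)] by (simp add: algebra_simps)
    then show ?thesis using y Tl by simp
  next
    case True
    have "B2 = {}"
    proof -
      have "B2 \<subseteq> {0}" using onb_subset[OF B2] True by simp
      moreover have "0 \<notin> B2" using onb_inner_basis[OF B2, of 0 0] by auto
      ultimately show ?thesis by blast
    qed
    then have T1: "?T = 1 + card B3 / 2" using trace_e by simp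
    then have "card B3 \<noteq> 0" using Tl l by auto
    then obtain z where z: "z \<in> B3" by fastforce
    then have z': "z \<in> V3" "inner z z = 1" using onb_subset[OF B3] onb_inner_basis[OF B3 z z] by auto
    \<comment> \<open>For y = 0 and a unit z the coefficient of t^3 reads 2T = (5/2)(1 + l) =
      (5/2)T.\<close>
    show ?thesis using co(3)[OF 0(1) z'(1)] z'(2) Tl by (simp add: algebra_simps)
  qed
  then show "l = - 1" using Tl by simp
qed

lemma graded_algebra_star: "graded_algebra (\<star>) V2 V3 B2 B3"
proof unfold_locales
  have 0: "0 \<in> V2" "0 \<in> V3" using sub2 sub3 subspace_0 by auto
  note co = hsiang_coefficients(4)[OF _ _ trace_e_zero(1), unfolded trace_e_zero(2)]
  show norm2: "inner (x \<star> x) (x \<star> x) = (inner x x)\<^sup>2" if "x \<in> V2" for x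
    using co[OF that 0(2)] by (simp add: field_simps power2_eq_square)
  show norm3: "inner (z \<star> z) (z \<star> z) = (inner z z)\<^sup>2" if "z \<in> V3" for z
    using co[OF 0(1) that] by (simp add: field_simps power2_eq_square)
  show "2 * inner (x \<star> z) (x \<star> z) - inner (x \<star> x) (z \<star> z) = inner x x * inner z z" if "x \<in> V2" "z \<in> V3" for x z
    using co[OF that] norm2[OF that(1)] norm3[OF that(2)] by (simp add: field_simps power2_eq_square)
  show "(z \<star> z) \<star> (z \<star> z) = inner z z *\<^sub>R (z \<star> z)" if z: "z \<in> V3" for z
  proof -
    let ?C = "z \<star> z"
    have "inner y (?C \<star> ?C) = inner z z * inner y ?C" if y: "y \<in> V2" for y
    proof -
      have "inner z (?C \<star> (y \<star> z)) = inner ?C (z \<star> (y \<star> z))"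
        using star.mult_assoc[of z ?C "y \<star> z"] star.mult_assoc[of ?C z "y \<star> z"] by (simp add: star.mult_commute[of z ?C])
      also have "\<dots> = inner z z * inner z (y \<star> z)"
        by (rule star.norm_polar[OF sub3 norm3 z star23[OF y z]])
      also have "inner z (y \<star> z) = inner y ?C"
        using star.mult_assoc[of y z z] by (simp add: inner_commute)
      finally have CE: "inner z (?C \<star> (y \<star> z)) = inner z z * inner y ?C" .
      have "r *\<^sub>R y \<in> V2" for r using y sub2 by (simp add: subspace_scale)
      note c5 = hsiang_coefficients(5)[OF this z trace_e_zero(1), unfolded trace_e_zero(2)]
      \<comment> \<open>The constant coefficient has terms of degree 1, 3 and 5 in y only; three
        multiples of y isolate the linear part. With \<open>CE\<close> this part reads: half the
        unknown inner product equals (3 - 1/2 - 2) times the inner product of y and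
        \<open>?C\<close> times |z|^2.\<close>
      show ?thesis using c5[of 1] c5[of 2] c5[of 3] CE
        by (simp add: algebra_simps add_divide_distrib diff_divide_distrib) linarith?
    qed
    then have "inner (?C \<star> ?C - inner z z *\<^sub>R ?C) y = 0" if "y \<in> V2" for y
      using that by (subst inner_commute) (simp add: inner_diff_right)
    moreover have "?C \<star> ?C - inner z z *\<^sub>R ?C \<in> V2"
      using star22 star33 z sub2 by (auto intro!: subspace_diff subspace_scale)
    ultimately have "?C \<star> ?C - inner z z *\<^sub>R ?C = 0" by (intro onb_vanish[OF B2])
    then show ?thesis by simp
  qed
  show "trace_on B2 ((\<star>) x) + trace_on B3 ((\<star>) x) = 0" if "x \<in> V2" for x
    using trace_2[OF that] hsiang_coefficients(1)[OF that 0(2)] by simp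
  show "card B2 = card B3 + 2" using trace_e trace_e_zero(1) by simp
qed (use B2 B3 orth star22 star23 star33 in auto)

interpretation star: graded_algebra "(\<star>)" V2 V3 B2 B3 by (rule graded_algebra_star)

lemma cubic_value:
  assumes y: "y \<in> V2" and z: "z \<in> V3"
  shows "inner ((t *\<^sub>R e + y + z) \<diamondop> (t *\<^sub>R e + y + z)) (t *\<^sub>R e + y + z)
    = t ^ 3 + 3/2 * t * (inner z z - inner y y) + s * inner ((y + z) \<star> (y + z)) (y + z)"
proof -
  have o: "inner y e = 0" "inner e y = 0" "inner z e = 0" "inner e z = 0" "inner y z = 0" "inner z y = 0"
    using y z by (simp_all add: orth orth_e2 orth_e3 inner_commute[of e y] inner_commute[of e z] inner_commute[of z y])
  have m: "inner (y \<star> y) z = 0" "inner (z \<star> z) z = 0" "inner (y \<star> z) y = 0"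
     "inner (y \<star> y) e = 0" "inner (z \<star> z) e = 0" "inner (y \<star> z) e = 0"
    using star22[OF y y] star23[OF y z] star33[OF z z] y z
    by (simp_all add: star_e orth inner_commute[of "y \<star> z" y])
  show ?thesis
    unfolding square[OF y z] using e(2)
    by (simp add: inner_add_left inner_add_right inner_diff_left o m star.mult_commute[of z y]
       field_simps power2_eq_square power3_eq_cube)
qed

section \<open>The linear factor at a reducible idempotent\<close>

definition proj where "proj C x = (\<Sum>b\<in>C. inner x b *\<^sub>R b)"

lemma linear_proj: "linear (proj C)"
  by (rule linearI) (auto simp: proj_def inner_add_left scaleR_add_left sum.distrib scaleR_right.sum)

lemma proj_sym: "inner (proj C x) y = inner x (proj C y)"
  by (simp add: proj_def inner_sum_left inner_sum_right inner_commute mult.commute)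

lemma proj_adapted:
  assumes "y \<in> V2" "z \<in> V3"
  shows "proj B2 (t *\<^sub>R e + y + z) = y" "proj B3 (t *\<^sub>R e + y + z) = z"
proof -
  have "proj B2 (t *\<^sub>R e + y + z) = (\<Sum>b\<in>B2. inner y b *\<^sub>R b)"
    unfolding proj_def using onb_subset[OF B2] orth[OF _ assms(2)] orth_e2
    by (intro sum.cong) (auto simp: inner_add_left inner_commute[of e] inner_commute[of z] subset_iff)
  then show "proj B2 (t *\<^sub>R e + y + z) = y" using onb_expand[OF B2 assms(1)] by simp
  have "proj B3 (t *\<^sub>R e + y + z) = (\<Sum>b\<in>B3. inner z b *\<^sub>R b)"
    unfolding proj_def using onb_subset[OF B3] orth[OF assms(1)] orth_e3
    by (intro sum.cong) (auto simp: inner_add_left inner_commute[of e] subset_iff)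
  then show "proj B3 (t *\<^sub>R e + y + z) = z" using onb_expand[OF B3 assms(2)] by simp
qed

text \<open>At te + rc + y + z, with y orthogonal to c, the cubic has the factor t + sqrt(2) r, and
  v is the unit vector of this linear form. The quadratic cofactor is diagonal: M is 0 on v, 1 on v1
  and on V3, and -1 on the complement of c in V2. Its trace is 1 + dim V3 - (dim V2 - 1) =
  0.\<close>

lemma reducible_form:
  assumes c: "star.reducible_at c"
  obtains v M k where "v \<in> V" "inner v v = 1" "linear M" "\<And>x. x \<in> V \<Longrightarrow> M x \<in> V"
    "\<And>x y. inner (M x) y = inner x (M y)" "M v = 0" "\<And>x. x \<in> V \<Longrightarrow> M (M x) = x - inner x v *\<^sub>R v"
    "trace_on B M = 0" "k \<noteq> 0" "\<And>x. x \<in> V \<Longrightarrow> inner (x \<diamondop> x) x = k * inner x v * inner x (M x)"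
proof -
  define a where "a = 1 / sqrt 3"
  have aa: "a * a = 1/3" "a * (a * r) = r / 3" for r by (auto simp: a_def)
  have qq: "sqrt 2 * (sqrt 2 * r) = 2 * r" for r by (simp flip: mult.assoc)
  have c2: "c \<in> V2" "inner c c = 1" using c by (auto simp: star.reducible_at_def)
  have ce: "inner c e = 0" "inner e c = 0" using orth_e2[OF c2(1)] by (auto simp: inner_commute)
  define v where "v = a *\<^sub>R e + (a * sqrt 2) *\<^sub>R c"
  \<comment> \<open>Completes v to an orthonormal basis of the plane of e and c.\<close>
  define v1 where "v1 = (a * sqrt 2) *\<^sub>R e - a *\<^sub>R c"
  define M where "M = (\<lambda>x. inner x v1 *\<^sub>R v1 - (proj B2 x - inner x c *\<^sub>R c) + proj B3 x)"
  have vV: "v \<in> V" unfolding v_def using e(1) c2(1) sub subV by (auto intro!: subspace_add subspace_scale)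
  have vv: "inner v v = 1" by (simp add: v_def inner_add_left inner_add_right ce c2 e aa qq algebra_simps)
  have linM: "linear M"
    unfolding M_def
    by (rule linearI) (simp_all add: linear_add[OF linear_proj] linear_scale[OF linear_proj] inner_add_left algebra_simps)
  have symM: "inner (M x) y = inner x (M y)" for x y
    unfolding M_def
    by (simp add: inner_add_left inner_add_right inner_diff_left inner_diff_right proj_sym)
      (simp add: inner_commute)
  have M: "M (t *\<^sub>R e + r *\<^sub>R c + y + z)
      = ((2 * t - sqrt 2 * r) / 3) *\<^sub>R e + ((r - sqrt 2 * t) / 3) *\<^sub>R c - y + z"
    if yz: "y \<in> V2" "inner y c = 0" "z \<in> V3" for t r y z
  proof -
    let ?x = "t *\<^sub>R e + r *\<^sub>R c + y + z"
    have xe: "?x = t *\<^sub>R e + (r *\<^sub>R c + y) + z" by simp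
    have rcy: "r *\<^sub>R c + y \<in> V2" using yz c2 sub2 by (simp add: subspace_add subspace_scale)
    have p: "proj B2 ?x = r *\<^sub>R c + y" "proj B3 ?x = z"
      unfolding xe by (rule proj_adapted[OF rcy yz(3)])+
    have o: "inner z c = 0" "inner z e = 0" "inner y e = 0"
      using orth[OF c2(1) yz(3)] yz by (simp_all add: inner_commute[of z c] orth_e2 orth_e3)
    have i: "inner ?x v1 = a * (sqrt 2 * t - r)" "inner ?x c = r"
      by (simp_all add: v1_def inner_add_left inner_diff_right ce e c2 o yz algebra_simps)
    show ?thesis
      unfolding M_def i p by (rule inner_eqI)
        (simp add: v1_def inner_add_left inner_diff_left aa qq field_simps)
  qed
  have dec: "\<exists>t r. \<exists>y\<in>V2. \<exists>z\<in>V3. inner y c = 0 \<and> x = t *\<^sub>R e + r *\<^sub>R c + y + z" if x: "x \<in> V" for x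
  proof -
    obtain t y z where y: "y \<in> V2" "z \<in> V3" "x = t *\<^sub>R e + y + z" using decomp[OF x] by blast
    have "y - inner y c *\<^sub>R c \<in> V2" using y c2 sub2 by (simp add: subspace_diff subspace_scale)
    moreover have "inner (y - inner y c *\<^sub>R c) c = 0" using c2 by (simp add: inner_diff_left)
    moreover have "x = t *\<^sub>R e + inner y c *\<^sub>R c + (y - inner y c *\<^sub>R c) + z" using y by simp
    ultimately show ?thesis using y(2) by blast
  qed
  show ?thesis
  proof (rule that[of v M "3/2 * sqrt 3"])
    show "v \<in> V" "inner v v = 1" "linear M" "inner (M x) y = inner x (M y)" for x y by fact+
    have 0: "0 \<in> V2" "0 \<in> V3" using sub2 sub3 subspace_0 by auto
    show "M v = 0" using M[OF 0(1) _ 0(2), of a "a * sqrt 2"] by (simp add: v_def qq)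
    show "(3/2 * sqrt 3 :: real) \<noteq> 0" by simp
    have "trace_on B3 M = card B3"
    proof -
      have "M x = 1 *\<^sub>R x" if "x \<in> V3" for x using M[OF 0(1) _ that, of 0 0] by simp
      then show ?thesis using trace_on_scale[OF B3, of M 1] by simp
    qed
    moreover have "trace_on B2 M = 4/3 - card B2"
    proof -
      have "inner (M b) b = 4/3 * (inner c b * inner c b) - 1" if b: "b \<in> B2" for b
      proof -
        have bV: "b \<in> V2" "inner b b = 1" using b onb_subset[OF B2] onb_inner_basis[OF B2 b b] by auto
        have "proj B2 b = b" "proj B3 b = 0" using proj_adapted[OF bV(1) 0(2), of 0] by auto
        then show ?thesis
          using bV orth_e2[OF bV(1)]
          by (simp add: M_def v1_def inner_add_left inner_diff_left inner_diff_right inner_commute[of e b]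
              inner_commute[of c b] aa algebra_simps)
      qed
      then have "trace_on B2 M = (\<Sum>b\<in>B2. 4/3 * (inner c b * inner c b) - 1)"
        unfolding trace_on_def by (intro sum.cong) auto
      also have "\<dots> = 4/3 * inner c c - card B2"
        by (subst onb_inner[OF B2 c2(1)]) (simp add: sum_subtractf sum_distrib_left)
      finally show ?thesis using c2 by simp
    qed
    moreover have "inner (M e) e = 2/3" using M[OF 0(1) _ 0(2), of 1 0] e ce by (simp add: inner_diff_left)
    ultimately show "trace_on B M = 0" using trace_adapted[OF linM] star.card_B2 by simp
    fix x assume x: "x \<in> V"
    obtain t r y z where d: "y \<in> V2" "z \<in> V3" "inner y c = 0" "x = t *\<^sub>R e + r *\<^sub>R c + y + z"
      using dec[OF x] by blast
    have my: "- y \<in> V2" "inner (- y) c = 0" using d sub2 by (auto simp: subspace_neg)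
    have Mx: "M x = ((2 * t - sqrt 2 * r) / 3) *\<^sub>R e + ((r - sqrt 2 * t) / 3) *\<^sub>R c - y + z"
      unfolding d(4) by (rule M[OF d(1,3,2)])
    show "M x \<in> V" unfolding Mx using d e c2 sub subV by (auto intro!: subspace_add subspace_diff subspace_scale)
    have o: "inner z c = 0" "inner z e = 0" "inner y e = 0" "inner c z = 0" "inner e z = 0" "inner e y = 0" "inner c y = 0"
       "inner y z = 0" "inner z y = 0"
      using orth[OF c2(1) d(2)] orth[OF d(1,2)] d(1-3)
      by (simp_all add: inner_commute[of z c] inner_commute[of c y] inner_commute[of e y] inner_commute[of e z]
          inner_commute[of z y] orth_e2 orth_e3)
    have xv: "inner x v = a * (t + sqrt 2 * r)"
      unfolding d(4) v_def by (simp add: inner_add_left inner_add_right o ce c2 e d(3) algebra_simps)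
    have "M (M x) = ((2 * ((2 * t - sqrt 2 * r) / 3) - sqrt 2 * ((r - sqrt 2 * t) / 3)) / 3) *\<^sub>R e
        + (((r - sqrt 2 * t) / 3 - sqrt 2 * ((2 * t - sqrt 2 * r) / 3)) / 3) *\<^sub>R c - (- y) + z"
      unfolding Mx using M[OF my d(2), of "(2 * t - sqrt 2 * r) / 3" "(r - sqrt 2 * t) / 3"] by simp
    also have "(2 * ((2 * t - sqrt 2 * r) / 3) - sqrt 2 * ((r - sqrt 2 * t) / 3)) / 3 = (2 * t - sqrt 2 * r) / 3"
      by (simp add: qq algebra_simps add_divide_distrib diff_divide_distrib)
    also have "((r - sqrt 2 * t) / 3 - sqrt 2 * ((2 * t - sqrt 2 * r) / 3)) / 3 = (r - sqrt 2 * t) / 3"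
      by (simp add: qq algebra_simps add_divide_distrib diff_divide_distrib)
    finally have MM: "M (M x) = ((2 * t - sqrt 2 * r) / 3) *\<^sub>R e + ((r - sqrt 2 * t) / 3) *\<^sub>R c - (- y) + z" .
    have k: "a * (t + sqrt 2 * r) * a = (a * a) * (t + sqrt 2 * r)"
      "a * (t + sqrt 2 * r) * (a * sqrt 2) = (a * a) * (sqrt 2 * t + sqrt 2 * (sqrt 2 * r))"
      by (simp_all only: distrib_left distrib_right ac_simps)
    have "inner x v *\<^sub>R v = (a * (t + sqrt 2 * r)) *\<^sub>R v" by (simp only: xv)
    also have "\<dots> = ((t + sqrt 2 * r) / 3) *\<^sub>R e + ((sqrt 2 * t + 2 * r) / 3) *\<^sub>R c"
      unfolding v_def scaleR_add_right scaleR_scaleR k aa qq by simp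
    finally show "M (M x) = x - inner x v *\<^sub>R v"
      unfolding MM by (simp only: d(4))
        (rule inner_eqI, simp add: inner_add_left inner_diff_left algebra_simps add_divide_distrib diff_divide_distrib)
    have rc: "r *\<^sub>R c + y \<in> V2" using d c2 sub2 by (simp add: subspace_add subspace_scale)
    have F: "inner (x \<diamondop> x) x = t ^ 3 + 3/2 * t * (inner z z - r * r - inner y y)
        + s * (r ^ 3 - 3 * r * inner y y + 3 * r * inner z z)"
      using cubic_value[OF rc d(2), of t] star.reducible_cubic[OF c d(1,3,2), of r] d(3) c2
      by (simp add: d(4) add.assoc inner_add_left inner_add_right o)
    have xM: "inner x (M x) = (2 * t * t - 2 * sqrt 2 * t * r + r * r) / 3 - inner y y + inner z z"
      unfolding Mx unfolding d(4)
      by (simp add: inner_add_left inner_add_right inner_diff_right o ce c2 e d(3) field_simps)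
    have q: "sqrt 2 = 2 * s" by (simp add: s_def real_div_sqrt)
    have "inner (x \<diamondop> x) x = 3/2 * (t + sqrt 2 * r) * inner x (M x)"
      unfolding F xM q
      by (simp add: power3_eq_cube ss algebra_simps add_divide_distrib diff_divide_distrib)
    also have "3/2 * (t + sqrt 2 * r) = 3/2 * sqrt 3 * inner x v" unfolding xv by (simp add: a_def)
    finally show "inner (x \<diamondop> x) x = 3/2 * sqrt 3 * inner x v * inner x (M x)" .
  qed
qed

theorem classification:
  "card B2 \<in> {5, 8, 14} \<or> (\<exists>v M k. v \<in> V \<and> inner v v = 1 \<and> linear M \<and> (\<forall>x\<in>V. M x \<in> V) \<and>
    (\<forall>x y. inner (M x) y = inner x (M y)) \<and> M v = 0 \<and> (\<forall>x\<in>V. M (M x) = x - inner x v *\<^sub>R v) \<and>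
    trace_on B M = 0 \<and> k \<noteq> 0 \<and> (\<forall>x\<in>V. inner (x \<diamondop> x) x = k * inner x v * inner x (M x)))"
proof (cases "\<exists>c. star.reducible_at c")
  case True
  then obtain c where c: "star.reducible_at c" by blast
  show ?thesis
  proof (rule reducible_form[OF c], goal_cases)
    case (1 v M k)
    then show ?case by (intro disjI2 exI[of _ v] exI[of _ M] exI[of _ k] conjI ballI allI)
  qed
next
  case False
  then show ?thesis using star.classification by blast
qed

lemma card_B: "card B = 2 * card B2 - 1" "card B2 \<ge> 2"
proof -
  have "card B = card (insert e (B2 \<union> B3))" using onb_dim[OF B] onb_dim[OF onb_adapted(1)] by simp
  also have "\<dots> = 1 + (card B2 + card B3)"
    using onb_adapted(2,3) onb_finite[OF B2] onb_finite[OF B3] by (simp add: card_Un_disjoint)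
  finally show "card B = 2 * card B2 - 1" "card B2 \<ge> 2" using star.card_B2 by auto
qed

end

section \<open>Vectors of varying dimension\<close>

text \<open>
  All spaces $\mathbb{R}^n$ are embedded into one inner product space, so that the results for the type class
  \<open>real_inner\<close> apply to the carrier-based vectors of the statement.
\<close>

typedef fsvec = "{f :: nat \<Rightarrow> real. finite {i. f i \<noteq> 0}}" morphisms coord Fsvec
  by (rule exI[of _ "\<lambda>_. 0"]) simp

setup_lifting type_definition_fsvec

lemma finite_coord: "finite {i. coord x i \<noteq> 0}"
  using coord[of x] by simp

instantiation fsvec :: real_vector
begin

lift_definition zero_fsvec :: fsvec is "\<lambda>_. 0" by simp

lift_definition plus_fsvec :: "fsvec \<Rightarrow> fsvec \<Rightarrow> fsvec" is "\<lambda>f g i. f i + g i"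
  subgoal for f g by (rule finite_subset[of _ "{i. f i \<noteq> 0} \<union> {i. g i \<noteq> 0}"]) auto
  done

lift_definition uminus_fsvec :: "fsvec \<Rightarrow> fsvec" is "\<lambda>f i. - f i" by simp

lift_definition minus_fsvec :: "fsvec \<Rightarrow> fsvec \<Rightarrow> fsvec" is "\<lambda>f g i. f i - g i"
  subgoal for f g by (rule finite_subset[of _ "{i. f i \<noteq> 0} \<union> {i. g i \<noteq> 0}"]) auto
  done

lift_definition scaleR_fsvec :: "real \<Rightarrow> fsvec \<Rightarrow> fsvec" is "\<lambda>r f i. r * f i"
  by (rule finite_subset[rotated]) auto

instance
  by standard (transfer; auto simp: algebra_simps)+

end

lemma coord_simps [simp]:
  "coord 0 i = 0" "coord (x + y) i = coord x i + coord y i" "coord (- x) i = - coord x i"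
  "coord (x - y) i = coord x i - coord y i" "coord (r *\<^sub>R x) i = r * coord x i"
  by (transfer; simp)+

lemma fsvec_eqI: "(\<And>i. coord x i = coord y i) \<Longrightarrow> x = y"
  by transfer auto

lemma coord_sum [simp]: "coord (\<Sum>a\<in>A. g a) i = (\<Sum>a\<in>A. coord (g a) i)"
  by (induction A rule: infinite_finite_induct) auto

instantiation fsvec :: real_inner
begin

definition inner_fsvec :: "fsvec \<Rightarrow> fsvec \<Rightarrow> real" where
  "inner_fsvec x y = (\<Sum>i | coord x i \<noteq> 0. coord x i * coord y i)"

definition norm_fsvec :: "fsvec \<Rightarrow> real" where "norm_fsvec x = sqrt (inner x x)"

definition dist_fsvec :: "fsvec \<Rightarrow> fsvec \<Rightarrow> real" where "dist_fsvec x y = norm (x - y)"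

definition sgn_fsvec :: "fsvec \<Rightarrow> fsvec" where "sgn_fsvec x = x /\<^sub>R norm x"

definition uniformity_fsvec :: "(fsvec \<times> fsvec) filter" where
  "uniformity_fsvec = (INF e\<in>{0<..}. principal {(x, y). dist x y < e})"

definition open_fsvec :: "fsvec set \<Rightarrow> bool" where
  "open_fsvec U \<longleftrightarrow> (\<forall>x\<in>U. \<forall>\<^sub>F (x', y) in uniformity. x' = x \<longrightarrow> y \<in> U)"

lemma inner_fsvec_superset:
  assumes "finite S" "{i. coord x i \<noteq> 0} \<subseteq> S"
  shows "inner x y = (\<Sum>i\<in>S. coord x i * coord y i)"
  unfolding inner_fsvec_def by (rule sum.mono_neutral_left) (use assms in auto)

instance
proof
  fix x y z :: fsvec and r :: real
  let ?S = "{i. coord x i \<noteq> 0} \<union> {i. coord y i \<noteq> 0}"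
  have S: "finite ?S" by (simp add: finite_coord)
  show "inner x y = inner y x"
    using inner_fsvec_superset[OF S, of x y] inner_fsvec_superset[OF S, of y x] by (simp add: mult.commute)
  show "inner (x + y) z = inner x z + inner y z"
  proof -
    have "{i. coord (x + y) i \<noteq> 0} \<subseteq> ?S" by auto
    from inner_fsvec_superset[OF S this] show ?thesis
      using inner_fsvec_superset[OF S, of x z] inner_fsvec_superset[OF S, of y z]
      by (simp add: distrib_right sum.distrib)
  qed
  show "inner (r *\<^sub>R x) y = r * inner x y"
    using inner_fsvec_superset[OF finite_coord[of x], of "r *\<^sub>R x" y]
    by (auto simp: inner_fsvec_def[of x] sum_distrib_left mult.assoc)
  show "0 \<le> inner x x" by (auto simp: inner_fsvec_def intro: sum_nonneg)
  show "inner x x = 0 \<longleftrightarrow> x = 0"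
  proof
    assume "inner x x = 0"
    then have "\<forall>i\<in>{i. coord x i \<noteq> 0}. coord x i * coord x i = 0"
      unfolding inner_fsvec_def by (subst (asm) sum_nonneg_eq_0_iff) (auto simp: finite_coord)
    then show "x = 0" by (intro fsvec_eqI) auto
  qed (simp add: inner_fsvec_def)
  show "dist x y = norm (x - y)" by (rule dist_fsvec_def)
  show "norm x = sqrt (inner x x)" by (rule norm_fsvec_def)
  show "sgn x = x /\<^sub>R norm x" by (rule sgn_fsvec_def)
  show "(uniformity :: (fsvec \<times> fsvec) filter) = (INF e\<in>{0<..}. principal {(x, y). dist x y < e})"
    by (rule uniformity_fsvec_def)
  show "open U \<longleftrightarrow> (\<forall>x\<in>U. \<forall>\<^sub>F (x', y) in uniformity. x' = x \<longrightarrow> y \<in> U)" for U :: "fsvec set"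
    by (rule open_fsvec_def)
qed

end

definition Rn :: "nat \<Rightarrow> fsvec set" where "Rn n = {x. \<forall>i\<ge>n. coord x i = 0}"

lift_definition unit :: "nat \<Rightarrow> fsvec" is "\<lambda>k i. if i = k then 1 else 0" by simp

lemma coord_unit [simp]: "coord (unit k) i = (if i = k then 1 else 0)"
  by transfer simp

lemma subspace_Rn: "subspace (Rn n)"
  by (auto simp: subspace_def Rn_def)

lemma inner_Rn: "x \<in> Rn n \<Longrightarrow> inner x y = (\<Sum>i<n. coord x i * coord y i)"
  by (rule inner_fsvec_superset) (auto simp: Rn_def not_le[symmetric])

lemma unit_Rn [simp]: "k < n \<Longrightarrow> unit k \<in> Rn n"
  by (auto simp: Rn_def)

lemma inner_unit [simp]: "inner (unit k) x = coord x k" "inner x (unit k) = coord x k"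
proof -
  show "inner (unit k) x = coord x k"
    using inner_Rn[of "unit k" "Suc k" x] by (simp add: if_distrib[of "\<lambda>t. t * _"] cong: if_cong)
  then show "inner x (unit k) = coord x k" by (simp add: inner_commute)
qed

lemma expand_unit: "x \<in> Rn n \<Longrightarrow> (\<Sum>k<n. coord x k *\<^sub>R unit k) = x"
  by (rule fsvec_eqI) (auto simp: Rn_def if_distrib[of "\<lambda>t. _ * t"] not_less cong: if_cong)

lemma inj_unit: "inj_on unit A"
  by (rule inj_onI) (metis coord_unit zero_neq_one)

lemma onb_unit: "onb (unit ` {..<n}) (Rn n)"
proof -
  have "span (unit ` {..<n}) = Rn n"
  proof
    show "span (unit ` {..<n}) \<subseteq> Rn n" by (rule span_minimal) (auto simp: subspace_Rn)
    show "Rn n \<subseteq> span (unit ` {..<n})"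
    proof
      fix x assume "x \<in> Rn n"
      have "(\<Sum>k<n. coord x k *\<^sub>R unit k) \<in> span (unit ` {..<n})"
        by (intro span_sum span_scale span_base) auto
      then show "x \<in> span (unit ` {..<n})" using expand_unit[OF \<open>x \<in> Rn n\<close>] by simp
    qed
  qed
  then show ?thesis using inj_unit[of UNIV] by (auto simp: onb_def dest: injD)
qed

lemma trace_unit: "trace_on (unit ` {..<n}) A = (\<Sum>i<n. coord (A (unit i)) i)"
  unfolding trace_on_def by (subst sum.reindex[OF inj_unit]) simp

section \<open>Passage between carrier vectors and finitely supported sequences\<close>

definition of_fs :: "nat \<Rightarrow> fsvec \<Rightarrow> rvec" where "of_fs n x = Matrix.vec n (coord x)"

definition to_fs :: "rvec \<Rightarrow> fsvec" where "to_fs v = Fsvec (\<lambda>i. if i < dim_vec v then v $ i else 0)"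

lemma coord_to_fs [simp]: "coord (to_fs v) i = (if i < dim_vec v then v $ i else 0)"
proof -
  have "{i. (if i < dim_vec v then v $ i else 0) \<noteq> 0} \<subseteq> {..<dim_vec v}" by (auto split: if_splits)
  then have "finite {i. (if i < dim_vec v then v $ i else 0) \<noteq> 0}" by (rule finite_subset) simp
  then show ?thesis by (simp add: to_fs_def Fsvec_inverse)
qed

lemma to_fs_Rn: "v \<in> carrier_vec n \<Longrightarrow> to_fs v \<in> Rn n"
  by (auto simp: Rn_def)

lemma of_fs_carrier [simp]: "of_fs n x \<in> carrier_vec n"
  by (simp add: of_fs_def)

lemma of_to_fs [simp]: "v \<in> carrier_vec n \<Longrightarrow> of_fs n (to_fs v) = v"
  by (rule eq_vecI) (auto simp: of_fs_def)

lemma to_of_fs [simp]: "x \<in> Rn n \<Longrightarrow> to_fs (of_fs n x) = x"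
  by (rule fsvec_eqI) (auto simp: of_fs_def Rn_def)

lemma to_fs_add: "u \<in> carrier_vec n \<Longrightarrow> v \<in> carrier_vec n \<Longrightarrow> to_fs (u + v) = to_fs u + to_fs v"
  by (rule fsvec_eqI) auto

lemma to_fs_smult: "to_fs (r \<cdot>\<^sub>v v) = r *\<^sub>R to_fs v"
  by (rule fsvec_eqI) auto

lemma to_fs_zero: "to_fs (0\<^sub>v n) = 0"
  by (rule fsvec_eqI) auto

lemma to_fs_unit: "i < n \<Longrightarrow> to_fs (unit_vec n i) = unit i"
  by (rule fsvec_eqI) auto

lemma to_fs_inner: "u \<in> carrier_vec n \<Longrightarrow> v \<in> carrier_vec n \<Longrightarrow> inner (to_fs u) (to_fs v) = u \<bullet> v"
  using inner_Rn[OF to_fs_Rn] by (auto simp: scalar_prod_def atLeast0LessThan)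

lemma to_fs_inj: "u \<in> carrier_vec n \<Longrightarrow> v \<in> carrier_vec n \<Longrightarrow> to_fs u = to_fs v \<Longrightarrow> u = v"
  by (metis of_to_fs)

section \<open>The algebra of a cubic form and the differential operator\<close>

definition cubic_algebra :: "nat \<Rightarrow> (rvec \<Rightarrow> real) \<Rightarrow> (fsvec \<Rightarrow> fsvec \<Rightarrow> fsvec) \<Rightarrow> bool" where
  "cubic_algebra n f m \<longleftrightarrow> comm_algebra m \<and> (\<forall>x y. m x y \<in> Rn n) \<and>
    (\<forall>v\<in>carrier_vec n. f v = inner (m (to_fs v) (to_fs v)) (to_fs v))"

lemma linear_expand:
  fixes g :: "fsvec \<Rightarrow> real"
  assumes "linear g" "\<And>x. (\<And>i. i < n \<Longrightarrow> coord x i = 0) \<Longrightarrow> g x = 0"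
  shows "(\<Sum>k<n. g (unit k) * coord x k) = g x"
proof -
  have "g (x - (\<Sum>k<n. coord x k *\<^sub>R unit k)) = 0"
    by (rule assms(2)) (simp add: if_distrib[of "\<lambda>t. _ * t"] cong: if_cong)
  then show ?thesis using assms(1) by (simp add: linear_diff linear_sum linear_scale mult.commute)
qed

text \<open>The product is the Riesz vector of the third argument. By \<open>supp\<close> the form
  does not see coordinates beyond n, so the defining relation holds against every z of the
  infinite-dimensional type and not only on \<open>Rn n\<close>.\<close>

lemma trilinear_algebra:
  fixes t :: "fsvec \<Rightarrow> fsvec \<Rightarrow> fsvec \<Rightarrow> real"
  assumes lin: "\<And>x y. linear (t x y)" and sym: "\<And>x y z. t x y z = t y x z" "\<And>x y z. t x y z = t x z y"
    and supp: "\<And>x y z. (\<And>i. i < n \<Longrightarrow> coord z i = 0) \<Longrightarrow> t x y z = 0"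
  defines "m \<equiv> (\<lambda>x y. \<Sum>k<n. t x y (unit k) *\<^sub>R unit k)"
  shows "comm_algebra m" "m x y \<in> Rn n" "inner (m x y) z = t x y z"
proof -
  have inn: "inner (m x y) z = t x y z" for x y z
    unfolding m_def inner_sum_left using linear_expand[OF lin supp, of n x y z] by (simp add: mult.commute)
  show "inner (m x y) z = t x y z" by (rule inn)
  show "m x y \<in> Rn n" unfolding m_def by (intro subspace_sum subspace_scale subspace_Rn) auto
  have s3: "t x y z = t y z x" for x y z using sym by metis
  show "comm_algebra m"
  proof
    have r: "linear (m x)" for x
      by (rule linearI; rule inner_eqI)
        (simp_all add: inn inner_add_left s3[of x] s3[of _ _ x] linear_add[OF lin] linear_scale[OF lin] sym(2)[of x _ _])
    moreover have "m x y = m y x" for x y unfolding m_def using sym(1)[of x y] by simp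
    then have "(\<lambda>x. m x y) = m y" for y by auto
    ultimately show "bilinear m" by (simp add: bilinear_def)
    show "m x y = m y x" for x y by fact
    show "inner (m x y) z = inner x (m y z)" for x y z
      using inn[of x y z] inn[of y z x] s3[of x y z] by (simp add: inner_commute)
  qed
qed

lemma cubic_form_algebra:
  assumes "cubic_form n f"
  obtains m where "cubic_algebra n f m"
proof -
  obtain c where c: "\<And>v. v \<in> carrier_vec n \<Longrightarrow> f v = (\<Sum>i<n. \<Sum>j<n. \<Sum>k<n. c i j k * v $ i * v $ j * v $ k)"
    using assms unfolding cubic_form_def by blast
  define q where "q = (\<lambda>x y z. \<Sum>i<n. \<Sum>j<n. \<Sum>k<n. c i j k * coord x i * coord y j * coord z k)"
  \<comment> \<open>The coefficients of a cubic form need not be symmetric; averaging over the six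
    permutations symmetrises the form and keeps its diagonal.\<close>
  define t where "t = (\<lambda>x y z. (q x y z + q x z y + q y x z + q y z x + q z x y + q z y x) / 6)"
  have q_lin: "q (x + x') y z = q x y z + q x' y z" "q x (y + y') z = q x y z + q x y' z" "q x y (z + z') = q x y z + q x y z'"
    "q (r *\<^sub>R x) y z = r * q x y z" "q x (r *\<^sub>R y) z = r * q x y z" "q x y (r *\<^sub>R z) = r * q x y z" for x x' y y' z z' r
    by (simp_all add: q_def distrib_left distrib_right sum.distrib sum_distrib_left ac_simps)
  have lin: "linear (t x y)" for x y
    by (rule linearI) (simp_all add: t_def q_lin add_divide_distrib distrib_left)
  have sym: "t x y z = t y x z" "t x y z = t x z y" for x y z by (simp_all add: t_def ac_simps)
  have supp: "t x y z = 0" if "\<And>i. i < n \<Longrightarrow> coord z i = 0" for x y z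
    using that by (simp add: t_def q_def)
  note m = trilinear_algebra[of t, OF lin sym supp]
  define m' where "m' = (\<lambda>x y. \<Sum>k<n. t x y (unit k) *\<^sub>R unit k)"
  have "f v = inner (m' (to_fs v) (to_fs v)) (to_fs v)" if v: "v \<in> carrier_vec n" for v
  proof -
    have "q (to_fs v) (to_fs v) (to_fs v) = f v"
      unfolding c[OF v] q_def using v by (intro sum.cong) auto
    moreover have "inner (m' (to_fs v) (to_fs v)) (to_fs v) = t (to_fs v) (to_fs v) (to_fs v)"
      unfolding m'_def by (rule m(3))
    ultimately show ?thesis by (simp add: t_def)
  qed
  then have "cubic_algebra n f m'"
    unfolding cubic_algebra_def m'_def using m(1,2)[of n] by blast
  then show ?thesis by (rule that)
qed

context comm_algebra
begin

lemma mult_sum_left: "(\<Sum>a\<in>A. g a) \<star> y = (\<Sum>a\<in>A. g a \<star> y)"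
  by (induction A rule: infinite_finite_induct) auto

end

lemma deriv_poly: "deriv (\<lambda>t::real. a + b * t + c * t\<^sup>2 + d * t ^ 3) 0 = b"
  by (rule DERIV_imp_deriv) (auto intro!: derivative_eq_intros)

lemma to_fs_line:
  assumes "v \<in> carrier_vec n" "i < n"
  shows "to_fs (v + t \<cdot>\<^sub>v unit_vec n i) = to_fs v + t *\<^sub>R unit i" "v + t \<cdot>\<^sub>v unit_vec n i \<in> carrier_vec n"
  using assms to_fs_add[of v n "t \<cdot>\<^sub>v unit_vec n i"] by (auto simp: to_fs_smult to_fs_unit)

text \<open>The gradient of the cubic is three times the square of x: on a coordinate line the cubic
  is a polynomial in t, and the derivative at 0 is its linear coefficient.\<close>

lemma partial_algebra:
  assumes m: "cubic_algebra n f m" and v: "v \<in> carrier_vec n" and i: "i < n"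
  shows "partial n i f v = 3 * coord (m (to_fs v) (to_fs v)) i"
proof -
  interpret comm_algebra m using m by (simp add: cubic_algebra_def)
  define x b where "x = to_fs v" and "b = unit i"
  have eq: "inner (m b x) x = inner (m x x) b" "inner (m x b) x = inner (m x x) b" "inner (m b x) b = inner (m b b) x"
    "inner (m x b) b = inner (m b b) x"
    by (metis mult_assoc mult_commute inner_commute)+
  have "f (v + t \<cdot>\<^sub>v unit_vec n i) = inner (m x x) x + (3 * inner (m x x) b) * t + (3 * inner (m b b) x) * t\<^sup>2
      + inner (m b b) b * t ^ 3" for t
    using m to_fs_line[OF v i, of t]
    by (simp add: cubic_algebra_def inner_add_left inner_add_right eq flip: x_def b_def)
      (simp add: eq algebra_simps power2_eq_square power3_eq_cube)
  then show ?thesis unfolding partial_def by (simp only: deriv_poly) (simp add: x_def b_def)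
qed

lemma partial_partial_algebra:
  assumes m: "cubic_algebra n f m" and v: "v \<in> carrier_vec n" and i: "i < n" and j: "j < n"
  shows "partial n j (partial n i f) v = 6 * coord (m (to_fs v) (unit j)) i"
proof -
  interpret comm_algebra m using m by (simp add: cubic_algebra_def)
  define x b where "x = to_fs v" and "b = unit j"
  have "partial n i f (v + t \<cdot>\<^sub>v unit_vec n j) = 3 * coord (m x x) i + (6 * coord (m x b) i) * t
      + (3 * coord (m b b) i) * t\<^sup>2 + 0 * t ^ 3" for t
    using partial_algebra[OF m to_fs_line(2)[OF v j] i] to_fs_line(1)[OF v j, of t]
    by (simp add: mult_commute[of b x] algebra_simps power2_eq_square flip: x_def b_def)
  then show ?thesis unfolding partial_def[of n j] by (simp only: deriv_poly) (simp add: x_def b_def)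
qed

text \<open>With gradient 3x^2 and Hessian 6L_x both terms of the operator carry the factor 3 * 3 *
  6 = 54.\<close>

lemma hsiang_op_algebra:
  assumes m: "cubic_algebra n f m" and v: "v \<in> carrier_vec n"
  defines "x \<equiv> to_fs v"
  shows "hsiang_op n f v = 54 * (inner (m x x) (m x x) * trace_on (unit ` {..<n}) (m x) - inner (m x x) (m x (m x x)))"
proof -
  interpret comm_algebra m using m by (simp add: cubic_algebra_def)
  have mem: "m a b \<in> Rn n" for a b using m by (simp add: cubic_algebra_def)
  have 1: "(\<Sum>i<n. (partial n i f v)\<^sup>2) = 9 * inner (m x x) (m x x)"
    unfolding inner_Rn[OF mem] sum_distrib_left
    by (intro sum.cong) (auto simp: partial_algebra[OF m v] x_def power2_eq_square)
  have 2: "(\<Sum>i<n. partial n i (partial n i f) v) = 6 * trace_on (unit ` {..<n}) (m x)"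
    unfolding trace_unit sum_distrib_left
    by (intro sum.cong) (auto simp: partial_partial_algebra[OF m v] x_def)
  have "m x (\<Sum>j<n. coord (m x x) j *\<^sub>R unit j) = (\<Sum>j<n. coord (m x x) j *\<^sub>R m x (unit j))"
    by (simp add: linear_sum[OF linear_mult])
  then have "m x (m x x) = (\<Sum>j<n. coord (m x x) j *\<^sub>R m x (unit j))"
    by (simp only: expand_unit[OF mem])
  then have 4: "coord (m x (m x x)) i = (\<Sum>j<n. coord (m x x) j * coord (m x (unit j)) i)" for i by simp
  have 3: "(\<Sum>i<n. \<Sum>j<n. partial n i f v * partial n j f v * partial n j (partial n i f) v)
      = 54 * inner (m x x) (m x (m x x))"
    unfolding inner_Rn[OF mem] 4 sum_distrib_left
    by (intro sum.cong) (auto simp: partial_algebra[OF m v] partial_partial_algebra[OF m v] x_def)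
  show ?thesis unfolding hsiang_op_def 1 2 3 by simp
qed

lemma to_fs_subspace:
  assumes "is_subspace n W"
  shows "W \<subseteq> carrier_vec n" "subspace (to_fs ` W)" "to_fs ` W \<subseteq> Rn n"
proof -
  interpret vec_space "TYPE(real)" n .
  have sub: "submodule class_ring W V" using assms by (simp add: VectorSpace.subspace_def)
  show W: "W \<subseteq> carrier_vec n" using submodule.subset[OF sub] by simp
  then show "to_fs ` W \<subseteq> Rn n" using to_fs_Rn by blast
  have z: "0\<^sub>v n \<in> W" using submodule.zero_closed[OF sub] by simp
  have a: "u + v \<in> W" if "u \<in> W" "v \<in> W" for u v using submodule.m_closed[OF sub that] by simp
  have s: "r \<cdot>\<^sub>v u \<in> W" if "u \<in> W" for u r using submodule.smult_closed[OF sub _ that, of r] by simp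
  show "subspace (to_fs ` W)"
    unfolding subspace_def
  proof (intro conjI ballI allI)
    show "0 \<in> to_fs ` W" using z to_fs_zero by force
    fix x y r assume "x \<in> to_fs ` W" 
    then obtain u where u: "u \<in> W" "x = to_fs u" by blast
    show "r *\<^sub>R x \<in> to_fs ` W" using s[OF u(1)] u(2) by (metis to_fs_smult imageI)
    assume "y \<in> to_fs ` W"
    then obtain v where v: "v \<in> W" "y = to_fs v" by blast
    have "to_fs (u + v) = x + y" using to_fs_add[of u n v] u v W by auto
    then show "x + y \<in> to_fs ` W" using a[OF u(1) v(1)] by (metis imageI)
  qed
qed

lemma is_subspaceI:
  assumes "subspace S" "S \<subseteq> Rn n"
  shows "is_subspace n (of_fs n ` S)" "to_fs ` of_fs n ` S = S"
proof -
  interpret vec_space "TYPE(real)" n .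
  show im: "to_fs ` of_fs n ` S = S" using assms(2) by (force simp: image_iff)
  have mem: "v \<in> of_fs n ` S \<longleftrightarrow> v \<in> carrier_vec n \<and> to_fs v \<in> S" for v
    using assms(2) by (auto simp: image_iff) (metis of_to_fs)
  have "submodule class_ring (of_fs n ` S) V"
  proof (unfold_locales)
    show "of_fs n ` S \<subseteq> carrier V" by auto
    show "u \<oplus>\<^bsub>V\<^esub> v \<in> of_fs n ` S" if "u \<in> of_fs n ` S" "v \<in> of_fs n ` S" for u v
      using that assms(1) unfolding mem by (auto simp: to_fs_add subspace_add)
    show "\<zero>\<^bsub>V\<^esub> \<in> of_fs n ` S" using assms(1) unfolding mem by (auto simp: to_fs_zero subspace_0)
    show "r \<odot>\<^bsub>V\<^esub> v \<in> of_fs n ` S" if "v \<in> of_fs n ` S" for r v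
      using that assms(1) unfolding mem by (auto simp: to_fs_smult subspace_scale)
  qed
  then show "is_subspace n (of_fs n ` S)" unfolding VectorSpace.subspace_def using vectorspace_axioms by blast
qed

text \<open>Connects the carrier-based dimension of the statement with the cardinalities used in the
  algebraic part: an orthonormal basis is carried over to a linearly independent spanning
  set.\<close>

lemma subspace_dim_onb:
  assumes W: "is_subspace n W" and C: "onb C (to_fs ` W)"
  shows "subspace_dim n W = card C"
proof -
  interpret vec_space "TYPE(real)" n .
  have sub: "submodule class_ring W V" using W by (simp add: VectorSpace.subspace_def)
  note WC = to_fs_subspace[OF W]
  have CW: "C \<subseteq> to_fs ` W" using onb_subset[OF C] .
  then have Cn: "C \<subseteq> Rn n" using WC(3) by blast
  have inj: "inj_on (of_fs n) C" by (rule inj_onI) (metis Cn subsetD to_of_fs)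
  let ?A = "of_fs n ` C"
  have AW: "?A \<subseteq> W" using CW WC(1) by (auto simp: subset_iff image_iff)
  have fA: "finite ?A" using onb_finite[OF C] by simp
  have Ac: "?A \<subseteq> carrier_vec n" by auto
  have lc: "to_fs (lincomb a ?A) = (\<Sum>c\<in>C. a (of_fs n c) *\<^sub>R c)" for a
  proof (rule fsvec_eqI)
    fix i
    have cl: "lincomb a ?A \<in> carrier_vec n" using lincomb_closed[OF Ac, of a] by simp
    show "coord (to_fs (lincomb a ?A)) i = coord (\<Sum>c\<in>C. a (of_fs n c) *\<^sub>R c) i"
    proof (cases "i < n")
      case True
      then have "coord (to_fs (lincomb a ?A)) i = (\<Sum>c\<in>C. a (of_fs n c) * of_fs n c $ i)"
        using cl by (simp add: lincomb_index[OF True Ac] sum.reindex[OF inj])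
      then show ?thesis using True by (simp add: of_fs_def)
    next
      case False
      then show ?thesis using cl Cn by (auto simp: Rn_def subset_iff intro!: sum.neutral[symmetric])
    qed
  qed
  have li: "lin_indpt ?A"
  proof (rule finite_lin_indpt2[OF fA Ac], goal_cases)
    case (1 a)
    then have z: "(\<Sum>c\<in>C. a (of_fs n c) *\<^sub>R c) = 0" using lc[of a] to_fs_zero[of n] by simp
    have "a (of_fs n d) = 0" if d: "d \<in> C" for d
    proof -
      have "0 = inner (\<Sum>c\<in>C. a (of_fs n c) *\<^sub>R c) d" using z by simp
      also have "\<dots> = (\<Sum>c\<in>C. if c = d then a (of_fs n d) else 0)"
        unfolding inner_sum_left by (rule sum.cong) (use onb_inner_basis[OF C _ d] in auto)
      also have "\<dots> = a (of_fs n d)" using d onb_finite[OF C] by simp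
      finally show ?thesis by simp
    qed
    then show ?case by (auto simp: class_ring_simps)
  qed
  have sp: "span ?A = W"
  proof
    show "span ?A \<subseteq> W" by (rule span_is_subset[OF AW sub])
    show "W \<subseteq> span ?A"
    proof
      fix w assume w: "w \<in> W"
      define a where "a = (\<lambda>v. inner (to_fs w) (to_fs v))"
      have "to_fs (lincomb a ?A) = (\<Sum>c\<in>C. inner (to_fs w) c *\<^sub>R c)"
        unfolding lc a_def by (rule sum.cong) (use Cn in auto)
      also have "\<dots> = to_fs w" using onb_expand[OF C] w by auto
      finally have "lincomb a ?A = w"
        using to_fs_inj[of "lincomb a ?A" n w] lincomb_closed[OF Ac, of a] w WC(1) by auto
      then show "w \<in> span ?A" unfolding span_def using fA by (force simp: class_ring_simps)
    qed
  qed
  interpret w: vectorspace class_ring "V\<lparr>carrier := W\<rparr>" by (rule subspace_is_vs[OF W])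
  have "w.basis ?A"
    unfolding w.basis_def using li sp AW span_li_not_depend[OF AW sub] by simp
  then show ?thesis using w.dim_basis[OF fA] card_image[OF inj] by simp
qed

text \<open>The line of v becomes the single z-coordinate, so q = 0, and its complement becomes the
  y-space, on which M is a symmetric involution. As Mv = 0, the trace of that involution is the
  trace of M, which supplies the extra condition imposed for q = 0.\<close>

lemma reducible_congruent_clifford:
  assumes n: "n = 2 * k + 1" "k \<ge> 1" and v: "v \<in> Rn n" "inner v v = 1"
    and M: "linear M" "\<And>x. x \<in> Rn n \<Longrightarrow> M x \<in> Rn n" "\<And>x y. inner (M x) y = inner x (M y)" "M v = 0"
      "\<And>x. x \<in> Rn n \<Longrightarrow> M (M x) = x - inner x v *\<^sub>R v" "trace_on (unit ` {..<n}) M = 0"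
    and f: "r \<noteq> 0" "\<And>x. x \<in> carrier_vec n \<Longrightarrow> f x = r * inner (to_fs x) v * inner (to_fs x) (M (to_fs x))"
  shows "\<exists>m q A. clifford_system m q A \<and> n = q + 1 + 2 * m \<and> congruent n f (clifford_cubic m q A)"
proof -
  let ?W = "{x \<in> Rn n. inner v x = 0}"
  have W: "subspace ?W" using subspace_Rn[of n] by (auto simp: subspace_def inner_add_right)
  obtain C where C: "onb C ?W" using onb_sub_exists[OF onb_unit W] by blast
  have vC: "onb (insert v C) (Rn n)" "v \<notin> C"
  proof -
    have "x - inner x v *\<^sub>R v \<in> ?W" if "x \<in> Rn n" for x
      using that v subspace_Rn[of n]
      by (auto simp: inner_diff_right inner_commute[of v x] intro!: subspace_diff subspace_scale)
    moreover have "inner v x = 0" if "x \<in> ?W" for x using that by simp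
    ultimately show "onb (insert v C) (Rn n)" "v \<notin> C"
      using onb_insert[OF C v(2) _ subspace_Rn v(1)] by blast+
  qed
  have "card (insert v C) = n"
    using onb_dim[OF vC(1)] onb_dim[OF onb_unit] card_image[OF inj_unit, of "{..<n}"] by simp
  then have cC: "card C = 2 * k" using vC(2) onb_finite[OF C] n by simp
  obtain c where c: "bij_betw c {..<2 * k} C"
    using ex_bij_betw_nat_finite[OF onb_finite[OF C]] cC by (auto simp: atLeast0LessThan)
  have cW: "c i \<in> Rn n" "inner v (c i) = 0" if "i < 2 * k" for i
    using bij_betwE[OF c] onb_subset[OF C] that by auto
  have cc: "inner (c i) (c j) = (if i = j then 1 else 0)" if "i < 2 * k" "j < 2 * k" for i j
    using onb_inner_basis[OF C, of "c i" "c j"] bij_betwE[OF c] bij_betw_imp_inj_on[OF c] that by (auto simp: inj_on_def)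
  have sumC: "(\<Sum>i<2 * k. g (c i)) = sum g C" for g :: "fsvec \<Rightarrow> real" by (rule sum.reindex_bij_betw[OF c])
  have MW: "M x \<in> ?W" if "x \<in> Rn n" for x using M(2)[OF that] M(3)[of v x] M(4) by simp
  have innW: "(\<Sum>i<2 * k. inner w (c i) * inner x (c i)) = inner w x" if "w \<in> ?W" for w x
    using onb_inner[OF C that, of x] sumC[of "\<lambda>b. inner w b * inner x b"] by (simp add: inner_commute)
  \<comment> \<open>The z-coordinate precedes the y-coordinates, so v has index 0 and the basis of
    the complement is shifted by one.\<close>
  define b where "b = (\<lambda>i. if i = 0 then v else c (i - 1))"
  have sumb: "(\<Sum>i<n. g (b i)) = g v + sum g C" for g :: "fsvec \<Rightarrow> real"
    unfolding n sumC[symmetric] by (simp add: b_def sum.lessThan_Suc_shift del: sum.lessThan_Suc)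
  have bn: "b i \<in> Rn n" if "i < n" for i using cW[of "i - 1"] v that by (auto simp: b_def n)
  define U where "U = mat n n (\<lambda>(i, j). coord (b i) j)"
  define A0 where "A0 = mat (2 * k) (2 * k) (\<lambda>(i, j). inner (M (c j)) (c i))"
  have U: "U \<in> carrier_mat n n" by (simp add: U_def)
  have UU: "transpose_mat U * U = 1\<^sub>m n"
  proof (rule eq_matI)
    fix i j assume ij: "i < dim_row (1\<^sub>m n)" "j < dim_col (1\<^sub>m n :: real mat)"
    then have "(transpose_mat U * U) $$ (i, j) = (\<Sum>l<n. coord (b l) i * coord (b l) j)"
      by (simp add: U_def scalar_prod_def atLeast0LessThan)
    also have "\<dots> = (\<Sum>d\<in>insert v C. inner (unit i) d * inner (unit j) d)"
      using sumb[of "\<lambda>d. coord d i * coord d j"] vC(2) onb_finite[OF C] by simp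
    also have "\<dots> = inner (unit i) (unit j)"
      using onb_inner[OF vC(1), of "unit i" "unit j"] ij by (simp add: inner_commute)
    finally show "(transpose_mat U * U) $$ (i, j) = 1\<^sub>m n $$ (i, j)" using ij by simp
  qed (use U in auto)
  have Ux: "(U *\<^sub>v x) $ i = inner (to_fs x) (b i)" if "x \<in> carrier_vec n" "i < n" for x i
    using that inner_Rn[OF bn[OF that(2)], of "to_fs x"]
    by (simp add: U_def scalar_prod_def atLeast0LessThan inner_commute[of "to_fs x"])
  have "clifford_system k 0 (\<lambda>_. A0)"
    unfolding clifford_system_def
  proof (intro conjI allI impI)
    show "k \<ge> 1" by fact
    show "A0 \<in> carrier_mat (2 * k) (2 * k)" by (simp add: A0_def)
    show "transpose_mat A0 = A0"
      by (rule eq_matI) (auto simp: A0_def, metis M(3) inner_commute)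
    have sq: "(A0 * A0) $$ (i, j) = (if i = j then 1 else 0)" if "i < 2 * k" "j < 2 * k" for i j
    proof -
      have "(A0 * A0) $$ (i, j) = (\<Sum>l<2 * k. inner (M (c l)) (c i) * inner (M (c j)) (c l))"
        using that by (simp add: A0_def scalar_prod_def atLeast0LessThan)
      also have "\<dots> = (\<Sum>l<2 * k. inner (M (c j)) (c l) * inner (M (c i)) (c l))"
        by (intro sum.cong refl) (metis M(3) inner_commute mult.commute)
      also have "\<dots> = inner (M (c j)) (M (c i))" by (rule innW[OF MW[OF cW(1)[OF that(2)]]])
      also have "\<dots> = inner (c j) (c i)"
        using M(5)[OF cW(1)[OF that(1)]] cW(2)[OF that(1)] by (simp add: M(3) inner_commute[of "c i" v])
      finally show ?thesis using cc that by auto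
    qed
    show "A0 * A0 + A0 * A0 = (if i = j then 2 else 0) \<cdot>\<^sub>m 1\<^sub>m (2 * k)" if "i \<le> 0" "j \<le> 0" for i j :: nat
      by (rule eq_matI) (use that sq in \<open>auto simp: A0_def\<close>)
    have "(\<Sum>i<2 * k. A0 $$ (i, i)) = trace_on C M"
      unfolding trace_on_def sumC[symmetric] by (simp add: A0_def)
    also have "\<dots> = trace_on (insert v C) M" using vC(2) onb_finite[OF C] M(4) by (simp add: trace_on_insert)
    also have "\<dots> = 0" using trace_on_unique[OF vC(1) onb_unit M(1)] M(6) by simp
    finally show "(\<Sum>i<2 * k. A0 $$ (i, i)) = 0" .
  qed
  moreover have "congruent n f (clifford_cubic k 0 (\<lambda>_. A0))"
    unfolding congruent_def
  proof (intro bexI[OF _ U] exI[of _ r] conjI ballI)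
    fix x :: rvec assume x: "x \<in> carrier_vec n"
    define X where "X = to_fs x"
    have X: "X \<in> Rn n" unfolding X_def using x by (rule to_fs_Rn)
    define y where "y = vec_last (U *\<^sub>v x) (2 * k)"
    have y: "y \<in> carrier_vec (2 * k)" "\<And>i. i < 2 * k \<Longrightarrow> y $ i = inner X (c i)"
      using U Ux[OF x, of "Suc _"] by (auto simp: y_def vec_last_def n X_def b_def)
    have "y \<bullet> (A0 *\<^sub>v y) = (\<Sum>i<2 * k. inner X (c i) * (\<Sum>j<2 * k. inner (M (c j)) (c i) * inner X (c j)))"
      using y by (simp add: scalar_prod_def atLeast0LessThan A0_def)
    also have "\<dots> = (\<Sum>j<2 * k. \<Sum>i<2 * k. inner X (c j) * (inner (M (c j)) (c i) * inner X (c i)))"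
      unfolding sum_distrib_left by (subst sum.swap) (simp add: ac_simps)
    also have "\<dots> = (\<Sum>j<2 * k. inner (M X) (c j) * inner X (c j))"
      by (intro sum.cong refl)
        (simp add: innW[OF MW[OF cW(1)]] M(3)[of X] inner_commute[of X "M _"] flip: sum_distrib_left)
    also have "\<dots> = inner X (M X)" using innW[OF MW[OF X], of X] by (simp add: inner_commute)
    finally have "clifford_cubic k 0 (\<lambda>_. A0) (U *\<^sub>v x) = inner X (M X) * inner X v"
      using Ux[OF x, of 0] n U by (simp add: clifford_cubic_def Let_def y_def vec_first_def X_def b_def)
    then show "f x = r * clifford_cubic k 0 (\<lambda>_. A0) (U *\<^sub>v x)" using f(2)[OF x] by (simp add: X_def)
  qed (use UU f in auto)
  ultimately show ?thesis using n by force
qed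

text \<open>A cubic in three real variables is determined by its values at small integer points; d
  and g are the values of \<psi>012 and \<psi>030, about which nothing is assumed.\<close>

lemma (in comm_algebra) cubic_relations:
  assumes "\<exists>d g. \<forall>t b r. inner ((t *\<^sub>R e + b *\<^sub>R y + r *\<^sub>R z) \<star> (t *\<^sub>R e + b *\<^sub>R y + r *\<^sub>R z)) (t *\<^sub>R e + b *\<^sub>R y + r *\<^sub>R z)
    = t ^ 3 - 3/2 * t * (b\<^sup>2 * p - r\<^sup>2 * q) + b * r\<^sup>2 * d + b ^ 3 * g"
  shows "inner (e \<star> e) e = 1" "inner (e \<star> e) y = 0" "inner (e \<star> e) z = 0" "inner (e \<star> y) y = - (1/2) * p"
    "inner (e \<star> z) z = (1/2) * q" "inner (e \<star> y) z = 0" "inner (y \<star> y) z = 0" "inner (z \<star> z) z = 0"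
proof -
  obtain d g where F: "\<And>t b r. inner ((t *\<^sub>R e + b *\<^sub>R y + r *\<^sub>R z) \<star> (t *\<^sub>R e + b *\<^sub>R y + r *\<^sub>R z)) (t *\<^sub>R e + b *\<^sub>R y + r *\<^sub>R z)
    = t ^ 3 - 3/2 * t * (b\<^sup>2 * p - r\<^sup>2 * q) + b * r\<^sup>2 * d + b ^ 3 * g" using assms by blast
  have s: "inner (e \<star> y) e = inner (e \<star> e) y" "inner (y \<star> e) e = inner (e \<star> e) y"
    "inner (e \<star> z) e = inner (e \<star> e) z" "inner (z \<star> e) e = inner (e \<star> e) z"
    "inner (y \<star> e) y = inner (e \<star> y) y" "inner (y \<star> y) e = inner (e \<star> y) y"
    "inner (z \<star> e) z = inner (e \<star> z) z" "inner (z \<star> z) e = inner (e \<star> z) z"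
    "inner (y \<star> e) z = inner (e \<star> y) z" "inner (y \<star> z) e = inner (e \<star> y) z" "inner (z \<star> y) e = inner (e \<star> y) z"
    "inner (e \<star> z) y = inner (e \<star> y) z" "inner (z \<star> e) y = inner (e \<star> y) z"
    "inner (y \<star> z) y = inner (y \<star> y) z" "inner (z \<star> y) y = inner (y \<star> y) z"
    "inner (y \<star> z) z = inner (z \<star> z) y" "inner (z \<star> y) z = inner (z \<star> z) y"
    by (metis mult_assoc mult_commute inner_commute)+
  note F' = F[simplified inner_add_left inner_add_right mult_simps inner_scaleR_left inner_scaleR_right s]
  show 1: "inner (e \<star> e) e = 1" using F'[of 1 0 0] by simp
  show "inner (e \<star> e) y = 0" "inner (e \<star> y) y = - (1/2) * p"
    using F'[of 1 1 0] F'[of "-1" 1 0] F'[of 2 1 0] F'[of 0 1 0] 1 by simp_all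
  show "inner (e \<star> e) z = 0" "inner (e \<star> z) z = (1/2) * q"
    using F'[of 1 0 1] F'[of "-1" 0 1] F'[of 2 0 1] F'[of 0 0 1] 1 by simp_all
  show zz: "inner (z \<star> z) z = 0" using F'[of 0 0 1] by simp
  show yy: "inner (y \<star> y) z = 0" using F'[of 0 1 1] F'[of 0 1 "-1"] zz by simp
  show "inner (e \<star> y) z = 0"
    using F'[of 1 1 1] F'[of "-1" 1 1] F'[of 2 1 1] F'[of 0 1 1] F'[of 1 1 "-1"] F'[of "-1" 1 "-1"] F'[of 0 1 "-1"] 1 zz yy
    by simp
qed

theorem exceptional_type:
  assumes ex: "exceptional n f" and ty: "has_type n f (0, n2)"
  shows "n2 \<in> {5, 8, 14}"
proof -
  obtain e V1 V2 V3 where nf: "normal_form n f e V1 V2 V3" "subspace_dim n V1 = 0" "subspace_dim n V2 = n2"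
    using ty unfolding has_type_def by auto
  obtain c \<psi>111 \<psi>102 \<psi>012 \<psi>030 where od: "orthogonal_decomposition n e V1 V2 V3" and c: "c \<noteq> 0"
    and psi: "trihomogeneous n e V1 V2 V3 1 1 1 \<psi>111" "trihomogeneous n e V1 V2 V3 1 0 2 \<psi>102"
      "trihomogeneous n e V1 V2 V3 0 1 2 \<psi>012" "trihomogeneous n e V1 V2 V3 0 3 0 \<psi>030"
    and form: "\<And>t \<xi> \<eta> \<zeta>. \<xi> \<in> V1 \<Longrightarrow> \<eta> \<in> V2 \<Longrightarrow> \<zeta> \<in> V3 \<Longrightarrow>
       c * f (t \<cdot>\<^sub>v e + \<xi> + \<eta> + \<zeta>) = t ^ 3 - 3 / 2 * t * (2 * (\<xi> \<bullet> \<xi>) + \<eta> \<bullet> \<eta> - \<zeta> \<bullet> \<zeta>)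
         + \<psi>111 (t \<cdot>\<^sub>v e + \<xi> + \<eta> + \<zeta>) + \<psi>102 (t \<cdot>\<^sub>v e + \<xi> + \<eta> + \<zeta>) + \<psi>012 (t \<cdot>\<^sub>v e + \<xi> + \<eta> + \<zeta>)
         + \<psi>030 (t \<cdot>\<^sub>v e + \<xi> + \<eta> + \<zeta>)"
    using nf(1) unfolding normal_form_def Let_def by blast
  have sub: "is_subspace n V1" "is_subspace n V2" "is_subspace n V3"
    and e: "e \<in> carrier_vec n" "e \<bullet> e = 1"
    and o: "orthogonal_sets {e} V2" "orthogonal_sets {e} V3" "orthogonal_sets V2 V3"
    and dec: "\<And>x. x \<in> carrier_vec n \<Longrightarrow> \<exists>t. \<exists>\<xi> \<in> V1. \<exists>\<eta> \<in> V2. \<exists>\<zeta> \<in> V3. x = t \<cdot>\<^sub>v e + \<xi> + \<eta> + \<zeta>"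
    using od unfolding orthogonal_decomposition_def by blast+
  note S1 = to_fs_subspace[OF sub(1)] and S2 = to_fs_subspace[OF sub(2)] and S3 = to_fs_subspace[OF sub(3)]
  obtain C1 where "onb C1 (to_fs ` V1)" using onb_sub_exists[OF onb_unit S1(2,3)] by blast
  then have "to_fs ` V1 = {0}"
    using subspace_dim_onb[OF sub(1)] nf(2) onb_finite[of C1] onb_span[of C1] by fastforce
  then have V1: "V1 = {0\<^sub>v n}"
    using S1(1) to_fs_zero[of n] to_fs_inj[of _ n "0\<^sub>v n"] by (auto simp: image_iff set_eq_iff) (metis zero_carrier_vec subsetD)+
  obtain B2 where B2: "onb B2 (to_fs ` V2)" using onb_sub_exists[OF onb_unit S2(2,3)] by blast
  obtain B3 where B3: "onb B3 (to_fs ` V3)" using onb_sub_exists[OF onb_unit S3(2,3)] by blast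
  have cB2: "card B2 = n2" using subspace_dim_onb[OF sub(2) B2] nf(3) by simp
  have rad: "radial_eigencubic n f" using ex by (simp add: exceptional_def)
  then obtain l where l: "l \<noteq> 0" "\<And>x. x \<in> carrier_vec n \<Longrightarrow> hsiang_op n f x = l * (x \<bullet> x) * f x" and cf: "cubic_form n f"
    unfolding radial_eigencubic_def by blast
  obtain m0 where m0: "cubic_algebra n f m0" using cubic_form_algebra[OF cf] .
  interpret m0: comm_algebra m0 using m0 by (simp add: cubic_algebra_def)
  define m where "m = (\<lambda>x y. c *\<^sub>R m0 x y)"
  have m_space: "m x y \<in> Rn n" for x y
    unfolding m_def using m0 subspace_Rn by (simp add: cubic_algebra_def subspace_scale)
  interpret m: comm_algebra m
  proof
    show "bilinear m" unfolding bilinear_def m_def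
      by (auto intro!: linearI simp: scaleR_add_right)
    show "m x y = m y x" for x y by (simp add: m_def m0.mult_commute[of x y])
    show "inner (m x y) z = inner x (m y z)" for x y z by (simp add: m_def m0.mult_assoc)
  qed
  have mf: "inner (m (to_fs v) (to_fs v)) (to_fs v) = c * f v" if "v \<in> carrier_vec n" for v
    using m0 that by (simp add: m_def cubic_algebra_def)
  let ?e = "to_fs e"
  have rel: "\<exists>d g. \<forall>t b r. inner (m (t *\<^sub>R ?e + b *\<^sub>R y + r *\<^sub>R z) (t *\<^sub>R ?e + b *\<^sub>R y + r *\<^sub>R z)) (t *\<^sub>R ?e + b *\<^sub>R y + r *\<^sub>R z)
    = t ^ 3 - 3/2 * t * (b\<^sup>2 * inner y y - r\<^sup>2 * inner z z) + b * r\<^sup>2 * d + b ^ 3 * g"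
    if yz0: "y \<in> to_fs ` V2" "z \<in> to_fs ` V3" for y z
  proof -
    obtain \<eta> \<zeta> where yz: "\<eta> \<in> V2" "y = to_fs \<eta>" "\<zeta> \<in> V3" "z = to_fs \<zeta>" using yz0 by blast
    have car: "\<eta> \<in> carrier_vec n" "\<zeta> \<in> carrier_vec n" using yz S2(1) S3(1) by auto
    have "inner (m (t *\<^sub>R ?e + b *\<^sub>R y + r *\<^sub>R z) (t *\<^sub>R ?e + b *\<^sub>R y + r *\<^sub>R z)) (t *\<^sub>R ?e + b *\<^sub>R y + r *\<^sub>R z)
      = t ^ 3 - 3/2 * t * (b\<^sup>2 * inner y y - r\<^sup>2 * inner z z) + b * r\<^sup>2 * \<psi>012 (0\<^sub>v n + \<eta> + \<zeta>) + b ^ 3 * \<psi>030 (0\<^sub>v n + \<eta> + \<zeta>)" for t b r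
    proof -
      \<comment> \<open>The zero vector of V1 is taken with coefficient 0, so that homogeneity of
        degree 1 in \<xi> kills \<psi>111 and \<psi>102 at v.\<close>
      define v where "v = t \<cdot>\<^sub>v e + 0 \<cdot>\<^sub>v 0\<^sub>v n + b \<cdot>\<^sub>v \<eta> + r \<cdot>\<^sub>v \<zeta>"
      have z0: "0 \<cdot>\<^sub>v 0\<^sub>v n = (0\<^sub>v n :: rvec)" by auto
      have v: "v \<in> carrier_vec n" unfolding v_def using e car by auto
      have sm: "b \<cdot>\<^sub>v \<eta> \<in> V2" "r \<cdot>\<^sub>v \<zeta> \<in> V3"
      proof -
        have "b *\<^sub>R to_fs \<eta> \<in> to_fs ` V2" "r *\<^sub>R to_fs \<zeta> \<in> to_fs ` V3"
          using yz S2(2) S3(2) by (auto intro!: subspace_scale)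
        then obtain u w where "u \<in> V2" "b *\<^sub>R to_fs \<eta> = to_fs u" "w \<in> V3" "r *\<^sub>R to_fs \<zeta> = to_fs w" by blast
        then show "b \<cdot>\<^sub>v \<eta> \<in> V2" "r \<cdot>\<^sub>v \<zeta> \<in> V3"
          using to_fs_inj[of "b \<cdot>\<^sub>v \<eta>" n u] to_fs_inj[of "r \<cdot>\<^sub>v \<zeta>" n w] car S2(1) S3(1) by (auto simp: to_fs_smult)
      qed
      have in1: "0\<^sub>v n \<in> V1" using V1 by simp
      have ps: "\<psi>111 v = 0" "\<psi>102 v = 0" "\<psi>012 v = b * r\<^sup>2 * \<psi>012 (0\<^sub>v n + \<eta> + \<zeta>)" "\<psi>030 v = b ^ 3 * \<psi>030 (0\<^sub>v n + \<eta> + \<zeta>)"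
        using psi in1 yz(1,3) unfolding trihomogeneous_def v_def by auto
      have "c * f v = t ^ 3 - 3 / 2 * t * (2 * ((0\<^sub>v n) \<bullet> (0\<^sub>v n)) + (b \<cdot>\<^sub>v \<eta>) \<bullet> (b \<cdot>\<^sub>v \<eta>) - (r \<cdot>\<^sub>v \<zeta>) \<bullet> (r \<cdot>\<^sub>v \<zeta>))
         + \<psi>111 v + \<psi>102 v + \<psi>012 v + \<psi>030 v"
        using form[OF in1 sm, of t] unfolding v_def z0 .
      also have "\<dots> = t ^ 3 - 3/2 * t * (b\<^sup>2 * inner y y - r\<^sup>2 * inner z z) + b * r\<^sup>2 * \<psi>012 (0\<^sub>v n + \<eta> + \<zeta>) + b ^ 3 * \<psi>030 (0\<^sub>v n + \<eta> + \<zeta>)"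
        unfolding ps using car yz(2,4) to_fs_inner[OF car(1,1)] to_fs_inner[OF car(2,2)]
        by (simp add: power2_eq_square)
      finally have "c * f v = t ^ 3 - 3/2 * t * (b\<^sup>2 * inner y y - r\<^sup>2 * inner z z) + b * r\<^sup>2 * \<psi>012 (0\<^sub>v n + \<eta> + \<zeta>) + b ^ 3 * \<psi>030 (0\<^sub>v n + \<eta> + \<zeta>)" .
      moreover have "to_fs v = t *\<^sub>R ?e + b *\<^sub>R y + r *\<^sub>R z"
        by (rule fsvec_eqI) (use e car yz in \<open>auto simp: v_def\<close>)
      ultimately show ?thesis using mf[OF v] by simp
    qed
    then show ?thesis by blast
  qed
  have z2: "0 \<in> to_fs ` V2" and z3: "0 \<in> to_fs ` V3" using S2(2) S3(2) subspace_0 by auto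
  have R: "inner (m ?e ?e) ?e = 1" "inner (m ?e ?e) y = 0" "inner (m ?e ?e) z = 0" "inner (m ?e y) y = - (1/2) * inner y y"
    "inner (m ?e z) z = (1/2) * inner z z" "inner (m ?e y) z = 0" "inner (m y y) z = 0" "inner (m z z) z = 0"
    if "y \<in> to_fs ` V2" "z \<in> to_fs ` V3" for y z
    by (rule m.cubic_relations[OF rel[OF that]])+
  have ortho: "inner y ?e = 0" "inner z ?e = 0" "inner y z = 0"
    if yz0: "y \<in> to_fs ` V2" "z \<in> to_fs ` V3" for y z
  proof -
    obtain \<eta> \<zeta> where yz: "\<eta> \<in> V2" "y = to_fs \<eta>" "\<zeta> \<in> V3" "z = to_fs \<zeta>" using yz0 by blast
    then have car: "\<eta> \<in> carrier_vec n" "\<zeta> \<in> carrier_vec n" using S2(1) S3(1) by auto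
    have "e \<bullet> \<eta> = 0" "e \<bullet> \<zeta> = 0" "\<eta> \<bullet> \<zeta> = 0" using o yz unfolding orthogonal_sets_def by auto
    then show "inner y ?e = 0" "inner z ?e = 0" "inner y z = 0"
      using to_fs_inner[OF e(1) car(1)] to_fs_inner[OF e(1) car(2)] to_fs_inner[OF car] yz
      by (simp_all add: inner_commute[of "to_fs \<eta>" ?e] inner_commute[of "to_fs \<zeta>" ?e])
  qed
  have decomp: "\<exists>t. \<exists>y\<in>to_fs ` V2. \<exists>z\<in>to_fs ` V3. x = t *\<^sub>R ?e + y + z" if x: "x \<in> Rn n" for x
  proof -
    obtain t \<eta> \<zeta> where d: "\<eta> \<in> V2" "\<zeta> \<in> V3" "of_fs n x = t \<cdot>\<^sub>v e + 0\<^sub>v n + \<eta> + \<zeta>"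
      using dec[of "of_fs n x"] V1 by auto
    have "x = to_fs (t \<cdot>\<^sub>v e + 0\<^sub>v n + \<eta> + \<zeta>)" using to_of_fs[OF x] d(3) by simp
    also have "\<dots> = t *\<^sub>R ?e + to_fs \<eta> + to_fs \<zeta>"
      by (rule fsvec_eqI) (use e d S2(1) S3(1) in \<open>auto simp: subset_iff\<close>)
    finally show ?thesis using d by blast
  qed
  have eqI: "u = w" if "u \<in> Rn n" "w \<in> Rn n" "inner u ?e = inner w ?e"
    "\<And>y. y \<in> to_fs ` V2 \<Longrightarrow> inner u y = inner w y" "\<And>z. z \<in> to_fs ` V3 \<Longrightarrow> inner u z = inner w z" for u w
  proof -
    have uw: "u - w \<in> Rn n" using that subspace_Rn by (simp add: subspace_diff)
    obtain t y z where d: "y \<in> to_fs ` V2" "z \<in> to_fs ` V3" "u - w = t *\<^sub>R ?e + y + z" using decomp[OF uw] by blast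
    have "inner (u - w) ?e = 0" "inner (u - w) y = 0" "inner (u - w) z = 0"
      using that(3) that(4)[OF d(1)] that(5)[OF d(2)] by (simp_all add: inner_diff_left)
    then have "inner (u - w) (t *\<^sub>R ?e + y + z) = 0"
      by (simp only: inner_add_right inner_scaleR_right)
    then show "u = w" using d(3) by simp
  qed
  have eS: "?e \<in> Rn n" using e to_fs_Rn by blast
  have ee1: "inner ?e ?e = 1" using to_fs_inner[OF e(1,1)] e(2) by simp
  have ey_e: "inner (m ?e y) ?e = inner (m ?e ?e) y" for y
    using m.mult_assoc[of ?e ?e y] by (simp add: inner_commute)
  \<comment> \<open>Scaling the product by c turns f into the normal form. The left side of the
    eigencubic equation is of degree 3 in the product and the right side of degree 1, whence c^2;
    the 54 is that of \<open>hsiang_op_algebra\<close>.\<close>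
  have "normal_form_algebra m (Rn n) (unit ` {..<n}) (to_fs ` V2) (to_fs ` V3) B2 B3 ?e (c\<^sup>2 * l / 54)"
  proof unfold_locales
    show "onb (unit ` {..<n}) (Rn n)" "onb B2 (to_fs ` V2)" "onb B3 (to_fs ` V3)" by (rule onb_unit B2 B3)+
    show "m x y \<in> Rn n" for x y by (rule m_space)
    show "?e \<in> Rn n" "inner ?e ?e = 1" by (rule eS ee1)+
    show "to_fs ` V2 \<subseteq> Rn n" "to_fs ` V3 \<subseteq> Rn n" by (rule S2 S3)+
    show "c\<^sup>2 * l / 54 \<noteq> 0" using c l by simp
    show "m ?e ?e = ?e"
    proof (rule eqI[OF m_space eS])
      show "inner (m ?e ?e) ?e = inner ?e ?e" using R(1)[OF z2 z3] ee1 by simp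
      show "inner (m ?e ?e) y = inner ?e y" if "y \<in> to_fs ` V2" for y
        using R(2)[OF that z3] ortho(1)[OF that z3] by (simp add: inner_commute[of ?e y])
      show "inner (m ?e ?e) z = inner ?e z" if "z \<in> to_fs ` V3" for z
        using R(3)[OF z2 that] ortho(2)[OF z2 that] by (simp add: inner_commute[of ?e z])
    qed
    show "m ?e y = - (1/2) *\<^sub>R y" if y: "y \<in> to_fs ` V2" for y
    proof (rule eqI)
      show "- (1/2) *\<^sub>R y \<in> Rn n" using y S2(3) subspace_Rn[of n] by (auto intro!: subspace_neg subspace_scale)
      show "inner (m ?e y) ?e = inner (- (1/2) *\<^sub>R y) ?e" using ey_e R(2)[OF y z3] ortho(1)[OF y z3] by simp
      show "inner (m ?e y) z = inner (- (1/2) *\<^sub>R y) z" if "z \<in> to_fs ` V3" for z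
        using R(6)[OF y that] ortho(3)[OF y that] by simp
      show "inner (m ?e y) y' = inner (- (1/2) *\<^sub>R y) y'" if y': "y' \<in> to_fs ` V2" for y'
      proof -
        have "y + y' \<in> to_fs ` V2" using y y' S2(2) by (simp add: subspace_add)
        moreover have "inner (m ?e y') y = inner (m ?e y) y'" by (metis m.mult_selfadjoint inner_commute)
        ultimately show ?thesis using R(4)[OF _ z3, of "y + y'"] R(4)[OF y z3] R(4)[OF y' z3]
          by (simp add: inner_add_left inner_add_right inner_commute[of y' y] add_divide_distrib)
      qed
    qed (rule m_space)
    show "m ?e z = (1/2) *\<^sub>R z" if z: "z \<in> to_fs ` V3" for z
    proof (rule eqI)
      show "(1/2) *\<^sub>R z \<in> Rn n" using z S3(3) subspace_Rn[of n] by (auto intro!: subspace_scale)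
      show "inner (m ?e z) ?e = inner ((1/2) *\<^sub>R z) ?e" using ey_e R(3)[OF z2 z] ortho(2)[OF z2 z] by simp
      show "inner (m ?e z) y = inner ((1/2) *\<^sub>R z) y" if y: "y \<in> to_fs ` V2" for y
      proof -
        have "inner (m ?e z) y = inner (m ?e y) z" by (metis m.mult_selfadjoint inner_commute)
        then show ?thesis using R(6)[OF y z] ortho(3)[OF y z] by (simp add: inner_commute[of z y])
      qed
      show "inner (m ?e z) z' = inner ((1/2) *\<^sub>R z) z'" if z': "z' \<in> to_fs ` V3" for z'
      proof -
        have "z + z' \<in> to_fs ` V3" using z z' S3(2) by (simp add: subspace_add)
        moreover have "inner (m ?e z') z = inner (m ?e z) z'" by (metis m.mult_selfadjoint inner_commute)
        ultimately show ?thesis using R(5)[OF z2, of "z + z'"] R(5)[OF z2 z] R(5)[OF z2 z']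
          by (simp add: inner_add_left inner_add_right inner_commute[of z' z] add_divide_distrib)
      qed
    qed (rule m_space)
    show "inner y z = 0" "inner (m y y) z = 0"
      if "y \<in> to_fs ` V2" "z \<in> to_fs ` V3" for y z by (rule ortho(3)[OF that] R(7)[OF that])+
    show "inner y ?e = 0" if "y \<in> to_fs ` V2" for y by (rule ortho(1)[OF that z3])
    show "inner z ?e = 0" "inner (m z z) z = 0" if "z \<in> to_fs ` V3" for z by (rule ortho(2)[OF z2 that] R(8)[OF z2 that])+
    fix x assume x: "x \<in> Rn n"
    then show "\<exists>t. \<exists>y\<in>to_fs ` V2. \<exists>z\<in>to_fs ` V3. x = t *\<^sub>R ?e + y + z" by (rule decomp)
    have xv: "to_fs (of_fs n x) = x" using x by simp
    have tm: "trace_on B (m x) = c * trace_on B (m0 x)" for B by (simp add: m_def trace_on_def sum_distrib_left)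
    have fx: "f (of_fs n x) = inner (m0 x x) x" using m0 xv by (simp add: cubic_algebra_def)
    have "of_fs n x \<bullet> of_fs n x = inner x x" using to_fs_inner[of "of_fs n x" n "of_fs n x"] xv by simp
    then have "54 * (inner (m0 x x) (m0 x x) * trace_on (unit ` {..<n}) (m0 x) - inner (m0 x x) (m0 x (m0 x x)))
        = l * inner x x * inner (m0 x x) x"
      using hsiang_op_algebra[OF m0, of "of_fs n x"] l(2)[of "of_fs n x"] xv fx by simp
    from arg_cong[OF this, of "\<lambda>t. c ^ 3 * t / 54"]
    show "inner (m x x) (m x x) * trace_on (unit ` {..<n}) (m x) - inner (m x x) (m x (m x x))
      = c\<^sup>2 * l / 54 * inner x x * inner (m x x) x"
      unfolding tm by (simp add: m_def power2_eq_square power3_eq_cube algebra_simps)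
  qed
  then interpret normal_form_algebra m "Rn n" "unit ` {..<n}" "to_fs ` V2" "to_fs ` V3" B2 B3 ?e "c\<^sup>2 * l / 54" .
  show ?thesis
  proof (rule ccontr)
    assume "n2 \<notin> {5, 8, 14}"
    then obtain v M k where M: "v \<in> Rn n" "inner v v = 1" "linear M" "\<And>x. x \<in> Rn n \<Longrightarrow> M x \<in> Rn n"
      "\<And>x y. inner (M x) y = inner x (M y)" "M v = 0" "\<And>x. x \<in> Rn n \<Longrightarrow> M (M x) = x - inner x v *\<^sub>R v"
      "trace_on (unit ` {..<n}) M = 0" "k \<noteq> 0" "\<And>x. x \<in> Rn n \<Longrightarrow> inner (m x x) x = k * inner x v * inner x (M x)"
      using classification cB2 by blast
    have nn: "n = 2 * (n2 - 1) + 1" "n2 - 1 \<ge> 1"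
      using card_B cB2 card_image[OF inj_unit, of "{..<n}"] by auto
    have fx: "f x = k / c * inner (to_fs x) v * inner (to_fs x) (M (to_fs x))" if "x \<in> carrier_vec n" for x
      using mf[OF that] M(10)[OF to_fs_Rn[OF that]] c by (simp add: field_simps)
    have kc: "k / c \<noteq> 0" using M(9) c by simp
    have "\<exists>m q A. clifford_system m q A \<and> n = q + 1 + 2 * m \<and> congruent n f (clifford_cubic m q A)"
      using reducible_congruent_clifford[OF nn M(1-8) kc, of f] fx by blast
    then show False using ex by (simp add: exceptional_def)
  qed
qed

section \<open>Exceptional eigencubics\<close>

lemma trilinear_cubic_form:
  fixes g :: "fsvec \<Rightarrow> fsvec \<Rightarrow> fsvec \<Rightarrow> real"
  assumes "\<And>y z. linear (\<lambda>x. g x y z)" "\<And>x z. linear (\<lambda>y. g x y z)" "\<And>x y. linear (\<lambda>z. g x y z)"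
  shows "cubic_form n (\<lambda>v. g (to_fs v) (to_fs v) (to_fs v))"
proof -
  have ex: "h x = (\<Sum>i<n. coord x i * h (unit i))" if "linear h" "x \<in> Rn n" for h :: "fsvec \<Rightarrow> real" and x
    using expand_unit[OF that(2)] linear_sum[OF that(1), of "\<lambda>i. coord x i *\<^sub>R unit i" "{..<n}"] that(1)
    by (simp add: linear_scale)
  have "g (to_fs v) (to_fs v) (to_fs v) = (\<Sum>i<n. \<Sum>j<n. \<Sum>k<n. g (unit i) (unit j) (unit k) * v $ i * v $ j * v $ k)"
    if v: "v \<in> carrier_vec n" for v
  proof -
    define x where "x = to_fs v"
    have x: "x \<in> Rn n" unfolding x_def using v by (rule to_fs_Rn)
    have vx: "v $ i = coord x i" if "i < n" for i using v that by (simp add: x_def)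
    have "g x x x = (\<Sum>i<n. coord x i * g (unit i) x x)" by (rule ex[OF assms(1) x])
    also have "\<dots> = (\<Sum>i<n. coord x i * (\<Sum>j<n. coord x j * g (unit i) (unit j) x))"
      by (subst ex[OF assms(2) x]) simp
    also have "\<dots> = (\<Sum>i<n. coord x i * (\<Sum>j<n. coord x j * (\<Sum>k<n. coord x k * g (unit i) (unit j) (unit k))))"
      by (subst ex[OF assms(3) x]) simp
    also have "\<dots> = (\<Sum>i<n. \<Sum>j<n. \<Sum>k<n. g (unit i) (unit j) (unit k) * v $ i * v $ j * v $ k)"
      unfolding sum_distrib_left by (intro sum.cong refl) (auto simp: vx)
    finally show ?thesis unfolding x_def .
  qed
  then show ?thesis unfolding cubic_form_def
    by (intro exI[of _ "\<lambda>i j k. g (unit i) (unit j) (unit k)"]) blast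
qed

text \<open>
  The involution $S$ is the identity on $\mathbb{R}e\oplus V_2$ and minus the identity on $V_3$. Its trace and its
  invariance make up for the dimension of $V_2$ and the absence of the terms $\psi$ odd in $\zeta$.
\<close>

lemma has_type_involution:
  assumes m: "cubic_algebra n f m" and e: "e \<in> Rn n" "inner e e = 1"
    and S: "linear S" "\<And>x. x \<in> Rn n \<Longrightarrow> S x \<in> Rn n" "\<And>x. x \<in> Rn n \<Longrightarrow> S (S x) = x"
      "\<And>x y. x \<in> Rn n \<Longrightarrow> y \<in> Rn n \<Longrightarrow> inner (S x) y = inner x (S y)" "S e = e" "trace_on (unit ` {..<n}) S = 3"
    and me: "k \<noteq> 0" "\<And>x. x \<in> Rn n \<Longrightarrow> m e x = k *\<^sub>R ((3/2 * inner e x) *\<^sub>R e - (1/2) *\<^sub>R S x)"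
    and inv: "\<And>x. x \<in> Rn n \<Longrightarrow> inner (m (S x) (S x)) (S x) = inner (m x x) x"
    and n2: "2 * n2 = n + 1"
  shows "has_type n f (0, n2)"
proof -
  interpret comm_algebra m using m by (simp add: cubic_algebra_def)
  let ?W2 = "{x \<in> Rn n. S x = x \<and> inner e x = 0}" and ?W3 = "{x \<in> Rn n. S x = - x}"
  define p2 where "p2 = (\<lambda>x. (1/2) *\<^sub>R (x + S x) - inner e x *\<^sub>R e)"
  define p3 where "p3 = (\<lambda>x. (1/2) *\<^sub>R (x - S x))"
  have sub: "subspace ?W2" "subspace ?W3"
    using subspace_Rn[of n] S(1)
    by (auto simp: subspace_def inner_add_right linear_0 linear_add linear_scale)
  note I2 = is_subspaceI[OF sub(1), of n] and I3 = is_subspaceI[OF sub(2), of n]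
  let ?V1 = "{0\<^sub>v n}" and ?V2 = "of_fs n ` ?W2" and ?V3 = "of_fs n ` ?W3"
  have im: "to_fs ` ?V1 = {0}" "to_fs ` ?V2 = ?W2" "to_fs ` ?V3 = ?W3" using to_fs_zero I2 I3 by auto
  have isub: "is_subspace n ?V1" "is_subspace n ?V2" "is_subspace n ?V3"
  proof -
    have "of_fs n ` {0} = ?V1" using of_to_fs[of "0\<^sub>v n" n] by (simp add: to_fs_zero)
    then show "is_subspace n ?V1" using is_subspaceI(1)[of "{0}" n] subspace_Rn[of n] by (auto simp: subspace_0)
    show "is_subspace n ?V2" "is_subspace n ?V3" using I2 I3 by auto
  qed
  have mem2: "v \<in> carrier_vec n" "to_fs v \<in> ?W2" if "v \<in> ?V2" for v using that im(2) to_fs_subspace(1)[OF isub(2)] by auto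
  have mem3: "v \<in> carrier_vec n" "to_fs v \<in> ?W3" if "v \<in> ?V3" for v using that im(3) to_fs_subspace(1)[OF isub(3)] by auto
  have o3: "inner e x = 0" if "x \<in> ?W3" for x using S(4)[of e x] S(5) e that by simp
  have o23: "inner x y = 0" if "x \<in> ?W2" "y \<in> ?W3" for x y using S(4)[of x y] that by simp
  have p: "p2 (t *\<^sub>R e + y + z) = y" "p3 (t *\<^sub>R e + y + z) = z" if "y \<in> ?W2" "z \<in> ?W3" for t y z
    using that o3[OF that(2)] e S(1,5)
    by (simp_all add: p2_def p3_def linear_add linear_scale inner_add_right algebra_simps flip: scaleR_add_left)
  have dec: "p2 x \<in> ?W2" "p3 x \<in> ?W3" "x = inner e x *\<^sub>R e + p2 x + p3 x" if x: "x \<in> Rn n" for x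
  proof -
    have "inner e (S x) = inner e x" using S(4)[OF e(1) x] S(5) by simp
    then show "p2 x \<in> ?W2" using x e S subspace_Rn[of n]
      by (auto simp: p2_def inner_diff_right inner_add_right linear_add linear_diff linear_scale
          intro!: subspace_add subspace_diff subspace_scale)
    show "p3 x \<in> ?W3" using x S subspace_Rn[of n]
      by (auto simp: p3_def linear_diff linear_scale algebra_simps intro!: subspace_diff subspace_scale)
    show "x = inner e x *\<^sub>R e + p2 x + p3 x"
      by (rule inner_eqI) (simp add: p2_def p3_def inner_add_left inner_diff_left field_simps)
  qed
  have od: "orthogonal_decomposition n (of_fs n e) ?V1 ?V2 ?V3"
    unfolding orthogonal_decomposition_def orthogonal_sets_def
  proof (intro conjI isub ballI)
    show "of_fs n e \<in> carrier_vec n" by simp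
    show "of_fs n e \<bullet> of_fs n e = 1" using to_fs_inner[of "of_fs n e" n "of_fs n e"] e by simp
    show "v \<bullet> w = 0" if "v \<in> {of_fs n e}" "w \<in> ?V1" for v w using that by (simp add: of_fs_def)
    show "v \<bullet> w = 0" if "v \<in> {of_fs n e}" "w \<in> ?V2" for v w
      using to_fs_inner[of v n w] that e mem2[OF that(2)] by auto
    show "v \<bullet> w = 0" if "v \<in> {of_fs n e}" "w \<in> ?V3" for v w
      using to_fs_inner[of v n w] that e mem3[OF that(2)] o3 by auto
    show "v \<bullet> w = 0" if "v \<in> ?V1" "w \<in> ?V2" for v w using that by (auto simp: of_fs_def)
    show "v \<bullet> w = 0" if "v \<in> ?V1" "w \<in> ?V3" for v w using that by (auto simp: of_fs_def)
    show "v \<bullet> w = 0" if "v \<in> ?V2" "w \<in> ?V3" for v w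
      using to_fs_inner[OF mem2(1)[OF that(1)] mem3(1)[OF that(2)]] o23[OF mem2(2)[OF that(1)] mem3(2)[OF that(2)]] by simp
    show "\<exists>t. \<exists>\<xi>\<in>?V1. \<exists>\<eta>\<in>?V2. \<exists>\<zeta>\<in>?V3. v = t \<cdot>\<^sub>v of_fs n e + \<xi> + \<eta> + \<zeta>" if v: "v \<in> carrier_vec n" for v
    proof -
      let ?x = "to_fs v"
      note d = dec[OF to_fs_Rn[OF v]]
      have "v = inner e ?x \<cdot>\<^sub>v of_fs n e + 0\<^sub>v n + of_fs n (p2 ?x) + of_fs n (p3 ?x)"
      proof (rule eq_vecI)
        fix i assume "i < dim_vec (inner e ?x \<cdot>\<^sub>v of_fs n e + 0\<^sub>v n + of_fs n (p2 ?x) + of_fs n (p3 ?x))"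
        then have i: "i < n" by (simp add: of_fs_def)
        have "v $ i = coord ?x i" using v i by simp
        also have "\<dots> = coord (inner e ?x *\<^sub>R e + p2 ?x + p3 ?x) i" by (rule arg_cong[OF d(3)])
        finally show "v $ i = (inner e ?x \<cdot>\<^sub>v of_fs n e + 0\<^sub>v n + of_fs n (p2 ?x) + of_fs n (p3 ?x)) $ i"
          using i by (simp add: of_fs_def)
      qed (use v in \<open>simp add: of_fs_def\<close>)
      then show ?thesis using d(1,2) by blast
    qed
  qed
  \<comment> \<open>k is the value of the cubic at e, so f/k is normalised; the 3 counts the
    positions of y among two copies of z in the expanded cubic.\<close>
  define \<psi>012 where "\<psi>012 = (\<lambda>v. 3 / k * inner (m (p3 (to_fs v)) (p3 (to_fs v))) (p2 (to_fs v)))"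
  define \<psi>030 where "\<psi>030 = (\<lambda>v. 1 / k * inner (m (p2 (to_fs v)) (p2 (to_fs v))) (p2 (to_fs v)))"
  have linp: "linear p2" "linear p3"
    unfolding p2_def p3_def using S(1)
    by (auto intro!: linearI simp: linear_add linear_scale inner_add_right algebra_simps)
  have toe: "to_fs (t \<cdot>\<^sub>v of_fs n e + a \<cdot>\<^sub>v \<xi> + b \<cdot>\<^sub>v \<eta> + c \<cdot>\<^sub>v \<zeta>) = t *\<^sub>R e + b *\<^sub>R to_fs \<eta> + c *\<^sub>R to_fs \<zeta>"
    if "\<xi> \<in> ?V1" "\<eta> \<in> ?V2" "\<zeta> \<in> ?V3" for t a b c \<xi> \<eta> \<zeta>
    by (rule fsvec_eqI) (use that mem2(1)[OF that(2)] mem3(1)[OF that(3)] e(1) in \<open>auto simp: of_fs_def Rn_def\<close>)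
  have toe1: "to_fs (\<xi> + \<eta> + \<zeta>) = to_fs \<eta> + to_fs \<zeta>" if "\<xi> \<in> ?V1" "\<eta> \<in> ?V2" "\<zeta> \<in> ?V3" for \<xi> \<eta> \<zeta>
    by (rule fsvec_eqI) (use that mem2(1)[OF that(2)] mem3(1)[OF that(3)] in auto)
  have sc: "b *\<^sub>R to_fs \<eta> \<in> ?W2" "c *\<^sub>R to_fs \<zeta> \<in> ?W3" if "\<eta> \<in> ?V2" "\<zeta> \<in> ?V3" for b c \<eta> \<zeta>
    using subspace_scale[OF sub(1) mem2(2)[OF that(1)]] subspace_scale[OF sub(2) mem3(2)[OF that(2)]] by blast+
  have pp: "p2 (t *\<^sub>R e + b *\<^sub>R to_fs \<eta> + c *\<^sub>R to_fs \<zeta>) = b *\<^sub>R to_fs \<eta>" "p3 (t *\<^sub>R e + b *\<^sub>R to_fs \<eta> + c *\<^sub>R to_fs \<zeta>) = c *\<^sub>R to_fs \<zeta>"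
    "p2 (to_fs \<eta> + to_fs \<zeta>) = to_fs \<eta>" "p3 (to_fs \<eta> + to_fs \<zeta>) = to_fs \<zeta>" if "\<eta> \<in> ?V2" "\<zeta> \<in> ?V3" for t b c \<eta> \<zeta>
    using p[OF sc(1)[OF that, of b] sc(2)[OF that, of c], of t] p[OF mem2(2)[OF that(1)] mem3(2)[OF that(2)], of 0] by auto
  have hom: "\<psi>012 (t \<cdot>\<^sub>v of_fs n e + a \<cdot>\<^sub>v \<xi> + b \<cdot>\<^sub>v \<eta> + c \<cdot>\<^sub>v \<zeta>) = a ^ 0 * b ^ 1 * c ^ 2 * \<psi>012 (\<xi> + \<eta> + \<zeta>)"
    "\<psi>030 (t \<cdot>\<^sub>v of_fs n e + a \<cdot>\<^sub>v \<xi> + b \<cdot>\<^sub>v \<eta> + c \<cdot>\<^sub>v \<zeta>) = a ^ 0 * b ^ 3 * c ^ 0 * \<psi>030 (\<xi> + \<eta> + \<zeta>)"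
    if "\<xi> \<in> ?V1" "\<eta> \<in> ?V2" "\<zeta> \<in> ?V3" for t a b c \<xi> \<eta> \<zeta>
    unfolding \<psi>012_def \<psi>030_def toe[OF that] toe1[OF that] pp[OF that(2,3)]
    by (simp_all add: power2_eq_square power3_eq_cube)
  have cf1: "cubic_form n \<psi>012"
    unfolding \<psi>012_def
    by (rule trilinear_cubic_form[of "\<lambda>x y z. 3 / k * inner (m (p3 x) (p3 y)) (p2 z)"]; rule linearI)
      (simp_all add: linear_add[OF linp(1)] linear_add[OF linp(2)] linear_scale[OF linp(1)] linear_scale[OF linp(2)]
        inner_add_left inner_add_right distrib_left)
  have cf2: "cubic_form n \<psi>030"
    unfolding \<psi>030_def
    by (rule trilinear_cubic_form[of "\<lambda>x y z. 1 / k * inner (m (p2 x) (p2 y)) (p2 z)"]; rule linearI)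
      (simp_all add: linear_add[OF linp(1)] linear_add[OF linp(2)] linear_scale[OF linp(1)] linear_scale[OF linp(2)]
        inner_add_left inner_add_right distrib_left)
  have cf3: "cubic_form n (\<lambda>_. 0)" unfolding cubic_form_def by (rule exI[of _ "\<lambda>_ _ _. 0"]) simp
  have tri: "trihomogeneous n (of_fs n e) ?V1 ?V2 ?V3 1 1 1 (\<lambda>_. 0)"
    "trihomogeneous n (of_fs n e) ?V1 ?V2 ?V3 1 0 2 (\<lambda>_. 0)"
    unfolding trihomogeneous_def by (simp_all add: cf3)
  have tri': "trihomogeneous n (of_fs n e) ?V1 ?V2 ?V3 0 1 2 \<psi>012"
    unfolding trihomogeneous_def by (intro conjI allI ballI cf1; rule hom; assumption)
  have tri'': "trihomogeneous n (of_fs n e) ?V1 ?V2 ?V3 0 3 0 \<psi>030"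
    unfolding trihomogeneous_def by (intro conjI allI ballI cf2; rule hom; assumption)
  have "normal_form n f (of_fs n e) ?V1 ?V2 ?V3"
    unfolding normal_form_def
  proof (rule conjI[OF od], rule exI[of _ "1 / k"], rule exI[of _ "\<lambda>_. 0"], rule exI[of _ "\<lambda>_. 0"], rule exI[of _ \<psi>012],
      rule exI[of _ \<psi>030], intro conjI tri tri' tri'' allI ballI)
    show "1 / k \<noteq> 0" using me by simp
    fix t :: real and \<xi> \<eta> \<zeta> :: rvec assume h: "\<xi> \<in> ?V1" "\<eta> \<in> ?V2" "\<zeta> \<in> ?V3"
    define y z where "y = to_fs \<eta>" and "z = to_fs \<zeta>"
    have y: "y \<in> Rn n" "S y = y" "inner e y = 0" "inner y e = 0" and z: "z \<in> Rn n" "S z = - z" "inner e z = 0" "inner z e = 0"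
      and yz: "inner y z = 0" "inner z y = 0"
    proof -
      have W: "y \<in> ?W2" "z \<in> ?W3" unfolding y_def z_def by (rule mem2(2)[OF h(2)] mem3(2)[OF h(3)])+
      show "inner e z = 0" "inner z e = 0" using o3[OF W(2)] by (simp_all add: inner_commute[of z e])
      show "inner y z = 0" "inner z y = 0" using o23[OF W] by (simp_all add: inner_commute[of z y])
      show "y \<in> Rn n" "S y = y" "inner e y = 0" "inner y e = 0" "z \<in> Rn n" "S z = - z"
        using W by (simp_all add: inner_commute[of y e])
    qed
    have ts: "to_fs (t \<cdot>\<^sub>v of_fs n e + \<xi> + \<eta> + \<zeta>) = t *\<^sub>R e + y + z"
      using toe[OF h, of t 1 1 1] h mem2(1) mem3(1) by (simp add: y_def z_def)
    have car: "t \<cdot>\<^sub>v of_fs n e + \<xi> + \<eta> + \<zeta> \<in> carrier_vec n"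
      using h mem2(1)[OF h(2)] mem3(1)[OF h(3)] by auto
    have q: "m e e = k *\<^sub>R e" "m e y = - (k/2) *\<^sub>R y" "m e z = (k/2) *\<^sub>R z"
      using me(2)[OF e(1)] me(2)[OF y(1)] me(2)[OF z(1)] y z e S(5)
      by (simp_all flip: scaleR_diff_left)
    have sp: "y + z \<in> Rn n" "y - z \<in> Rn n" using y z subspace_Rn[of n] by (auto intro: subspace_add subspace_diff)
    have c: "inner (m y z) y = inner (m y y) z" "inner (m z y) y = inner (m y y) z"
      "inner (m y z) z = inner (m z z) y" "inner (m z y) z = inner (m z z) y"
      by (metis mult_assoc mult_commute inner_commute)+
    have zzz: "inner (m z z) z = 0" using inv[OF z(1)] z(2) by simp
    have "S (y + z) = y - z" using S(1) y z by (simp add: linear_add)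
    \<comment> \<open>S turns y + z into y - z, so its invariance removes the terms odd in
      z.\<close>
    then have yyz: "inner (m y y) z = 0"
      using inv[OF sp(1)] zzz by (simp add: inner_add_left inner_add_right inner_diff_left inner_diff_right c)
    have pv: "p2 (t *\<^sub>R e + y + z) = y" "p3 (t *\<^sub>R e + y + z) = z"
      using pp(1,2)[OF h(2,3), of t 1 1] by (simp_all add: y_def z_def)
    have "f (t \<cdot>\<^sub>v of_fs n e + \<xi> + \<eta> + \<zeta>) = inner (m (t *\<^sub>R e + y + z) (t *\<^sub>R e + y + z)) (t *\<^sub>R e + y + z)"
      using m car ts by (simp add: cubic_algebra_def)
    also have "\<dots> = k * t ^ 3 - 3/2 * k * t * (inner y y - inner z z) + 3 * inner (m z z) y + inner (m y y) y"
    proof -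
      have ce: "inner (m y z) e = 0" "inner (m z y) e = 0" "inner (m y y) e = - (k/2) * inner y y" "inner (m z z) e = k/2 * inner z z"
        using mult_assoc[of e y z] mult_assoc[of e y y] mult_assoc[of e z z] mult_assoc[of e z y] q yz
        by (simp_all add: inner_commute[of "m y z" e] inner_commute[of "m z y" e] inner_commute[of "m y y" e]
            inner_commute[of "m z z" e])
      show ?thesis
        by (simp add: mult_commute[of y e] mult_commute[of z e] q inner_add_left inner_add_right e y z yz c ce zzz yyz
            power3_eq_cube algebra_simps add_divide_distrib diff_divide_distrib)
    qed
    finally have fv: "f (t \<cdot>\<^sub>v of_fs n e + \<xi> + \<eta> + \<zeta>) =
      k * t ^ 3 - 3/2 * k * t * (inner y y - inner z z) + 3 * inner (m z z) y + inner (m y y) y" .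
    have sq: "\<xi> \<bullet> \<xi> = 0" "\<eta> \<bullet> \<eta> = inner y y" "\<zeta> \<bullet> \<zeta> = inner z z"
      using h(1) to_fs_inner[OF mem2(1)[OF h(2)] mem2(1)[OF h(2)]] to_fs_inner[OF mem3(1)[OF h(3)] mem3(1)[OF h(3)]]
      by (simp_all add: y_def z_def)
    have ps: "\<psi>012 (t \<cdot>\<^sub>v of_fs n e + \<xi> + \<eta> + \<zeta>) = 3 / k * inner (m z z) y"
      "\<psi>030 (t \<cdot>\<^sub>v of_fs n e + \<xi> + \<eta> + \<zeta>) = 1 / k * inner (m y y) y"
      unfolding \<psi>012_def \<psi>030_def ts pv by (rule refl)+
    show "let x = t \<cdot>\<^sub>v of_fs n e + \<xi> + \<eta> + \<zeta> in 1 / k * f x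
      = t ^ 3 - 3 / 2 * t * (2 * (\<xi> \<bullet> \<xi>) + \<eta> \<bullet> \<eta> - \<zeta> \<bullet> \<zeta>) + 0 + 0 + \<psi>012 x + \<psi>030 x"
      unfolding Let_def fv sq ps using me(1) by (simp add: field_simps)
  qed
  moreover have "subspace_dim n ?V1 = 0"
    using subspace_dim_onb[OF isub(1), of "{}"] im(1) by (simp add: onb_def)
  moreover have "subspace_dim n ?V2 = n2"
  proof -
    obtain B2 where B2: "onb B2 ?W2" using onb_sub_exists[OF onb_unit sub(1), of n] by blast
    obtain B3 where B3: "onb B3 ?W3" using onb_sub_exists[OF onb_unit sub(2), of n] by blast
    let ?W = "{x \<in> Rn n. inner e x = 0}"
    have W: "subspace ?W" using subspace_Rn[of n] by (auto simp: subspace_def inner_add_right)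
    have W23: "?W2 \<subseteq> ?W" "?W3 \<subseteq> ?W" using o3 by auto
    have sp: "\<exists>y\<in>?W2. \<exists>z\<in>?W3. x = y + z" if x: "x \<in> ?W" for x
    proof -
      have "x = p2 x + p3 x" using dec(3)[of x, symmetric] x by simp
      then show ?thesis using dec(1,2)[of x] x by blast
    qed
    note u = onb_Un[OF B2 B3 o23 W W23 sp]
    have dW: "x - inner x e *\<^sub>R e \<in> ?W" if "x \<in> Rn n" for x
      using that e subspace_Rn[of n]
      by (auto simp: inner_diff_right inner_commute[of e x] intro!: subspace_diff subspace_scale)
    have oW: "inner e x = 0" if "x \<in> ?W" for x using that by simp
    have WS: "?W \<subseteq> Rn n" by blast
    note i = onb_insert[OF u(1) e(2) oW subspace_Rn e(1) WS dW]
    note fin = onb_finite[OF B2] onb_finite[OF B3]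
    have "n = 1 + (card B2 + card B3)"
      using onb_dim[OF i(1)] onb_dim[OF onb_unit] card_image[OF inj_unit, of "{..<n}"] i(2) u(2) fin
      by (simp add: card_Un_disjoint)
    moreover have "trace_on (unit ` {..<n}) S = 1 + (card B2 - real (card B3))"
      using trace_on_unique[OF onb_unit i(1) S(1)] i(2) u(2) fin trace_on_scale[OF B2, of S 1] trace_on_scale[OF B3, of S "-1"]
      by (simp add: trace_on_insert trace_on_Un S(5) e)
    ultimately have "card B2 = n2" using S(6) n2 by linarith
    then show ?thesis using subspace_dim_onb[OF isub(2), of B2] B2 im(2) by simp
  qed
  ultimately show ?thesis unfolding has_type_def
    by (rule_tac x = "of_fs n e" in exI, rule_tac x = ?V1 in exI, rule_tac x = ?V2 in exI, rule_tac x = ?V3 in exI) simp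
qed

text \<open>Full polarisation of a symmetric trilinear form by inclusion and exclusion over the
  three arguments.\<close>

lemma (in comm_algebra) cubic_polar:
  "6 * inner (x \<star> y) z = inner ((x + y + z) \<star> (x + y + z)) (x + y + z) - inner ((x + y) \<star> (x + y)) (x + y)
    - inner ((x + z) \<star> (x + z)) (x + z) - inner ((y + z) \<star> (y + z)) (y + z)
    + inner (x \<star> x) x + inner (y \<star> y) y + inner (z \<star> z) z"
proof -
  have "inner (y \<star> x) z = inner (x \<star> y) z" "inner (x \<star> z) y = inner (x \<star> y) z" "inner (z \<star> x) y = inner (x \<star> y) z"
    "inner (y \<star> z) x = inner (x \<star> y) z" "inner (z \<star> y) x = inner (x \<star> y) z"
    by (metis mult_assoc mult_commute inner_commute)+
  then show ?thesis by (simp add: inner_add_left inner_add_right)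
qed

lemma sum_lessThan_add: "(\<Sum>i<a + b. g i) = (\<Sum>i<a. g i) + (\<Sum>j<b. g (a + j :: nat) :: 'a::comm_monoid_add)"
  by (induction b) (simp_all add: ac_simps)

text \<open>
  Here $N_i$ is the matrix $A_i$ transported along the congruence and extended by zero, and $Q$ is the projection onto
  the factor $\mathbb{R}^{2h}$.
\<close>

lemma clifford_congruent_pullback:
  assumes A: "clifford_system h q A" and n: "n = q + 1 + 2 * h" and f: "congruent n f (clifford_cubic h q A)"
  obtains s N Q c where "c \<noteq> 0" "\<And>i. i \<le> q \<Longrightarrow> s i \<in> Rn n"
    "\<And>i j. i \<le> q \<Longrightarrow> j \<le> q \<Longrightarrow> inner (s i) (s j) = (if i = j then 1 else 0)"
    "\<And>i. linear (N i)" "\<And>i x. i \<le> q \<Longrightarrow> N i x \<in> Rn n"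
    "\<And>i x y. i \<le> q \<Longrightarrow> inner (N i x) y = inner x (N i y)" "\<And>i j. i \<le> q \<Longrightarrow> j \<le> q \<Longrightarrow> N i (s j) = 0"
    "\<And>i j x. i \<le> q \<Longrightarrow> j \<le> q \<Longrightarrow> N i (N j x) + N j (N i x) = (if i = j then 2 else 0) *\<^sub>R Q x"
    "\<And>x. x \<in> Rn n \<Longrightarrow> x = (\<Sum>i\<le>q. inner x (s i) *\<^sub>R s i) + Q x"
    "\<exists>w\<in>Rn n. w \<noteq> 0 \<and> Q w = w"
    "\<And>v. v \<in> carrier_vec n \<Longrightarrow> f v = c * (\<Sum>i\<le>q. inner (to_fs v) (s i) * inner (to_fs v) (N i (to_fs v)))"
proof -
  obtain U c where U: "U \<in> carrier_mat n n" "transpose_mat U * U = 1\<^sub>m n" and c: "c \<noteq> 0"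
    and fU: "\<And>v. v \<in> carrier_vec n \<Longrightarrow> f v = c * clifford_cubic h q A (U *\<^sub>v v)"
    using f by (auto simp: Defs.congruent_def)
  have h: "h \<ge> 1" and Ac: "\<And>i. i \<le> q \<Longrightarrow> A i \<in> carrier_mat (2 * h) (2 * h)" and At: "\<And>i. i \<le> q \<Longrightarrow> transpose_mat (A i) = A i"
    and AA: "\<And>i j. i \<le> q \<Longrightarrow> j \<le> q \<Longrightarrow> A i * A j + A j * A i = (if i = j then 2 else 0) \<cdot>\<^sub>m 1\<^sub>m (2 * h)"
    using A unfolding clifford_system_def by auto
  \<comment> \<open>The hypothesis is about columns; the coordinates of Uv are inner products with
    the rows, which are orthonormal because U is square.\<close>
  have UU: "U * transpose_mat U = 1\<^sub>m n"
    using mat_mult_left_right_inverse[OF _ U(1) U(2)] U(1) by simp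
  define s where "s = (\<lambda>i. to_fs (row U i))"
  have s_space: "s i \<in> Rn n" for i
    using U(1) by (auto simp: s_def intro!: to_fs_Rn)
  have s_coord: "coord (s i) j = U $$ (i, j)" if "i < n" "j < n" for i j using that U(1) by (simp add: s_def)
  have Uv: "(U *\<^sub>v v) $ i = inner (to_fs v) (s i)" if "v \<in> carrier_vec n" "i < n" for v i
    using that U(1) inner_Rn[OF s_space, of i "to_fs v"]
    by (simp add: scalar_prod_def atLeast0LessThan s_coord inner_commute[of "to_fs v" "s i"])
  have ss: "inner (s i) (s j) = (if i = j then 1 else 0)" if "i < n" "j < n" for i j
  proof -
    have "inner (s i) (s j) = (U * transpose_mat U) $$ (i, j)"
      using that U(1) inner_Rn[OF s_space, of i "s j"] by (simp add: scalar_prod_def atLeast0LessThan s_coord)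
    then show ?thesis using UU that by simp
  qed
  have expand: "(\<Sum>i<n. inner x (s i) *\<^sub>R s i) = x" if x: "x \<in> Rn n" for x
  proof (rule fsvec_eqI)
    fix j
    show "coord (\<Sum>i<n. inner x (s i) *\<^sub>R s i) j = coord x j"
    proof (cases "j < n")
      case True
      have "coord (\<Sum>i<n. inner x (s i) *\<^sub>R s i) j = (\<Sum>i<n. \<Sum>l<n. coord x l * (U $$ (i, l) * U $$ (i, j)))"
        using True by (simp add: inner_Rn[OF x] s_coord sum_distrib_right mult.assoc)
      also have "\<dots> = (\<Sum>l<n. coord x l * (\<Sum>i<n. U $$ (i, l) * U $$ (i, j)))"
        by (subst sum.swap) (simp add: sum_distrib_left)
      also have "\<dots> = (\<Sum>l<n. coord x l * (transpose_mat U * U) $$ (l, j))"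
        using True U(1) by (simp add: scalar_prod_def atLeast0LessThan)
      also have "\<dots> = coord x j" using True unfolding U(2) by (simp add: if_distrib[of "\<lambda>t. _ * t"] cong: if_cong)
      finally show ?thesis .
    next
      case False
      then have "coord y j = 0" if "y \<in> Rn n" for y using that by (auto simp: Rn_def)
      then show ?thesis using x s_space by simp
    qed
  qed
  define R where "R = (\<lambda>j. s (q + 1 + j))"
  have RR: "inner (R i) (R j) = (if i = j then 1 else 0)" if "i < 2 * h" "j < 2 * h" for i j
    using ss[of "q + 1 + i" "q + 1 + j"] that n by (simp add: R_def)
  have sR: "inner (s i) (R j) = 0" "inner (R j) (s i) = 0" if "i \<le> q" "j < 2 * h" for i j
    using ss[of i "q + 1 + j"] that n by (auto simp: R_def inner_commute[of "s (Suc (q + j))" "s i"])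
  define lift where "lift = (\<lambda>w. \<Sum>j<2 * h. w $ j *\<^sub>R R j)"
  define crd where "crd = (\<lambda>x. Matrix.vec (2 * h) (\<lambda>j. inner x (R j)))"
  have crd_car [simp]: "crd x \<in> carrier_vec (2 * h)" for x by (simp add: crd_def)
  have lift_space: "lift w \<in> Rn n" for w
    unfolding lift_def R_def by (intro subspace_sum subspace_scale subspace_Rn s_space)
  have crd_lift: "crd (lift w) = w" if "w \<in> carrier_vec (2 * h)" for w
  proof (rule eq_vecI)
    fix j assume "j < dim_vec w"
    then have j: "j < 2 * h" using that by simp
    have "inner (lift w) (R j) = (\<Sum>i<2 * h. if i = j then w $ j else 0)"
      unfolding lift_def inner_sum_left by (rule sum.cong) (use RR j in auto)
    then show "crd (lift w) $ j = w $ j" using j by (simp add: crd_def)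
  qed (use that in \<open>simp add: crd_def\<close>)
  have lift_inner: "inner (lift w) x = w \<bullet> crd x" for w x
    by (simp add: lift_def inner_sum_left crd_def scalar_prod_def atLeast0LessThan inner_commute[of "R j" x for j])
  have lift_add: "lift (u + w) = lift u + lift w" if "u \<in> carrier_vec (2 * h)" "w \<in> carrier_vec (2 * h)" for u w
    using that by (simp add: lift_def scaleR_add_left sum.distrib)
  have lift_smult: "lift (r \<cdot>\<^sub>v w) = r *\<^sub>R lift w" if "w \<in> carrier_vec (2 * h)" for r w
    using that by (simp add: lift_def scaleR_right.sum)
  have crd_add: "crd (x + y) = crd x + crd y" for x y
    by (rule eq_vecI) (auto simp: crd_def inner_add_left)
  have crd_scale: "crd (r *\<^sub>R x) = r \<cdot>\<^sub>v crd x" for r x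
    by (rule eq_vecI) (auto simp: crd_def)
  \<comment> \<open>The default 0 beyond q makes \<open>N i\<close> linear for every index.\<close>
  define N where "N = (\<lambda>i x. if i \<le> q then lift (A i *\<^sub>v crd x) else 0)"
  define Q where "Q = (\<lambda>x. lift (crd x))"
  have N: "N i x = lift (A i *\<^sub>v crd x)" if "i \<le> q" for i x using that by (simp add: N_def)
  have Acr: "A i *\<^sub>v crd x \<in> carrier_vec (2 * h)" if "i \<le> q" for i x using Ac[OF that] by simp
  have cN: "crd (N i x) = A i *\<^sub>v crd x" if "i \<le> q" for i x using crd_lift[OF Acr[OF that]] N[OF that] by simp
  have linN: "linear (N i)" for i
  proof (cases "i \<le> q")
    case True
    show ?thesis
    proof (rule linearI)
      fix x y r
      show "N i (x + y) = N i x + N i y"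
        using Ac[OF True] by (simp add: N[OF True] crd_add mult_add_distrib_mat_vec[of _ "2 * h" "2 * h"] lift_add Acr[OF True])
      show "N i (r *\<^sub>R x) = r *\<^sub>R N i x"
        using Ac[OF True] by (simp add: N[OF True] crd_scale mult_mat_vec[of _ "2 * h" "2 * h"] lift_smult Acr[OF True])
    qed
  next
    case False
    then have "N i = (\<lambda>_. 0)" by (simp add: N_def fun_eq_iff)
    then show ?thesis by (simp add: linear_zero)
  qed
  have NN: "N i (N j x) + N j (N i x) = (if i = j then 2 else 0) *\<^sub>R Q x" if "i \<le> q" "j \<le> q" for i j x
  proof -
    have "N i (N j x) + N j (N i x) = lift (A i *\<^sub>v (A j *\<^sub>v crd x) + A j *\<^sub>v (A i *\<^sub>v crd x))"
      unfolding N[OF that(1), of "N j x"] N[OF that(2), of "N i x"] cN[OF that(1)] cN[OF that(2)]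
      by (rule lift_add[symmetric]; rule mult_mat_vec_carrier[OF Ac Acr]) (rule that)+
    also have "A i *\<^sub>v (A j *\<^sub>v crd x) + A j *\<^sub>v (A i *\<^sub>v crd x) = (A i * A j + A j * A i) *\<^sub>v crd x"
      using Ac[OF that(1)] Ac[OF that(2)]
      by (simp add: add_mult_distrib_mat_vec[of _ "2 * h" "2 * h"] assoc_mult_mat_vec[of _ "2 * h" "2 * h" _ "2 * h"])
    also have "\<dots> = (if i = j then 2 else 0) \<cdot>\<^sub>v crd x"
      unfolding AA[OF that] by (rule eq_vecI) (auto simp: crd_def scalar_prod_def if_distrib[of "\<lambda>t. 2 * t * _"] cong: if_cong)
    finally show ?thesis by (simp only: lift_smult[OF crd_car] Q_def)
  qed
  have dec: "x = (\<Sum>i\<le>q. inner x (s i) *\<^sub>R s i) + Q x" if "x \<in> Rn n" for x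
  proof -
    have "(\<Sum>i<q + 1 + 2 * h. inner x (s i) *\<^sub>R s i) = (\<Sum>i<q + 1. inner x (s i) *\<^sub>R s i)
        + (\<Sum>j<2 * h. inner x (s (q + 1 + j)) *\<^sub>R s (q + 1 + j))"
      using sum_lessThan_add[of "\<lambda>i. inner x (s i) *\<^sub>R s i" "q + 1" "2 * h"] by simp
    then show ?thesis using expand[OF that] n by (simp add: Q_def lift_def crd_def R_def lessThan_Suc_atMost)
  qed
  show ?thesis
  proof (rule that[of c s N Q])
    show "c \<noteq> 0" by fact
    show "s i \<in> Rn n" for i by (rule s_space)
    show "inner (s i) (s j) = (if i = j then 1 else 0)" if "i \<le> q" "j \<le> q" for i j using ss that n by simp
    show "linear (N i)" for i by (rule linN)
    show "N i x \<in> Rn n" if "i \<le> q" for i x by (simp add: N[OF that] lift_space)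
    show "inner (N i x) y = inner x (N i y)" if i: "i \<le> q" for i x y
    proof -
      have "inner (N i x) y = (A i *\<^sub>v crd x) \<bullet> crd y" by (simp add: N[OF i] lift_inner)
      also have "\<dots> = (A i *\<^sub>v crd y) \<bullet> crd x"
        using transpose_vec_mult_scalar[OF Ac[OF i] crd_car crd_car, of y x] At[OF i] Acr[OF i]
        by (metis comm_scalar_prod crd_car)
      also have "\<dots> = inner x (N i y)" by (simp add: N[OF i] lift_inner inner_commute[of x "lift (A i *\<^sub>v crd y)"])
      finally show ?thesis .
    qed
    show "N i (s j) = 0" if "i \<le> q" "j \<le> q" for i j
    proof -
      have "crd (s j) = 0\<^sub>v (2 * h)" by (rule eq_vecI) (use sR that in \<open>auto simp: crd_def\<close>)
      then show ?thesis using Ac[OF that(1)] that by (simp add: N lift_def scalar_prod_def)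
    qed
    show "N i (N j x) + N j (N i x) = (if i = j then 2 else 0) *\<^sub>R Q x" if "i \<le> q" "j \<le> q" for i j x by (rule NN[OF that])
    show "x = (\<Sum>i\<le>q. inner x (s i) *\<^sub>R s i) + Q x" if "x \<in> Rn n" for x by (rule dec[OF that])
    show "\<exists>w\<in>Rn n. w \<noteq> 0 \<and> Q w = w"
    proof (rule bexI[of _ "R 0"])
      have R0: "R 0 \<in> Rn n" using s_space by (simp add: R_def)
      have "(\<Sum>i\<le>q. inner (R 0) (s i) *\<^sub>R s i) = 0" using sR h by (intro sum.neutral) auto
      then have "Q (R 0) = R 0" using dec[OF R0] by simp
      moreover have "R 0 \<noteq> 0" using RR[of 0 0] h by auto
      ultimately show "R 0 \<noteq> 0 \<and> Q (R 0) = R 0" by blast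
      show "R 0 \<in> Rn n" by (rule R0)
    qed
    fix v :: rvec assume v: "v \<in> carrier_vec n"
    have "vec_last (U *\<^sub>v v) (2 * h) = crd (to_fs v)"
      using U(1) Uv[OF v] n by (intro eq_vecI) (auto simp: vec_last_def crd_def R_def)
    moreover have "vec_first (U *\<^sub>v v) (q + 1) $ i = inner (to_fs v) (s i)" if "i \<le> q" for i
      using U(1) Uv[OF v, of i] n that by (simp add: vec_first_def)
    ultimately show "f v = c * (\<Sum>i\<le>q. inner (to_fs v) (s i) * inner (to_fs v) (N i (to_fs v)))"
      unfolding fU[OF v] clifford_cubic_def Let_def
      by (intro arg_cong[of _ _ "times c"] sum.cong refl)
        (simp add: N lift_inner comm_scalar_prod[OF crd_car Acr] inner_commute[of "to_fs v" "lift w" for w] mult.commute)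
  qed
qed

section \<open>Clifford cubics and the identity for the square of a square\<close>

lemma cubic_algebra_unique:
  assumes "comm_algebra m" "comm_algebra m'" "\<And>x y. x \<in> V \<Longrightarrow> y \<in> V \<Longrightarrow> m x y \<in> V"
    "\<And>x y. x \<in> V \<Longrightarrow> y \<in> V \<Longrightarrow> m' x y \<in> V" "subspace V"
    "\<And>x. x \<in> V \<Longrightarrow> inner (m x x) x = inner (m' x x) x" "x \<in> V" "y \<in> V"
  shows "m x y = m' x y"
proof -
  define d where "d = m x y - m' x y"
  have d: "d \<in> V" unfolding d_def using assms by (intro subspace_diff) auto
  have "6 * inner (m x y) d = 6 * inner (m' x y) d"
    unfolding comm_algebra.cubic_polar[OF assms(1)] comm_algebra.cubic_polar[OF assms(2)]
    using assms(5-8) d by (simp add: subspace_add)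
  then have "inner d d = 0" by (simp add: d_def inner_diff_left)
  then show ?thesis by (simp add: d_def)
qed

text \<open>For q = 0, nonzero cubic values at x and y give indices i and j in the support of
  \<open>s 0\<close>, distinct because x and y have disjoint supports. Since \<open>unit i\<close>
  has square 0, Q kills it, so it is parallel to \<open>s 0\<close>, whose j-th coordinate is
  nonzero. For q at least 1, an explicit vector has cubic value 0 but a square whose square is
  nonzero, against \<open>sq\<close>.\<close>

lemma not_clifford:
  assumes m: "cubic_algebra n f m"
    and sq: "\<And>x. x \<in> Rn n \<Longrightarrow> m (m x x) (m x x) = (k * inner (m x x) x) *\<^sub>R x"
    and b0: "\<And>i. i < n \<Longrightarrow> m (unit i) (unit i) = 0"
    and xy: "x \<in> Rn n" "y \<in> Rn n" "inner (m x x) x \<noteq> 0" "inner (m y y) y \<noteq> 0"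
      "\<And>i. coord x i = 0 \<or> coord y i = 0"
  shows "\<not> (\<exists>h q A. clifford_system h q A \<and> n = q + 1 + 2 * h \<and> congruent n f (clifford_cubic h q A))"
proof
  assume "\<exists>h q A. clifford_system h q A \<and> n = q + 1 + 2 * h \<and> congruent n f (clifford_cubic h q A)"
  then obtain h q A where A: "clifford_system h q A" "n = q + 1 + 2 * h" "congruent n f (clifford_cubic h q A)" by blast
  obtain s N Q c where c: "c \<noteq> 0" and s: "\<And>i. i \<le> q \<Longrightarrow> s i \<in> Rn n"
    and ss: "\<And>i j. i \<le> q \<Longrightarrow> j \<le> q \<Longrightarrow> inner (s i) (s j) = (if i = j then 1 else 0)"
    and linN: "\<And>i. linear (N i)" and Nsp: "\<And>i x. i \<le> q \<Longrightarrow> N i x \<in> Rn n"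
    and Nsym: "\<And>i x y. i \<le> q \<Longrightarrow> inner (N i x) y = inner x (N i y)" and Ns: "\<And>i j. i \<le> q \<Longrightarrow> j \<le> q \<Longrightarrow> N i (s j) = 0"
    and NN: "\<And>i j x. i \<le> q \<Longrightarrow> j \<le> q \<Longrightarrow> N i (N j x) + N j (N i x) = (if i = j then 2 else 0) *\<^sub>R Q x"
    and dec: "\<And>x. x \<in> Rn n \<Longrightarrow> x = (\<Sum>i\<le>q. inner x (s i) *\<^sub>R s i) + Q x"
    and w: "\<exists>w\<in>Rn n. w \<noteq> 0 \<and> Q w = w"
    and fv: "\<And>v. v \<in> carrier_vec n \<Longrightarrow> f v = c * (\<Sum>i\<le>q. inner (to_fs v) (s i) * inner (to_fs v) (N i (to_fs v)))"
    by (rule clifford_congruent_pullback[OF A]) blast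
  have NQ: "N i (N i x) = Q x" if "i \<le> q" for i x
    using NN[OF that that, of x] by (simp flip: scaleR_2)
  have sN: "inner (s j) (N i x) = 0" "inner (N i x) (s j) = 0" if "i \<le> q" "j \<le> q" for i j x
    using Nsym[OF that(1), of "s j" x] Ns[OF that] Nsym[OF that(1), of x "s j"] by auto
  \<comment> \<open>The polarisation of the pulled-back Clifford cubic; the third compensates for
    the three places of the factor \<open>s i\<close>.\<close>
  define m' where "m' = (\<lambda>x y. (c/3) *\<^sub>R (\<Sum>i\<le>q. inner x (s i) *\<^sub>R N i y + inner y (s i) *\<^sub>R N i x + inner x (N i y) *\<^sub>R s i))"
  have inn: "inner (m' x y) z = (c/3) * (\<Sum>i\<le>q. inner x (s i) * inner (N i y) z + inner y (s i) * inner (N i x) z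
      + inner x (N i y) * inner (s i) z)" for x y z
    by (simp add: m'_def inner_sum_left inner_add_left)
  have m'_comm: "m' x y = m' y x" for x y
    unfolding m'_def
    by (intro arg_cong[of _ _ "scaleR (c/3)"] sum.cong refl) (simp add: Nsym inner_commute[of x "N i y" for i])
  have m': "comm_algebra m'"
  proof
    have r: "linear (m' x)" for x
      unfolding m'_def
      by (rule linearI) (simp_all add: linear_add[OF linN] linear_scale[OF linN] inner_add_left inner_add_right sum.distrib
          scaleR_add_left scaleR_add_right scaleR_right.sum algebra_simps)
    moreover have "(\<lambda>x. m' x y) = m' y" for y using m'_comm by auto
    ultimately show "bilinear m'" by (simp add: bilinear_def)
    show "m' x y = m' y x" for x y by (rule m'_comm)
    show "inner (m' x y) z = inner x (m' y z)" for x y z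
      unfolding inner_commute[of x "m' y z"] inn
      by (intro arg_cong[of _ _ "times (c/3)"] sum.cong refl)
        (simp add: Nsym inner_commute[of x "N i y" for i] inner_commute[of x "s i" for i] inner_commute[of z "s i" for i]
          inner_commute[of x "N i z" for i])
  qed
  have mm': "m x y = m' x y" if "x \<in> Rn n" "y \<in> Rn n" for x y
  proof (rule cubic_algebra_unique[OF _ m' _ _ subspace_Rn _ that])
    show "comm_algebra m" "m x y \<in> Rn n" for x y using m by (auto simp: cubic_algebra_def)
    show "m' x y \<in> Rn n" for x y
      unfolding m'_def by (intro subspace_scale subspace_sum subspace_add subspace_Rn) (auto simp: s Nsp)
    show "inner (m x x) x = inner (m' x x) x" if "x \<in> Rn n" for x
    proof -
      have "inner (m x x) x = f (of_fs n x)" using m that by (auto simp: cubic_algebra_def)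
      also have "\<dots> = c * (\<Sum>i\<le>q. inner x (s i) * inner x (N i x))" using fv[of "of_fs n x"] that by simp
      also have "\<dots> = inner (m' x x) x"
        unfolding inn sum_distrib_left
        by (rule sum.cong) (simp_all add: Nsym inner_commute[of "s i" x for i])
      finally show ?thesis .
    qed
  qed
  show False
  proof (cases "q = 0")
    case True
    let ?s = "s 0" and ?N = "N 0"
    have cub: "inner (m x x) x = c * (inner x ?s * inner x (?N x))" if "x \<in> Rn n" for x
      using mm'[OF that that] True inn[of x x x] by (simp add: Nsym inner_commute[of "s 0" x])
    have nz: "\<exists>i<n. coord x i \<noteq> 0 \<and> coord ?s i \<noteq> 0" if "x \<in> Rn n" "inner (m x x) x \<noteq> 0" for x
    proof (rule ccontr)
      assume "\<not> ?thesis"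
      then have "inner x ?s = 0" using inner_Rn[OF that(1), of ?s] by (auto intro!: sum.neutral)
      then show False using cub[OF that(1)] that(2) by simp
    qed
    obtain i where i: "i < n" "coord x i \<noteq> 0" "coord ?s i \<noteq> 0" using nz[OF xy(1,3)] by blast
    obtain j where j: "j < n" "coord y j \<noteq> 0" "coord ?s j \<noteq> 0" using nz[OF xy(2,4)] by blast
    let ?b = "unit i"
    have bb: "m' ?b ?b = 0" using mm'[of ?b ?b] b0[OF i(1)] i(1) by simp
    have "inner ?b (?N ?b) = 0"
      using inn[of ?b ?b ?s] bb True c ss[of 0 0] sN[of 0 0 ?b] by (simp del: inner_unit)
    then have "inner (?N ?b) (?N ?b) = 0"
      using inn[of ?b ?b "?N ?b"] bb True c i(3) by simp
    then have "Q ?b = 0" using NQ[of 0 ?b] linear_0[OF linN[of 0]] by simp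
    then have "(\<Sum>i\<le>q. inner ?b (s i) *\<^sub>R s i) + Q ?b = inner ?b ?s *\<^sub>R ?s" using True by simp
    then have "?b = inner ?b ?s *\<^sub>R ?s" using dec[OF unit_Rn[OF i(1)]] by (rule trans[rotated])
    then have "coord ?b j = coord (inner ?b ?s *\<^sub>R ?s) j" by (rule arg_cong)
    moreover have "j \<noteq> i" using xy(5)[of i] i j by auto
    ultimately show False using i j by simp
  next
    case False
    then have q: "0 \<le> q" "1 \<le> q" by auto
    obtain w where w: "w \<in> Rn n" "w \<noteq> 0" "Q w = w" using w by blast
    \<comment> \<open>N 0 is an involution on the image of Q: w + N 0 w is an eigenvector for 1
      unless it vanishes, and then w is one for -1.\<close>
    obtain y0 e where y0: "y0 \<in> Rn n" "y0 \<noteq> 0" "N 0 y0 = e *\<^sub>R y0" and e: "e * e = (1::real)"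
    proof (cases "w + N 0 w = 0")
      case True
      then have "N 0 w = (-1) *\<^sub>R w" by (simp add: add_eq_0_iff)
      then show ?thesis using w by (intro that[of w "-1"]) auto
    next
      case False
      have "N 0 (w + N 0 w) = 1 *\<^sub>R (w + N 0 w)" using NQ[OF q(1), of w] w(3) by (simp add: linear_add[OF linN])
      then show ?thesis using False w(1) Nsp[OF q(1)] subspace_add[OF subspace_Rn]
        by (intro that[of "w + N 0 w" 1]) auto
    qed
    have NNy: "N 0 (N 0 y0) = y0" using y0(3) e by (simp add: linear_scale[OF linN])
    have ys: "inner y0 (s i) = 0" "inner (s i) y0 = 0" if "i \<le> q" for i
      using sN[OF q(1) that, of "N 0 y0"] by (simp_all add: NNy)
    have Ny: "N 0 (N i y0) = - e *\<^sub>R N i y0" if "i \<le> q" "i \<noteq> 0" for i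
      using NN[OF q(1) that(1), of y0] that(2) y0(3) by (simp add: linear_scale[OF linN] eq_neg_iff_add_eq_0)
    have yNy: "inner y0 (N i y0) = 0" if "i \<le> q" "i \<noteq> 0" for i
    proof -
      have "e * inner y0 (N i y0) = inner (N 0 y0) (N i y0)" by (simp add: y0(3))
      also have "\<dots> = inner y0 (N 0 (N i y0))" by (rule Nsym[OF q(1)])
      also have "\<dots> = - (e * inner y0 (N i y0))" by (simp add: Ny[OF that])
      finally show ?thesis using e by auto
    qed
    define a where "a = e * inner y0 y0"
    have a: "a \<noteq> 0" using y0(2) e by (auto simp: a_def)
    define v where "v = N 1 y0"
    define u where "u = 2 *\<^sub>R v + a *\<^sub>R s 0"
    have vs: "inner v (s i) = 0" if "i \<le> q" for i using sN(2)[OF q(2) that] by (simp add: v_def)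
    \<comment> \<open>The cubic vanishes here because y0 is orthogonal to N 1 y0, as N 1 reverses
      the sign of the eigenvalue of N 0. The square of this vector is a multiple of u, with the
      component a along \<open>s 0\<close> coming from the eigenvalue e.\<close>
    let ?x = "y0 + s 1"
    have xsp: "?x \<in> Rn n" using y0(1) s[OF q(2)] subspace_add[OF subspace_Rn] by blast
    have usp: "u \<in> Rn n" unfolding u_def v_def
      by (intro subspace_add subspace_scale subspace_Rn s Nsp q)
    have Nx: "N i ?x = N i y0" if "i \<le> q" for i by (simp add: linear_add[OF linN] Ns[OF that q(2), simplified])
    have xx: "m' ?x ?x = (c/3) *\<^sub>R u"
    proof -
      have "inner ?x (s i) *\<^sub>R N i ?x + inner ?x (s i) *\<^sub>R N i ?x + inner ?x (N i ?x) *\<^sub>R s i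
          = (if i = 1 then 2 *\<^sub>R v else 0) + (if i = 0 then a *\<^sub>R s 0 else 0)" if "i \<le> q" for i
        unfolding Nx[OF that] using ys[OF that] ss[OF q(2) that] yNy[OF that] sN[OF that q(2)] y0(3) that
        by (auto simp: inner_add_left v_def a_def scaleR_2)
      then have "(\<Sum>i\<le>q. inner ?x (s i) *\<^sub>R N i ?x + inner ?x (s i) *\<^sub>R N i ?x + inner ?x (N i ?x) *\<^sub>R s i)
          = (\<Sum>i\<le>q. (if i = 1 then 2 *\<^sub>R v else 0) + (if i = 0 then a *\<^sub>R s 0 else 0))"
        by (intro sum.cong) auto
      also have "\<dots> = u" using q by (simp add: sum.distrib u_def)
      finally show ?thesis by (simp add: m'_def)
    qed
    have "inner v y0 = 0" using yNy[OF q(2)] unfolding v_def Nsym[OF q(2)] by simp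
    then have "inner u ?x = 0"
      using vs[OF q(2)] ys[OF q(1)] ss[OF q] by (simp add: u_def inner_add_left inner_add_right)
    then have "m (m ?x ?x) (m ?x ?x) = 0" using sq[OF xsp] mm'[OF xsp xsp] xx by simp
    moreover have "m (m ?x ?x) (m ?x ?x) = m' ((c/3) *\<^sub>R u) ((c/3) *\<^sub>R u)"
      unfolding mm'[OF xsp xsp] xx by (rule mm') (use usp subspace_scale[OF subspace_Rn] in auto)
    moreover have Nv: "N 0 v = - e *\<^sub>R v" using Ny[OF q(2)] by (simp add: v_def)
    ultimately have "(c/3) *\<^sub>R (c/3) *\<^sub>R m' u u = 0"
      by (simp only: bilinear_lmul[OF comm_algebra.bilinear_mult[OF m']] bilinear_rmul[OF comm_algebra.bilinear_mult[OF m']])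
    then have "m' u u = 0" using c by simp
    \<comment> \<open>Only i = 0 contributes: u has component a along \<open>s 0\<close>, and N 0
      acts on v by -e. Since the left side is 0, v vanishes, which contradicts that Q fixes
      y0.\<close>
    moreover have "inner (m' u u) v = (c/3) * (2 * a * (- 2 * e * inner v v))"
    proof -
      have "inner u (s i) * inner (N i u) v + inner u (s i) * inner (N i u) v + inner u (N i u) * inner (s i) v
          = (if i = 0 then 2 * a * (- 2 * e * inner v v) else 0)" if "i \<le> q" for i
        using that q vs[OF that] ss[OF q(1) that] Nv Ns[OF that q(1)]
        by (auto simp: u_def inner_add_left linear_add[OF linN] linear_scale[OF linN] inner_commute[of "s i" v])
      then show ?thesis unfolding inn by simp
    qed
    ultimately have "inner v v = 0" using c a e by auto
    then have "N 1 v = 0" using linear_0[OF linN] by simp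
    then have "Q y0 = 0" using NQ[OF q(2), of y0] by (simp add: v_def)
    then show False using NQ[OF q(1), of y0] NNy y0(2) by simp
  qed
qed

section \<open>The cubic norm over the split composition algebras\<close>

text \<open>
  The signed monomials of the cubic norm of the Hermitian matrices with diagonal $(x_0,x_1,x_2)$ over the split octonions,
  written as Zorn vector matrices: the three off-diagonal entries have coordinates $3+6p+2j+h$ with $j<3$ the number of the entry
  and $p<4$, $h<2$. Coordinates below $9$ and $15$ give the split complex and the split quaternionic matrices.
\<close>

definition triads :: "(real \<times> nat \<times> nat \<times> nat) list" where
  "triads = [(1, 0, 1, 2), (- 1, 0, 3, 4), (- 1, 1, 5, 6), (- 1, 2, 7, 8), (- 1, 0, 9, 10), (- 1, 1, 11, 12), (-
    1, 2, 13, 14), (- 1, 0, 15, 16), (- 1, 1, 17, 18), (- 1, 2, 19, 20), (- 1, 0, 21, 22), (- 1, 1, 23,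
    24), (- 1, 2, 25, 26), (1, 3, 5, 7), (- 1, 3, 11, 14), (- 1, 3, 17, 20), (- 1, 3, 23, 26), (1, 4, 6,
    8), (- 1, 4, 12, 13), (- 1, 4, 18, 19), (- 1, 4, 24, 25), (- 1, 6, 9, 14), (- 1, 7, 9, 12), (1, 9,
    17, 25), (- 1, 9, 19, 23), (- 1, 5, 10, 13), (- 1, 8, 10, 11), (1, 10, 18, 26), (- 1, 10, 20, 24),
    (- 1, 6, 15, 20), (- 1, 11, 15, 25), (- 1, 7, 15, 18), (1, 13, 15, 23), (- 1, 5, 16, 19), (- 1, 12,
    16, 26), (- 1, 8, 16, 17), (1, 14, 16, 24), (- 1, 6, 21, 26), (1, 11, 19, 21), (- 1, 13, 17, 21), (-
    1, 7, 21, 24), (- 1, 5, 22, 25), (1, 12, 20, 22), (- 1, 14, 18, 22), (- 1, 8, 22, 23)]"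

definition grad :: "(nat \<Rightarrow> real) \<Rightarrow> nat \<Rightarrow> real" where
  "grad x i = (\<Sum>(s, a, b, c)\<leftarrow>triads. s * ((if i = a then x b * x c else 0) + (if i = b then x a * x c else 0)
     + (if i = c then x a * x b else 0)))"

definition cub :: "(nat \<Rightarrow> real) \<Rightarrow> real" where
  "cub x = (\<Sum>(s, a, b, c)\<leftarrow>triads. s * (x a * x b * x c))"

text \<open>
  Since the Euclidean gradient differs from Freudenthal's adjoint only by the involution \<open>partner\<close> below, applying it twice
  gives $x^{\#\#}=N(x)x$, which is \<open>grad_grad\<close>.
\<close>

lemma grad_eqs:
  "grad x 0 = x 1 * x 2 - x 3 * x 4 - x 9 * x 10 - x 15 * x 16 - x 21 * x 22"
  "grad x 1 = x 0 * x 2 - x 5 * x 6 - x 11 * x 12 - x 17 * x 18 - x 23 * x 24"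
  "grad x 2 = x 0 * x 1 - x 7 * x 8 - x 13 * x 14 - x 19 * x 20 - x 25 * x 26"
  "grad x 3 = - x 0 * x 4 + x 5 * x 7 - x 11 * x 14 - x 17 * x 20 - x 23 * x 26"
  "grad x 4 = - x 0 * x 3 + x 6 * x 8 - x 12 * x 13 - x 18 * x 19 - x 24 * x 25"
  "grad x 5 = - x 1 * x 6 + x 3 * x 7 - x 10 * x 13 - x 16 * x 19 - x 22 * x 25"
  "grad x 6 = - x 1 * x 5 + x 4 * x 8 - x 9 * x 14 - x 15 * x 20 - x 21 * x 26"
  "grad x 7 = - x 2 * x 8 + x 3 * x 5 - x 9 * x 12 - x 15 * x 18 - x 21 * x 24"
  "grad x 8 = - x 2 * x 7 + x 4 * x 6 - x 10 * x 11 - x 16 * x 17 - x 22 * x 23"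
  "grad x 9 = - x 0 * x 10 - x 6 * x 14 - x 7 * x 12 + x 17 * x 25 - x 19 * x 23"
  "grad x 10 = - x 0 * x 9 - x 5 * x 13 - x 8 * x 11 + x 18 * x 26 - x 20 * x 24"
  "grad x 11 = - x 1 * x 12 - x 3 * x 14 - x 8 * x 10 - x 15 * x 25 + x 19 * x 21"
  "grad x 12 = - x 1 * x 11 - x 4 * x 13 - x 7 * x 9 - x 16 * x 26 + x 20 * x 22"
  "grad x 13 = - x 2 * x 14 - x 4 * x 12 - x 5 * x 10 + x 15 * x 23 - x 17 * x 21"
  "grad x 14 = - x 2 * x 13 - x 3 * x 11 - x 6 * x 9 + x 16 * x 24 - x 18 * x 22"
  "grad x 15 = - x 0 * x 16 - x 6 * x 20 - x 11 * x 25 - x 7 * x 18 + x 13 * x 23"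
  "grad x 16 = - x 0 * x 15 - x 5 * x 19 - x 12 * x 26 - x 8 * x 17 + x 14 * x 24"
  "grad x 17 = - x 1 * x 18 - x 3 * x 20 + x 9 * x 25 - x 8 * x 16 - x 13 * x 21"
  "grad x 18 = - x 1 * x 17 - x 4 * x 19 + x 10 * x 26 - x 7 * x 15 - x 14 * x 22"
  "grad x 19 = - x 2 * x 20 - x 4 * x 18 - x 9 * x 23 - x 5 * x 16 + x 11 * x 21"
  "grad x 20 = - x 2 * x 19 - x 3 * x 17 - x 10 * x 24 - x 6 * x 15 + x 12 * x 22"
  "grad x 21 = - x 0 * x 22 - x 6 * x 26 + x 11 * x 19 - x 13 * x 17 - x 7 * x 24"
  "grad x 22 = - x 0 * x 21 - x 5 * x 25 + x 12 * x 20 - x 14 * x 18 - x 8 * x 23"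
  "grad x 23 = - x 1 * x 24 - x 3 * x 26 - x 9 * x 19 + x 13 * x 15 - x 8 * x 22"
  "grad x 24 = - x 1 * x 23 - x 4 * x 25 - x 10 * x 20 + x 14 * x 16 - x 7 * x 21"
  "grad x 25 = - x 2 * x 26 - x 4 * x 24 + x 9 * x 17 - x 11 * x 15 - x 5 * x 22"
  "grad x 26 = - x 2 * x 25 - x 3 * x 23 + x 10 * x 18 - x 12 * x 16 - x 6 * x 21"
  by (simp_all add: grad_def triads_def)

lemma cub_eq: "cub x = x 0 * x 1 * x 2 - x 0 * x 3 * x 4 - x 1 * x 5 * x 6 - x 2 * x 7 * x 8 - x 0 * x 9 * x 10 - x 1 * x 11 * x 12 - x 2 * x 13 * x 14 - x 0 * x 15 * x 16 - x 1 * x 17 * x 18 - x 2 * x 19 * x 20 - x 0 * x 21 * x 22 - x 1 * x 23 * x 24 - x 2 * x 25 * x 26 + x 3 * x 5 * x 7 - x 3 * x 11 * x 14 - x 3 * x 17 * x 20 - x 3 * x 23 * x 26 + x 4 * x 6 * x 8 - x 4 * x 12 * x 13 - x 4 * x 18 * x 19 - x 4 * x 24 * x 25 - x 6 * x 9 * x 14 - x 7 * x 9 * x 12 + x 9 * x 17 * x 25 - x 9 * x 19 * x 23 - x 5 * x 10 * x 13 - x 8 * x 10 * x 11 + x 10 * x 18 * x 26 - x 10 * x 20 * x 24 - x 6 * x 15 * x 20 - x 11 * x 15 * x 25 - x 7 * x 15 * x 18 + x 13 * x 15 * x 23 - x 5 * x 16 * x 19 - x 12 * x 16 * x 26 - x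 8 * x 16 * x 17 + x 14 * x 16 * x 24 - x 6 * x 21 * x 26 + x 11 * x 19 * x 21 - x 13 * x 17 * x 21 - x 7 * x 21 * x 24 - x 5 * x 22 * x 25 + x 12 * x 20 * x 22 - x 14 * x 18 * x 22 - x 8 * x 22 * x 23"
  by (simp add: cub_def triads_def)

text \<open>Verified by expanding both sides as quartic polynomials in the coordinates, which
  replaces any argument with non-associative octonion arithmetic.\<close>

lemma grad_grad_0:
  "grad (grad x) 0 = cub x * x 0"
  "grad (grad x) 1 = cub x * x 1"
  "grad (grad x) 2 = cub x * x 2"
  unfolding cub_eq grad_eqs by (simp_all add: algebra_simps)

lemma grad_grad_1:
  "grad (grad x) 3 = cub x * x 3"
  "grad (grad x) 4 = cub x * x 4"
  "grad (grad x) 5 = cub x * x 5"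
  unfolding cub_eq grad_eqs by (simp_all add: algebra_simps)

lemma grad_grad_2:
  "grad (grad x) 6 = cub x * x 6"
  "grad (grad x) 7 = cub x * x 7"
  "grad (grad x) 8 = cub x * x 8"
  unfolding cub_eq grad_eqs by (simp_all add: algebra_simps)

lemma grad_grad_3:
  "grad (grad x) 9 = cub x * x 9"
  "grad (grad x) 10 = cub x * x 10"
  "grad (grad x) 11 = cub x * x 11"
  unfolding cub_eq grad_eqs by (simp_all add: algebra_simps)

lemma grad_grad_4:
  "grad (grad x) 12 = cub x * x 12"
  "grad (grad x) 13 = cub x * x 13"
  "grad (grad x) 14 = cub x * x 14"
  unfolding cub_eq grad_eqs by (simp_all add: algebra_simps)

lemma grad_grad_5:
  "grad (grad x) 15 = cub x * x 15"
  "grad (grad x) 16 = cub x * x 16"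
  "grad (grad x) 17 = cub x * x 17"
  unfolding cub_eq grad_eqs by (simp_all add: algebra_simps)

lemma grad_grad_6:
  "grad (grad x) 18 = cub x * x 18"
  "grad (grad x) 19 = cub x * x 19"
  "grad (grad x) 20 = cub x * x 20"
  unfolding cub_eq grad_eqs by (simp_all add: algebra_simps)

lemma grad_grad_7:
  "grad (grad x) 21 = cub x * x 21"
  "grad (grad x) 22 = cub x * x 22"
  "grad (grad x) 23 = cub x * x 23"
  unfolding cub_eq grad_eqs by (simp_all add: algebra_simps)

lemma grad_grad_8:
  "grad (grad x) 24 = cub x * x 24"
  "grad (grad x) 25 = cub x * x 25"
  "grad (grad x) 26 = cub x * x 26"
  unfolding cub_eq grad_eqs by (simp_all add: algebra_simps)


lemma less_27: "i < 27 \<longleftrightarrow> i \<in> {0, 1, 2, 3, 4, 5, 6, 7, 8, 9, 10, 11, 12, 13, 14, 15, 16, 17, 18, 19, 20, 21, 22, 23, 24, 25, 26}" for i :: nat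
  unfolding lessThan_iff[symmetric] by (simp add: lessThan_nat_numeral lessThan_Suc del: lessThan_iff) blast

lemma grad_grad: "i < 27 \<Longrightarrow> grad (grad x) i = cub x * x i"
  unfolding less_27 insert_iff empty_iff
  by (elim disjE FalseE) (simp_all only: grad_grad_0 grad_grad_1 grad_grad_2 grad_grad_3 grad_grad_4 grad_grad_5 grad_grad_6 grad_grad_7 grad_grad_8)

lemma triads_distinct: "(s, a, b, c) \<in> set triads \<Longrightarrow> a \<noteq> b \<and> a \<noteq> c \<and> b \<noteq> c"
proof -
  have "\<forall>(s, a, b, c)\<in>set triads. a \<noteq> b \<and> a \<noteq> c \<and> b \<noteq> c" by (simp add: triads_def)
  then show "(s, a, b, c) \<in> set triads \<Longrightarrow> a \<noteq> b \<and> a \<noteq> c \<and> b \<noteq> c" by blast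
qed

text \<open>Makes vectors supported below 9 or 15 closed under \<open>grad\<close>, so that the
  identity in 27 variables restricts to the two smaller cases.\<close>

lemma triads_closed:
  assumes "n \<in> {9, 15, 27}" "(s, a, b, c) \<in> set triads"
  shows "(a < n \<longrightarrow> b < n \<longrightarrow> c < n) \<and> (a < n \<longrightarrow> c < n \<longrightarrow> b < n) \<and> (b < n \<longrightarrow> c < n \<longrightarrow> a < n)"
proof -
  have "\<forall>(s, a, b, c)\<in>set triads. (a < n \<longrightarrow> b < n \<longrightarrow> c < n) \<and> (a < n \<longrightarrow> c < n \<longrightarrow> b < n) \<and> (b < n \<longrightarrow> c < n \<longrightarrow> a < n)"
    using assms(1) unfolding insert_iff empty_iff by (elim disjE FalseE) (simp_all add: triads_def)
  then show ?thesis using assms(2) by blast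
qed

text \<open>The polarisation of \<open>cub\<close> without the factor 1/6, hence the factors 2 and 6
  in \<open>tri_grad\<close> and \<open>tri_cub\<close>.\<close>

definition tri :: "(nat \<Rightarrow> real) \<Rightarrow> (nat \<Rightarrow> real) \<Rightarrow> (nat \<Rightarrow> real) \<Rightarrow> real" where
  "tri x y z = (\<Sum>(s, a, b, c)\<leftarrow>triads. s * (x a * y b * z c + x a * y c * z b + x b * y a * z c
     + x b * y c * z a + x c * y a * z b + x c * y b * z a))"

lemma tri_cong:
  assumes "\<And>s a b c. (s, a, b, c) \<in> set triads \<Longrightarrow> F s a b c = G s a b c"
  shows "(\<Sum>(s, a, b, c)\<leftarrow>triads. F s a b c) = (\<Sum>(s, a, b, c)\<leftarrow>triads. G s a b c)"
  by (rule arg_cong[of _ _ sum_list], rule map_cong) (use assms in auto)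

lemma tri_sym: "tri x y z = tri y x z" "tri x y z = tri x z y"
  unfolding tri_def split_def
  by (intro arg_cong[of _ _ sum_list] map_cong refl; simp add: algebra_simps)+

lemma tri_add: "tri x y (\<lambda>i. z i + z' i) = tri x y z + tri x y z'"
  unfolding tri_def split_def sum_list_addf[symmetric]
  by (intro arg_cong[of _ _ sum_list] map_cong refl) (simp add: algebra_simps)

lemma tri_scale: "tri x y (\<lambda>i. r * z i) = r * tri x y z"
  unfolding tri_def split_def sum_list_const_mult[symmetric]
  by (intro arg_cong[of _ _ sum_list] map_cong refl) (simp add: algebra_simps)

lemma grad_scale: "grad (\<lambda>i. r * x i) i = r\<^sup>2 * grad x i"
  unfolding grad_def split_def sum_list_const_mult[symmetric]
  by (intro arg_cong[of _ _ sum_list] map_cong refl) (simp add: algebra_simps power2_eq_square)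

lemma tri_grad: "tri x x (coord (unit i)) = 2 * grad x i"
  unfolding tri_def grad_def split_def sum_list_const_mult[symmetric]
  by (intro arg_cong[of _ _ sum_list] map_cong refl) (auto simp: algebra_simps)

lemma tri_cub: "tri x x x = 6 * cub x"
  unfolding tri_def cub_def split_def sum_list_const_mult[symmetric]
  by (intro arg_cong[of _ _ sum_list] map_cong refl) (simp add: algebra_simps)

lemma tri_unit_unit: "tri (coord (unit i)) (coord (unit i)) z = 0"
proof -
  have "tri (coord (unit i)) (coord (unit i)) z = (\<Sum>(s, a, b, c)\<leftarrow>triads. 0)"
    unfolding tri_def by (rule tri_cong) (use triads_distinct in auto)
  then show ?thesis by (simp add: split_def)
qed

text \<open>The norm of an off-diagonal entry is a sum of products of coordinates with indices 2k+1
  and 2k+2, so the coordinates are null and come in pairs. The involution exchanges each pair and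
  fixes the diagonal.\<close>

definition partner :: "nat \<Rightarrow> nat" where
  "partner i = (if i < 3 then i else if odd i then i + 1 else i - 1)"

lemma partner_partner [simp]: "partner (partner i) = i"
  by (auto simp: partner_def) presburger

lemma partner_less: "n \<in> {9, 15, 27} \<Longrightarrow> i < n \<Longrightarrow> partner i < n"
  by (auto simp: partner_def elim!: oddE)

lemma partner_eq [simp]: "partner i = i \<longleftrightarrow> i < 3"
  by (auto simp: partner_def)

lemma partner_less_3 [simp]: "partner i < 3 \<longleftrightarrow> i < 3"
  by (auto simp: partner_def) presburger

lemma partner_numeral:
  "partner 0 = 0" "partner 1 = 1" "partner 2 = 2" "partner 3 = 4" "partner 4 = 3" "partner 5 = 6" "partner 6 = 5"
  "partner 7 = 8" "partner 8 = 7" "partner 9 = 10" "partner 10 = 9" "partner 11 = 12" "partner 12 = 11"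
  "partner 13 = 14" "partner 14 = 13" "partner 15 = 16" "partner 16 = 15" "partner 17 = 18" "partner 18 = 17"
  "partner 19 = 20" "partner 20 = 19" "partner 21 = 22" "partner 22 = 21" "partner 23 = 24" "partner 24 = 23"
  "partner 25 = 26" "partner 26 = 25" "partner (Suc 0) = Suc 0"
  by (simp_all add: partner_def)

lemma cub_partner: "cub (\<lambda>i. x (partner i)) = cub x"
  unfolding cub_eq partner_numeral by (simp add: algebra_simps)

text \<open>For the identity matrix the Freudenthal product with x is tr(x) times the identity minus
  x; \<open>partner\<close> enters because the product is dualised by the Euclidean inner
  product.\<close>

lemma tri_diagonal:
  assumes "i < 27"
  shows "tri (\<lambda>j. if j < 3 then r else 0) x (coord (unit i)) = r * ((if i < 3 then x 0 + x 1 + x 2 else 0) - x (partner i))"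
  using assms unfolding less_27 insert_iff empty_iff
  by (elim disjE FalseE) (simp_all add: tri_def triads_def partner_numeral algebra_simps)

text \<open>Coordinates beyond n are cut off so that the form vanishes on vectors supported there,
  as \<open>trilinear_algebra\<close> requires.\<close>

definition trunc :: "nat \<Rightarrow> fsvec \<Rightarrow> nat \<Rightarrow> real" where
  "trunc n x i = (if i < n then coord x i else 0)"

lemma trunc_Rn: "x \<in> Rn n \<Longrightarrow> trunc n x = coord x"
  by (auto simp: trunc_def Rn_def fun_eq_iff not_less)

definition cartan_mult :: "nat \<Rightarrow> fsvec \<Rightarrow> fsvec \<Rightarrow> fsvec" where
  "cartan_mult n x y = (\<Sum>k<n. tri (trunc n x) (trunc n y) (trunc n (unit k)) *\<^sub>R unit k)"

definition cartan_cubic :: "nat \<Rightarrow> rvec \<Rightarrow> real" where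
  "cartan_cubic n v = inner (cartan_mult n (to_fs v) (to_fs v)) (to_fs v)"

lemma linear_tri: "linear (\<lambda>z. tri (trunc n x) (trunc n y) (trunc n z))"
proof (rule linearI)
  have "trunc n (z + z') = (\<lambda>i. trunc n z i + trunc n z' i)" for z z' by (auto simp: trunc_def)
  then show "tri (trunc n x) (trunc n y) (trunc n (z + z')) =
      tri (trunc n x) (trunc n y) (trunc n z) + tri (trunc n x) (trunc n y) (trunc n z')" for z z'
    by (simp add: tri_add)
  have "trunc n (r *\<^sub>R z) = (\<lambda>i. r * trunc n z i)" for r z by (auto simp: trunc_def)
  then show "tri (trunc n x) (trunc n y) (trunc n (r *\<^sub>R z)) = r *\<^sub>R tri (trunc n x) (trunc n y) (trunc n z)" for r z
    by (simp add: tri_scale)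
qed

lemma cartan_mult:
  shows cartan_comm_algebra: "comm_algebra (cartan_mult n)"
    and cartan_mult_space: "cartan_mult n x y \<in> Rn n"
    and cartan_mult_inner: "inner (cartan_mult n x y) z = tri (trunc n x) (trunc n y) (trunc n z)"
proof -
  have supp: "tri (trunc n x) (trunc n y) (trunc n z) = 0" if "\<And>i. i < n \<Longrightarrow> coord z i = 0" for x y z
  proof -
    have "trunc n z = (\<lambda>i. 0 * trunc n z i)" using that by (auto simp: trunc_def)
    then show ?thesis by (metis tri_scale mult_zero_left)
  qed
  note t = trilinear_algebra[of "\<lambda>x y z. tri (trunc n x) (trunc n y) (trunc n z)" n, OF linear_tri tri_sym supp]
  have eq: "cartan_mult n = (\<lambda>x y. \<Sum>k<n. tri (trunc n x) (trunc n y) (trunc n (unit k)) *\<^sub>R unit k)"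
    by (simp add: cartan_mult_def fun_eq_iff)
  show "comm_algebra (cartan_mult n)" unfolding eq by (rule t(1))
  show "cartan_mult n x y \<in> Rn n" unfolding eq by (rule t(2))
  show "inner (cartan_mult n x y) z = tri (trunc n x) (trunc n y) (trunc n z)" unfolding eq by (rule t(3))
qed

lemma cartan_cubic_algebra: "cubic_algebra n (cartan_cubic n) (cartan_mult n)"
  by (simp add: cubic_algebra_def cartan_comm_algebra cartan_mult_space cartan_cubic_def)

lemma cartan_mult_coord: "i < n \<Longrightarrow> coord (cartan_mult n x y) i = tri (trunc n x) (trunc n y) (coord (unit i))"
  using cartan_mult_inner[of n x y "unit i"] trunc_Rn[of "unit i" n] by simp

lemma cartan_cube: "x \<in> Rn n \<Longrightarrow> inner (cartan_mult n x x) x = 6 * cub (coord x)"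
  by (simp add: cartan_mult_inner trunc_Rn tri_cub)

lemma cartan_square_coord:
  assumes n: "n \<in> {9, 15, 27}" and x: "x \<in> Rn n"
  shows "coord (cartan_mult n x x) i = 2 * grad (coord x) i"
proof (cases "i < n")
  case True
  then show ?thesis using x by (simp add: cartan_mult_coord trunc_Rn tri_grad)
next
  case False
  have "grad (coord x) i = (\<Sum>(s, a, b, c)\<leftarrow>triads. 0)"
    unfolding grad_def
  proof (rule tri_cong)
    fix s a b c assume "(s, a, b, c) \<in> set triads"
    note cl = triads_closed[OF n this] triads_distinct[OF this]
    show "s * ((if i = a then coord x b * coord x c else 0) + (if i = b then coord x a * coord x c else 0)
      + (if i = c then coord x a * coord x b else 0)) = 0"
      using cl False x by (auto simp: Rn_def not_less)
  qed
  moreover have "coord (cartan_mult n x x) i = 0" using cartan_mult_space[of n x x] False by (auto simp: Rn_def)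
  ultimately show ?thesis by (simp add: split_def)
qed

lemma cartan_square_square:
  assumes n: "n \<in> {9, 15, 27}" and x: "x \<in> Rn n"
  shows "cartan_mult n (cartan_mult n x x) (cartan_mult n x x) = (4/3 * inner (cartan_mult n x x) x) *\<^sub>R x"
proof (rule fsvec_eqI)
  fix i
  let ?q = "cartan_mult n x x"
  have c: "coord ?q = (\<lambda>i. 2 * grad (coord x) i)" using cartan_square_coord[OF n x] by auto
  show "coord (cartan_mult n ?q ?q) i = coord ((4/3 * inner ?q x) *\<^sub>R x) i"
  proof (cases "i < n")
    case True
    then have "i < 27" using n by auto
    then show ?thesis
      by (simp add: cartan_square_coord[OF n cartan_mult_space] c grad_scale grad_grad cartan_cube[OF x])
  next
    case False
    then show ?thesis using x cartan_mult_space[of n ?q ?q] by (auto simp: Rn_def)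
  qed
qed

text \<open>No monomial contains a variable twice, so all diagonal entries of the multiplication are
  0.\<close>

lemma cartan_trace: "trace_on (unit ` {..<n}) (cartan_mult n x) = 0"
proof -
  have "tri (trunc n x) (coord (unit i)) (coord (unit i)) = 0" for i
    using tri_unit_unit[of i "trunc n x"] tri_sym by metis
  then show ?thesis unfolding trace_unit by (intro sum.neutral) (auto simp: cartan_mult_coord trunc_Rn)
qed

lemma cartan_exceptional:
  assumes n: "n \<in> {9, 15, 27}"
  shows "exceptional n (cartan_cubic n)"
proof -
  let ?m = "cartan_mult n"
  interpret comm_algebra ?m by (rule cartan_comm_algebra)
  \<comment> \<open>These select the monomials in the coordinates 0, 1, 2 and 3, 5, 7, both with
    coefficient 1 and present already for n = 9.\<close>
  let ?x = "unit 0 + unit 1 + unit 2" and ?y = "unit 3 + unit 5 + unit 7"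
  have sp: "?x \<in> Rn n" "?y \<in> Rn n" using n by (auto simp: Rn_def)
  have c: "inner (?m ?x ?x) ?x = 6" "inner (?m ?y ?y) ?y = 6"
    unfolding sp[THEN cartan_cube] by (simp_all add: cub_eq)
  have "cubic_form n (cartan_cubic n)"
    unfolding cartan_cubic_def
    by (rule trilinear_cubic_form[of "\<lambda>x y z. inner (?m x y) z"]; rule linearI)
      (simp_all add: inner_add_left inner_add_right)
  moreover have "\<exists>v\<in>carrier_vec n. cartan_cubic n v \<noteq> 0"
    using c(1) sp(1) by (intro bexI[of _ "of_fs n ?x"]) (simp_all add: cartan_cubic_def)
  \<comment> \<open>The trace term vanishes and the other contributes -54 * (4/3) = -72.\<close>
  moreover have "hsiang_op n (cartan_cubic n) v = - 72 * (v \<bullet> v) * cartan_cubic n v" if v: "v \<in> carrier_vec n" for v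
  proof -
    define x where "x = to_fs v"
    have x: "x \<in> Rn n" using v by (simp add: x_def to_fs_Rn)
    have "hsiang_op n (cartan_cubic n) v = - 54 * inner (?m x x) (?m x (?m x x))"
      using hsiang_op_algebra[OF cartan_cubic_algebra v] by (simp add: cartan_trace x_def)
    also have "inner (?m x x) (?m x (?m x x)) = inner x (?m (?m x x) (?m x x))"
      by (rule mult_selfadjoint[symmetric, THEN trans]) (simp add: mult_assoc[symmetric] mult_commute[of "?m x x" x] inner_commute[of x "?m (?m x x) (?m x x)"])
    also have "\<dots> = 4/3 * inner (?m x x) x * inner x x"
      by (simp add: cartan_square_square[OF n x])
    finally show ?thesis
      using to_fs_inner[OF v v] by (simp add: cartan_cubic_def[of n v] x_def)
  qed
  ultimately have "radial_eigencubic n (cartan_cubic n)"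
    unfolding radial_eigencubic_def by (intro conjI exI[of _ "- 72"]) auto
  moreover have "\<not> (\<exists>h q A. clifford_system h q A \<and> n = q + 1 + 2 * h \<and> congruent n (cartan_cubic n) (clifford_cubic h q A))"
  proof (rule not_clifford[OF cartan_cubic_algebra, where k = "4/3", OF cartan_square_square[OF n] _ sp])
    show "?m (unit i) (unit i) = 0" if "i < n" for i
      by (rule inner_eqI) (use that in \<open>simp add: cartan_mult_inner trunc_Rn tri_unit_unit\<close>)
    show "inner (?m ?x ?x) ?x \<noteq> 0" "inner (?m ?y ?y) ?y \<noteq> 0" using c by auto
    show "coord ?x i = 0 \<or> coord ?y i = 0" for i by simp
  qed
  ultimately show ?thesis unfolding exceptional_def by blast
qed

lemma cartan_has_type:
  assumes n: "n \<in> {9, 15, 27}" and n2: "2 * n2 = n + 1"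
  shows "has_type n (cartan_cubic n) (0, n2)"
proof -
  \<comment> \<open>The identity matrix scaled to unit length. S permutes coordinates by
    \<open>partner\<close>, which fixes exactly the three diagonal ones; hence its trace is
    3.\<close>
  define e where "e = (1 / sqrt 3) *\<^sub>R (unit 0 + unit 1 + unit 2)"
  define S where "S = (\<lambda>x. \<Sum>i<n. coord x (partner i) *\<^sub>R unit i)"
  have n3: "3 < n" using n by auto
  have sqrt3: "sqrt 3 * (sqrt 3 * t) = 3 * t" for t by (simp flip: mult.assoc)
  have ec: "coord e = (\<lambda>i. if i < 3 then 1 / sqrt 3 else 0)"
    by (rule ext) (auto simp: e_def less_Suc_eq numeral_3_eq_3)
  have e: "e \<in> Rn n" using n3 by (auto simp: Rn_def ec)
  have ex: "inner e x = (coord x 0 + coord x 1 + coord x 2) / sqrt 3" for x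
    by (simp add: e_def inner_add_left field_simps)
  have ee: "inner e e = 1" unfolding ex by (simp add: ec field_simps)
  have Sc: "coord (S x) i = (if i < n then coord x (partner i) else 0)" for x i
    by (auto simp: S_def if_distrib[of "\<lambda>t. _ * t"] not_less cong: if_cong)
  have Ssp: "S x \<in> Rn n" for x by (simp add: Rn_def Sc)
  note pl = partner_less[OF n]
  have Sx: "coord (S x) = (\<lambda>i. coord x (partner i))" if "x \<in> Rn n" for x
  proof
    fix i
    have "n \<le> partner i" if "\<not> i < n" using pl[of "partner i"] that by (metis linorder_not_less partner_partner)
    then show "coord (S x) i = coord x (partner i)" using that by (auto simp: Sc Rn_def)
  qed
  show ?thesis
  \<comment> \<open>k is the value of the cubic at e, namely 6 / (sqrt 3)^3.\<close>
  proof (rule has_type_involution[OF cartan_cubic_algebra e ee, where S = S and k = "2 / sqrt 3"])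
    show "linear S"
      by (rule linearI; rule fsvec_eqI) (simp_all add: Sc)
    show "S x \<in> Rn n" for x by (rule Ssp)
    show "S (S x) = x" if "x \<in> Rn n" for x
      by (rule fsvec_eqI) (simp add: Sx[OF Ssp] Sx[OF that])
    show "inner (S x) y = inner x (S y)" if "x \<in> Rn n" "y \<in> Rn n" for x y
      unfolding inner_Rn[OF Ssp] inner_Rn[OF that(1)]
      by (rule sum.reindex_bij_witness[of _ partner partner]) (auto simp: pl Sc)
    show "S e = e" by (rule fsvec_eqI) (simp add: Sx[OF e], simp add: ec)
    show "trace_on (unit ` {..<n}) S = 3"
    proof -
      have "trace_on (unit ` {..<n}) S = (\<Sum>i<n. if i < 3 then 1 else 0)"
        unfolding trace_unit by (intro sum.cong) (auto simp: Sc)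
      also have "\<dots> = real (card ({..<n} \<inter> {i. i < 3}))" by (simp add: sum.If_cases)
      also have "{..<n} \<inter> {i. i < 3} = {..<3}" using n3 by auto
      finally show ?thesis by simp
    qed
    show "2 / sqrt 3 \<noteq> (0::real)" by simp
    show "cartan_mult n e x = (2 / sqrt 3) *\<^sub>R ((3/2 * inner e x) *\<^sub>R e - (1/2) *\<^sub>R S x)" if x: "x \<in> Rn n" for x
    proof (rule fsvec_eqI)
      fix i
      show "coord (cartan_mult n e x) i = coord ((2 / sqrt 3) *\<^sub>R ((3/2 * inner e x) *\<^sub>R e - (1/2) *\<^sub>R S x)) i"
      proof (cases "i < n")
        case True
        then have "i < 27" using n by auto
        then have "coord (cartan_mult n e x) i =
            1 / sqrt 3 * ((if i < 3 then coord x 0 + coord x 1 + coord x 2 else 0) - coord x (partner i))"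
          using True x e by (simp add: cartan_mult_coord trunc_Rn tri_diagonal ec)
        also have "\<dots> = coord ((2 / sqrt 3) *\<^sub>R ((3/2 * inner e x) *\<^sub>R e - (1/2) *\<^sub>R S x)) i"
          unfolding ex coord_simps ec Sx[OF x] by (simp add: field_simps sqrt3)
        finally show ?thesis .
      next
        case False
        then have "coord z i = 0" if "z \<in> Rn n" for z using that by (auto simp: Rn_def)
        then show ?thesis using cartan_mult_space e Ssp by simp
      qed
    qed
    show "inner (cartan_mult n (S x) (S x)) (S x) = inner (cartan_mult n x x) x" if "x \<in> Rn n" for x
      by (simp add: cartan_cube[OF Ssp] cartan_cube[OF that] Sx[OF that] cub_partner)
    show "2 * n2 = n + 1" by (rule n2)
  qed
qed

theorem proposition6p1:
  fixes n2 :: nat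
  shows "(\<exists>n f. exceptional n f \<and> has_type n f (0, n2)) \<longleftrightarrow> n2 \<in> {5, 8, 14}"
proof
  show "n2 \<in> {5, 8, 14}" if "\<exists>n f. exceptional n f \<and> has_type n f (0, n2)"
    using that exceptional_type by blast
  assume "n2 \<in> {5, 8, 14}"
  then obtain n :: nat where "n \<in> {9, 15, 27}" "2 * n2 = n + 1" by auto
  then show "\<exists>n f. exceptional n f \<and> has_type n f (0, n2)"
    using cartan_exceptional cartan_has_type by blast
qed

end
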